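(* Let $\theta>1$ and let $V$ be twice continuously differentiable on $[0,+\infty)$ with $\lim_{x\to+\infty}V(x)/\log x=+\infty$. Suppose a probability measure $\mu$ is supported on one interval $[0,b]$, has a continuous density $\psi$ on $(0,b)$, and satisfies, for some $\ell\in\mathbb R$, $$\int\log|x-y|d\mu(y)+\int\log|x^\theta-y^\theta|d\mu(y)-V(x)=\ell\quad\text{for }x\in\operatorname{supp}\mu,$$ $$\int\log|x-y|d\mu(y)+\int\log|x^\theta-y^\theta|d\mu(y)-V(x)\le\ell\quad\text{for }x\in[0,+\infty).$$ Then $b=c\frac{(1+\theta)^{1+1/\theta}}{\theta}$, where $c>0$ solves $$\frac{1}{2\pi i}\oint_\gamma\frac{V'(J_c(s))J_c(s)}{s}\,ds=1+\theta,$$ and for $x\in(0,b)$, $$\psi(x)=\frac{1}{2\pi^2x}\int_0^b\big(V''(y)y+V'(y)\big)\log\left|\frac{I_+(y)-I_-(x)}{I_+(y)-I_+(x)}\right|dy.$$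
   Context: For $c>0$, $J_c(s)=c(s+1)\left(\frac{s+1}{s}\right)^{1/\theta}$, with the branch analytic in $\mathbb C\setminus[-1,0]$ and such that $J_c(s)\sim cs$ as $s\to\infty$. Its real critical points are $-1$ and $s_b=1/\theta$, with $J_c(-1)=0$ and $J_c(1/\theta)=c(1+\theta)^{1+1/\theta}/\theta$. There are two complex conjugate arcs $\gamma_1$ (upper half-plane) and $\gamma_2$ (lower half-plane) joining $-1$ and $1/\theta$ on which $J_c$ is real; each is mapped bijectively onto $[0,J_c(1/\theta)]$ by $J_c$. $\gamma=\gamma_1\cup\gamma_2$ is oriented counterclockwise. For $x$ in that interval, $I_+(x)\in\gamma_1$ and $I_-(x)\in\gamma_2$ denote the preimages of $x$ under $J_c$. *)

theory Defs
  imports "HOL-Complex_Analysis.Complex_Analysis" "HOL-Probability.Probability"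
begin

text \<open>J_c(s) = c (s+1) ((s+1)/s)^(1/theta), principal branch of the power:
  analytic off [-1,0] and asymptotic to c s at infinity.\<close>
definition Jc :: "real \<Rightarrow> real \<Rightarrow> complex \<Rightarrow> complex" where
  "Jc c \<theta> s = of_real c * (s + 1) * ((s + 1) / s) powr (complex_of_real (1 / \<theta>))"

text \<open>J_c(1/theta), the right endpoint b.\<close>
definition Jmax :: "real \<Rightarrow> real \<Rightarrow> real" where
  "Jmax c \<theta> = c * (1 + \<theta>) powr (1 + 1 / \<theta>) / \<theta>"

text \<open>I_+(x): the preimage of x under J_c on the upper arc gamma_1
  (open upper half plane together with the endpoints -1 and 1/theta).\<close>
definition Iplus :: "real \<Rightarrow> real \<Rightarrow> real \<Rightarrow> complex" where
  "Iplus c \<theta> x = (THE s. (Im s > 0 \<or> s = -1 \<or> s = complex_of_real (1 / \<theta>))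
                        \<and> Jc c \<theta> s = complex_of_real x)"

text \<open>I_-(x): the preimage on the lower arc gamma_2 (complex conjugate).\<close>
definition Iminus :: "real \<Rightarrow> real \<Rightarrow> real \<Rightarrow> complex" where
  "Iminus c \<theta> x = cnj (Iplus c \<theta> x)"

text \<open>The closed contour gamma = gamma_1 \<union> gamma_2, counterclockwise:
  first gamma_1 from 1/theta to -1, then gamma_2 from -1 to 1/theta.\<close>
definition gamma_path :: "real \<Rightarrow> real \<Rightarrow> real \<Rightarrow> complex" where
  "gamma_path c \<theta> t =
     (if t \<le> 1/2 then Iplus c \<theta> (Jmax c \<theta> * (1 - 2 * t))
      else Iminus c \<theta> (Jmax c \<theta> * (2 * t - 1)))"

definition mu_support :: "real measure \<Rightarrow> real set" where
  "mu_support M = {x. \<forall>e>0. emeasure M (ball x e) > 0}"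

end

theory Submission
  imports Defs "HOL-Real_Asymp.Real_Asymp"
begin

text \<open>
  Around the origin the curve \<gamma> has the polar equation
  r = sin (\<beta> / (1 + \<theta>)) / sin (\<theta> \<beta> / (1 + \<theta>)) for -\<pi> \<le> \<beta> \<le> \<pi>, so its inside D is star-shaped, and
  s \<mapsto> 1/s carries its outside to the inside of the same kind of curve with 1/\<theta> in place of \<theta>.
  For a point mass at z in (0,b) the function Ln ((1 + s)^(1+\<theta>) - (z/c)^\<theta> s) is holomorphic on D, and
  Ln ((1 + t)^(1+1/\<theta>) - (z/c) t), t = 1/s, is holomorphic outside; up to a constant, their boundary values on
  \<gamma> add up to log |x - z| + log |x^\<theta> - z^\<theta>| with x = J(s).  Cauchy's formula with kernel 1/(\<xi> - s)^2
  therefore evaluates the integral of this logarithmic kernel along \<gamma> in terms of 1/(J(s) - z).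

  Integrating over z against \<mu> (Fubini) and inserting the equality in the variational conditions gives, for s outside \<gamma>
  and w = J(s), after integration by parts,
  \<integral> w/(w - z) d\<mu>(z) = 1 + C/(s - 1/\<theta>) - (2\<pi>i)^(-1) \<integral> V'(J(\<xi>)) J(\<xi>) / (\<xi> - s) d\<xi> over \<gamma>,
  with a real constant C that vanishes exactly if the asserted contour condition holds.  Taking imaginary parts and
  letting s tend to the curve, the left-hand side tends to -\<pi> x \<psi>(x), which is the density formula plus a multiple of C.
  If C were nonzero, \<psi> would tend to plus or minus infinity at b: the negative sign contradicts \<psi> \<ge> 0 and the positive
  one contradicts the variational inequality to the right of b.
\<close>


section \<open>The curve in polar coordinates\<close>

text \<open>The polar equation is the law of sines in the triangle 0, -1, s under the condition arg
  s = (1 + T) arg (1 + s), which makes (1 + s)^(1+T) / s positive. On the inside of the curve the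
  defining functions avoid the negative real axis, so principal logarithms suffice and no branch has
  to be followed along a path. The kernel 1/(\<xi> - s)^2 has a single-valued primitive, so it
  annihilates constants, in particular the multiple of log c produced by the logarithms and the
  Lagrange constant. The logarithms are singular on the curve itself. Cauchy's formula is therefore
  proved on the shrunken copies r \<xi>, r < 1, where it reduces to the fundamental theorem of
  calculus, and is carried to the curve by dominated convergence. The point s stays off the curve
  until the very end, so Fubini needs only bounded potentials and no principal values occur. The
  number c is read off from b at the start. The contour condition is then a statement to be proved,
  and the constant C is what stands in its way. The density may blow up at 0 and b, so near the
  endpoints all estimates are made against the measure and not against its density.\<close>

definition rho :: "real \<Rightarrow> real \<Rightarrow> real" where
  "rho T b = (if b = 0 then 1 / T else sin (b / (1 + T)) / sin (T * b / (1 + T)))"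

text \<open>At b = 0 the formula for the derivative degenerates to 0/0 = 0; it is only used for b \<noteq> 0.\<close>
definition drho :: "real \<Rightarrow> real \<Rightarrow> real" where
  "drho T b = (cos (b / (1 + T)) / (1 + T) * sin (T * b / (1 + T))
     - sin (b / (1 + T)) * (cos (T * b / (1 + T)) * T / (1 + T))) / (sin (T * b / (1 + T)))\<^sup>2"

definition xi :: "real \<Rightarrow> real \<Rightarrow> complex" where
  "xi T b = of_real (rho T b) * cis b"

definition dxi :: "real \<Rightarrow> real \<Rightarrow> complex" where
  "dxi T b = (of_real (drho T b) + \<i> * of_real (rho T b)) * cis b"

text \<open>The true order is three; order two is all that is needed against the square of a sine in
  the denominator of \<open>drho\<close>.\<close>

lemma abs_sin_minus_le: "\<bar>sin x - x\<bar> \<le> x\<^sup>2" for x :: real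
proof -
  have "\<bar>sin x - (\<Sum>m<2. sin_coeff m * x ^ m)\<bar> \<le> inverse (fact 2) * \<bar>x\<bar> ^ 2"
    by (rule Maclaurin_sin_bound)
  moreover have "(\<Sum>m<2. sin_coeff m * x ^ m) = x"
    by (simp add: sin_coeff_def numeral_2_eq_2)
  moreover have "inverse (fact 2) * \<bar>x\<bar> ^ 2 \<le> x\<^sup>2" by simp
  ultimately show ?thesis by linarith
qed

locale fc_curve =
  fixes T :: real
  assumes T_pos: "T > 0"
begin

lemma sin_q_pos: "0 < b \<Longrightarrow> b \<le> pi \<Longrightarrow> sin (T * b / (1 + T)) > 0"
proof -
  assume b: "0 < b" "b \<le> pi"
  have "T * b / (1 + T) < b" using T_pos b by (simp add: field_simps)
  then show ?thesis using T_pos b by (intro sin_gt_zero) auto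
qed

lemma sin_p_pos: "0 < b \<Longrightarrow> b \<le> pi \<Longrightarrow> sin (b / (1 + T)) > 0"
proof -
  assume b: "0 < b" "b \<le> pi"
  have "b / (1 + T) < b" using T_pos b by (simp add: field_simps)
  then show ?thesis using T_pos b by (intro sin_gt_zero) auto
qed

lemma rho_minus [simp]: "rho T (- b) = rho T b"
  by (simp add: rho_def)

lemma rho_abs: "rho T \<bar>b\<bar> = rho T b"
  by (auto simp: abs_if)

lemma sin_q_nonzero: "b \<noteq> 0 \<Longrightarrow> \<bar>b\<bar> \<le> pi \<Longrightarrow> sin (T * b / (1 + T)) \<noteq> 0"
  using sin_q_pos[of b] sin_q_pos[of "-b"] by (cases "b > 0") auto

lemma rho_pos: "\<bar>b\<bar> \<le> pi \<Longrightarrow> rho T b > 0"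
proof -
  assume b: "\<bar>b\<bar> \<le> pi"
  have "rho T \<bar>b\<bar> > 0"
  proof (cases "b = 0")
    case True then show ?thesis using T_pos by (simp add: rho_def)
  next
    case False
    then have "0 < \<bar>b\<bar>" by simp
    from sin_p_pos[OF this b] sin_q_pos[OF this b] False show ?thesis by (simp add: rho_def)
  qed
  then show ?thesis by (simp add: rho_abs)
qed

lemma rho_pi [simp]: "rho T pi = 1"
proof -
  have "T * pi / (1 + T) = pi - pi / (1 + T)" using T_pos by (simp add: field_simps)
  then have "sin (T * pi / (1 + T)) = sin (pi / (1 + T))" by (simp add: sin_diff)
  moreover have "sin (pi / (1 + T)) > 0" using sin_p_pos[of pi] by simp
  ultimately show ?thesis by (simp add: rho_def)
qed

lemma rho_has_derivative:
  assumes "b \<noteq> 0" "\<bar>b\<bar> \<le> pi"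
  shows "(rho T has_real_derivative drho T b) (at b)"
proof -
  have "((\<lambda>b. sin (b / (1 + T)) / sin (T * b / (1 + T))) has_real_derivative drho T b) (at b)"
  proof -
    have 1: "((\<lambda>b. sin (b / (1 + T))) has_real_derivative cos (b / (1 + T)) / (1 + T)) (at b)"
      using T_pos by (auto intro!: derivative_eq_intros)
    have 2: "((\<lambda>b. sin (T * b / (1 + T))) has_real_derivative cos (T * b / (1 + T)) * T / (1 + T)) (at b)"
      using T_pos by (auto intro!: derivative_eq_intros)
    show ?thesis unfolding drho_def power2_eq_square
      by (rule DERIV_divide[OF 1 2 sin_q_nonzero[OF assms]])
  qed
  then show ?thesis
  proof (rule has_field_derivative_transform_within_open[where S="- {0}"])
    show "\<And>x. x \<in> - {0} \<Longrightarrow> sin (x / (1 + T)) / sin (T * x / (1 + T)) = rho T x"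
      by (simp add: rho_def)
  qed (use assms in auto)
qed

lemma isCont_rho: "\<bar>b\<bar> \<le> pi \<Longrightarrow> isCont (rho T) b"
proof (cases "b = 0")
  case False
  then show "\<bar>b\<bar> \<le> pi \<Longrightarrow> isCont (rho T) b" using rho_has_derivative DERIV_isCont by blast
next
  case True
  have L: "((\<lambda>x. sin (k * x) / x) \<longlongrightarrow> k) (at (0::real))" for k :: real
  proof -
    have "((\<lambda>x. sin (k * x)) has_real_derivative k) (at 0)"
      by (auto intro!: derivative_eq_intros)
    then show ?thesis by (simp add: has_field_derivative_iff)
  qed
  have "((\<lambda>x. (sin ((1/(1+T)) * x) / x) / (sin ((T/(1+T)) * x) / x)) \<longlongrightarrow> (1/(1+T)) / (T/(1+T))) (at 0)"
    by (intro tendsto_divide L) (use T_pos in auto)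
  moreover have "(1/(1+T)) / (T/(1+T)) = 1 / T" using T_pos by (simp add: field_simps)
  moreover have "\<forall>\<^sub>F x in at (0::real). (sin ((1/(1+T)) * x) / x) / (sin ((T/(1+T)) * x) / x) = rho T x"
    by (auto simp: eventually_at_filter rho_def)
  ultimately have "(rho T \<longlongrightarrow> 1 / T) (at 0)"
    using tendsto_cong by fastforce
  then show "isCont (rho T) b" using True by (simp add: isCont_def rho_def)
qed

lemma continuous_on_rho: "continuous_on {-pi..pi} (rho T)"
  by (intro continuous_at_imp_continuous_on ballI isCont_rho) auto

text \<open>The quotient sin (q b) / b, continued by q at 0, is continuous and positive on [0, pi],
  so its minimum serves as the constant. The case T = 1 later bounds chords of circles from
  below.\<close>

lemma sin_q_lower: "\<exists>k>0. \<forall>b. 0 \<le> b \<longrightarrow> b \<le> pi \<longrightarrow> k * b \<le> sin (T * b / (1 + T))"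
proof -
  define q where "q = T / (1 + T)"
  have q: "0 < q" "q < 1" using T_pos by (auto simp: q_def field_simps)
  have "continuous_on {0..pi} (\<lambda>b. if b = 0 then q else sin (q * b) / b)"
  proof (intro continuous_at_imp_continuous_on ballI)
    fix x :: real
    have D: "((\<lambda>x. sin (q * x)) has_real_derivative q) (at 0)"
      by (auto intro!: derivative_eq_intros)
    show "isCont (\<lambda>b. if b = 0 then q else sin (q * b) / b) x"
    proof (cases "x = 0")
      case True
      have "((\<lambda>x. sin (q * x) / x) \<longlongrightarrow> q) (at 0)" using D by (simp add: has_field_derivative_iff)
      then have "((\<lambda>b. if b = 0 then q else sin (q * b) / b) \<longlongrightarrow> q) (at 0)"
        by (rule Lim_transform_eventually) (auto simp: eventually_at_filter)
      then show ?thesis using True by (simp add: isCont_def)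
    next
      case False
      have "isCont (\<lambda>b. sin (q * b) / b) x" using False by (intro continuous_intros) auto
      moreover have "\<forall>\<^sub>F b in nhds x. (if b = 0 then q else sin (q * b) / b) = sin (q * b) / b"
        using t1_space_nhds[OF False] by (rule eventually_mono) auto
      ultimately show ?thesis by (simp add: isCont_cong)
    qed
  qed
  moreover have "(if b = 0 then q else sin (q * b) / b) > 0" if "b \<in> {0..pi}" for b
    using that q sin_q_pos[of b] by (auto simp: q_def)
  moreover obtain b0 where "b0 \<in> {0..pi}"
    "\<forall>b\<in>{0..pi}. (if b0 = 0 then q else sin (q * b0) / b0) \<le> (if b = 0 then q else sin (q * b) / b)"
    using continuous_attains_inf[OF compact_Icc _ calculation(1)] by auto
  ultimately obtain k where k: "k > 0" "\<And>b. b \<in> {0..pi} \<Longrightarrow> k \<le> (if b = 0 then q else sin (q * b) / b)"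
    by meson
  have "k * b \<le> sin (T * b / (1 + T))" if "0 \<le> b" "b \<le> pi" for b
    using k(2)[of b] that by (cases "b = 0") (auto simp: field_simps q_def)
  then show ?thesis using k(1) by blast
qed

text \<open>Both the numerator of the derivative and its denominator vanish to second order at 0; the former
  because its two frequencies add up to 1.\<close>
lemma drho_bounded: "\<exists>M>0. \<forall>b. 0 < \<bar>b\<bar> \<longrightarrow> \<bar>b\<bar> \<le> pi \<longrightarrow> \<bar>drho T b\<bar> \<le> M"
proof -
  define q where "q = T / (1 + T)"
  define p where "p = 1 / (1 + T)"
  have q: "0 < q" "q < 1" and p: "0 < p" "p < 1" and pq: "p + q = 1"
    using T_pos by (auto simp: q_def p_def field_simps)
  obtain k where k: "k > 0" and k2': "\<And>b. 0 \<le> b \<Longrightarrow> b \<le> pi \<Longrightarrow> k * b \<le> sin (T * b / (1 + T))"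
    using sin_q_lower by blast
  have k2: "k * b \<le> sin (q * b)" if "0 < b" "b \<le> pi" for b
    using k2'[of b] that by (simp add: q_def)
  have main: "\<bar>drho T b\<bar> \<le> 2 / k\<^sup>2" if b: "0 < b" "b \<le> pi" for b
  proof -
    define n where "n = p * cos (p * b) * sin (q * b) - q * sin (p * b) * cos (q * b)"
    have eq: "drho T b = n / (sin (q * b))\<^sup>2"
      by (simp add: drho_def n_def p_def q_def field_simps)
    have "2 * n = (p - q) * sin ((p + q) * b) + (p + q) * sin ((q - p) * b)"
      by (simp add: n_def algebra_simps sin_add sin_diff)
    then have n2: "2 * n = (p - q) * sin b + sin ((q - p) * b)" using pq by simp
    have "2 * n = (p - q) * (sin b - b) + (sin ((q - p) * b) - (q - p) * b)"
      using n2 by (simp add: algebra_simps)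
    then have "\<bar>2 * n\<bar> \<le> \<bar>p - q\<bar> * \<bar>sin b - b\<bar> + \<bar>sin ((q - p) * b) - (q - p) * b\<bar>"
      by (metis abs_mult abs_triangle_ineq)
    also have "\<dots> \<le> 1 * b\<^sup>2 + ((q - p) * b)\<^sup>2"
      by (intro add_mono mult_mono abs_sin_minus_le) (use p q in auto)
    also have "((q - p) * b)\<^sup>2 \<le> 1 * b\<^sup>2"
      unfolding power_mult_distrib using p q by (intro mult_right_mono) (auto simp: abs_square_le_1)
    finally have nn: "\<bar>n\<bar> \<le> 2 * b\<^sup>2" using zero_le_power2[of b] by (simp add: abs_mult)
    have "(k * b)\<^sup>2 \<le> (sin (q * b))\<^sup>2" using k2[OF b] k b by (intro power_mono) auto
    moreover have "0 < (k * b)\<^sup>2" using k b by simp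
    ultimately have "\<bar>n\<bar> / (sin (q * b))\<^sup>2 \<le> 2 * b\<^sup>2 / (k * b)\<^sup>2"
      using nn by (intro frac_le) auto
    also have "\<dots> = 2 / k\<^sup>2" using b by (simp add: power_mult_distrib)
    finally show ?thesis by (simp add: eq abs_divide)
  qed
  have "drho T (- b) = - drho T b" for b by (simp add: drho_def diff_divide_distrib)
  then have "\<bar>drho T b\<bar> \<le> 2 / k\<^sup>2" if "0 < \<bar>b\<bar>" "\<bar>b\<bar> \<le> pi" for b
    using main[of b] main[of "-b"] that by (cases "b > 0") auto
  moreover have "2 / k\<^sup>2 > 0" using k by simp
  ultimately show ?thesis by blast
qed

lemma drho_minus [simp]: "drho T (- b) = - drho T b"
  by (simp add: drho_def diff_divide_distrib)

lemma xi_minus: "xi T (- b) = cnj (xi T b)"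
  by (simp add: xi_def cis_cnj)

lemma dxi_minus: "dxi T (- b) = - cnj (dxi T b)"
  by (simp add: dxi_def cis_cnj algebra_simps)

lemma norm_xi: "\<bar>b\<bar> \<le> pi \<Longrightarrow> cmod (xi T b) = rho T b"
  using rho_pos[of b] by (simp add: xi_def norm_mult)

lemma xi_nonzero: "\<bar>b\<bar> \<le> pi \<Longrightarrow> xi T b \<noteq> 0"
  using rho_pos[of b] by (simp add: xi_def)

lemma xi_pi [simp]: "xi T pi = -1" "xi T (-pi) = -1"
proof -
  show *: "xi T pi = -1" by (simp add: xi_def)
  show "xi T (-pi) = -1" by (subst xi_minus) (simp add: *)
qed

lemma xi_0 [simp]: "xi T 0 = of_real (1 / T)"
  by (simp add: xi_def rho_def)

lemma isCont_xi: "\<bar>b\<bar> \<le> pi \<Longrightarrow> isCont (xi T) b"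
  unfolding xi_def cis_conv_exp by (intro continuous_intros isCont_rho)

lemma continuous_on_xi: "continuous_on {-pi..pi} (xi T)"
  by (intro continuous_at_imp_continuous_on ballI isCont_xi) auto

lemma xi_has_derivative:
  assumes "b \<noteq> 0" "\<bar>b\<bar> \<le> pi"
  shows "(xi T has_vector_derivative dxi T b) (at b)"
proof -
  have 1: "((\<lambda>b. of_real (rho T b)::complex) has_vector_derivative of_real (drho T b)) (at b)"
    using rho_has_derivative[OF assms] by (simp add: has_real_derivative_iff_has_vector_derivative
         has_vector_derivative_of_real)
  have 2: "(cis has_vector_derivative (\<i> * cis b)) (at b)"
    unfolding has_vector_derivative_def by (auto intro!: derivative_eq_intros simp: scaleR_conv_of_real algebra_simps)
  show ?thesis unfolding xi_def using has_vector_derivative_mult[OF 1 2]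
    by (simp add: dxi_def algebra_simps)
qed

text \<open>In the frame rotating with \<open>cis b\<close> the angular component of the velocity is
  \<open>rho\<close>, which never vanishes.\<close>

lemma dxi_nonzero: "\<bar>b\<bar> \<le> pi \<Longrightarrow> dxi T b \<noteq> 0"
proof -
  assume "\<bar>b\<bar> \<le> pi"
  from rho_pos[OF this] have "of_real (drho T b) + \<i> * of_real (rho T b) \<noteq> (0::complex)"
    by (simp add: complex_eq_iff)
  then show ?thesis by (simp add: dxi_def)
qed

lemma dxi_bounded: "\<exists>M>0. \<forall>b. 0 < \<bar>b\<bar> \<longrightarrow> \<bar>b\<bar> \<le> pi \<longrightarrow> cmod (dxi T b) \<le> M"
proof -
  obtain M where M: "M > 0" "\<And>b. 0 < \<bar>b\<bar> \<Longrightarrow> \<bar>b\<bar> \<le> pi \<Longrightarrow> \<bar>drho T b\<bar> \<le> M"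
    using drho_bounded by blast
  have "bounded (rho T ` {-pi..pi})"
    by (intro compact_imp_bounded compact_continuous_image continuous_on_rho) auto
  then obtain R where R: "R > 0" "\<And>b. \<bar>b\<bar> \<le> pi \<Longrightarrow> \<bar>rho T b\<bar> \<le> R"
    unfolding bounded_pos by (auto simp: abs_le_iff)
  have "cmod (dxi T b) \<le> M + R" if "0 < \<bar>b\<bar>" "\<bar>b\<bar> \<le> pi" for b
  proof -
    have "cmod (dxi T b) = cmod (of_real (drho T b) + \<i> * of_real (rho T b))"
      by (simp add: dxi_def norm_mult)
    also have "\<dots> \<le> \<bar>drho T b\<bar> + \<bar>rho T b\<bar>"
      by (rule norm_triangle_le) (simp add: norm_mult)
    finally show ?thesis using M(2)[OF that] R(2)[OF that(2)] by linarith
  qed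
  then show ?thesis using M(1) R(1) by (intro exI[of _ "M + R"]) auto
qed

lemma continuous_on_dxi: "continuous_on ({-pi..pi} - {0}) (dxi T)"
proof -
  have "continuous_on ({-pi..pi} - {0}) (drho T)"
  proof -
    have *: "\<forall>x\<in>{-pi..pi} - {0}. (sin (T * x / (1 + T)))\<^sup>2 \<noteq> 0"
      using sin_q_nonzero by (auto simp: abs_le_iff)
    have **: "1 + T \<noteq> 0" using T_pos by simp
    show ?thesis unfolding drho_def
      by (rule continuous_on_divide[OF _ _ *]) (intro continuous_intros ballI **)+
  qed
  moreover have "continuous_on ({-pi..pi} - {0}) (rho T)"
    using continuous_on_rho by (rule continuous_on_subset) auto
  ultimately show ?thesis unfolding dxi_def cis_conv_exp by (intro continuous_intros)
qed

text \<open>The triangle 0, -1, \<open>xi T b\<close> has the angles pi - b, P and Q, with P =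
  b/(1+T) and Q = T b/(1+T); the law of sines gives \<open>rho\<close> = sin P / sin Q and the
  modulus sin b / sin Q here. The point of the formula is that the argument of 1 + xi is exactly the
  (1+T)-th part of that of xi.\<close>

lemma one_plus_xi:
  assumes "b \<noteq> 0" "\<bar>b\<bar> \<le> pi"
  shows "1 + xi T b = of_real (sin b / sin (T * b / (1 + T))) * cis (b / (1 + T))"
proof -
  define P where "P = b / (1 + T)"
  define Q where "Q = T * b / (1 + T)"
  have b: "b = P + Q" using T_pos by (simp add: P_def Q_def add_divide_distrib[symmetric]) (simp add: field_simps)
  have nz: "sin Q \<noteq> 0" using sin_q_nonzero[OF assms] by (simp add: Q_def)
  have r: "rho T b = sin P / sin Q" using assms by (simp add: rho_def P_def Q_def)
  have "1 + of_real (sin P / sin Q) * cis (P + Q) = of_real (sin (P + Q) / sin Q) * cis P"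
  proof (rule complex_eqI)
    have "sin Q + sin P * cos (P + Q) = sin (P + Q) * cos P"
    proof -
      have "sin ((P + Q) - P) = sin (P+Q) * cos P - cos (P+Q) * sin P" by (rule sin_diff)
      then show ?thesis by (simp add: algebra_simps)
    qed
    then show "Re (1 + of_real (sin P / sin Q) * cis (P + Q)) = Re (of_real (sin (P + Q) / sin Q) * cis P)"
      using nz by (simp add: field_simps)
    show "Im (1 + of_real (sin P / sin Q) * cis (P + Q)) = Im (of_real (sin (P + Q) / sin Q) * cis P)"
      by (simp add: field_simps)
  qed
  then show ?thesis unfolding xi_def r by (simp add: b[symmetric] P_def[symmetric] Q_def[symmetric])
qed

end

section \<open>The inversion s -> 1/s exchanges T and 1/T\<close>

lemma rho_inverse: "T > 0 \<Longrightarrow> rho (1 / T) b = 1 / rho T b"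
proof -
  assume T: "T > 0"
  have "b / (1 + 1 / T) = T * b / (1 + T)" "1 / T * b / (1 + 1 / T) = b / (1 + T)"
    using T by (simp_all add: field_simps)
  then show ?thesis unfolding rho_def by (simp only:) simp
qed

text \<open>Passing from T to 1/T swaps the two sines in \<open>rho\<close>. Inversion also reverses
  the angle, so integrals over the curve for 1/T have to be reflected before they are compared with
  those for T.\<close>

lemma xi_inverse: "T > 0 \<Longrightarrow> xi (1 / T) (- b) = 1 / xi T b"
  by (simp add: xi_def rho_inverse[of T "- b"] fc_curve.rho_minus[of T] fc_curve_def)
   (simp add: divide_simps cis_mult flip: mult.assoc)


section \<open>The inside of the curve\<close>

text \<open>The real value of (1 + s)^(1+T) / s at the curve point s = xi T b.\<close>
definition fc_quot :: "real \<Rightarrow> real \<Rightarrow> real" where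
  "fc_quot T b = cmod (1 + xi T b) powr (1 + T) / rho T b"

text \<open>The complex factor is (1+T)/(1+s) - 1/s = (T s - 1)/(s (1+s)), the logarithmic
  derivative of (1+s)^(1+T)/s. Along the curve the product is already real, as
  \<open>ln_fc_quot_derivative\<close> shows; \<open>Re\<close> only adjusts the type.\<close>

definition dln_fc_quot :: "real \<Rightarrow> real \<Rightarrow> real" where
  "dln_fc_quot T b = Re (dxi T b * (of_real T * xi T b - 1) / (xi T b * (1 + xi T b)))"

text \<open>The origin is included through the convention \<open>Arg 0 = 0\<close> and
  \<open>rho T 0 = 1 / T\<close>.\<close>

definition fc_dom :: "real \<Rightarrow> complex set" where
  "fc_dom T = {s. cmod s < rho T (Arg s)}"

text \<open>On the curve this equals (\<open>fc_quot\<close> - a) s. It will be used with a =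
  (z/c)^th for the exponent th and with a = z/c for 1/th, where z is the position of a point
  mass.\<close>

definition fc_fun :: "real \<Rightarrow> real \<Rightarrow> complex \<Rightarrow> complex" where
  "fc_fun T a s = (1 + s) powr of_real (1 + T) - of_real a * s"

context fc_curve begin

section \<open>Real values and monotonicity along the curve\<close>

lemma fc_quot_minus [simp]: "fc_quot T (- b) = fc_quot T b"
proof -
  have "1 + xi T (- b) = cnj (1 + xi T b)" by (simp add: xi_minus)
  then show ?thesis unfolding fc_quot_def by (simp only: complex_mod_cnj rho_minus)
qed

lemma fc_quot_pi [simp]: "fc_quot T pi = 0"
  by (simp add: fc_quot_def)

lemma fc_quot_0: "fc_quot T 0 = (1 + 1 / T) powr (1 + T) * T"
proof -
  have "1 + xi T 0 = of_real (1 + 1 / T)" by simp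
  then have "cmod (1 + xi T 0) = 1 + 1 / T" using T_pos by (simp only: norm_of_real) simp
  then show ?thesis by (simp add: fc_quot_def rho_def)
qed

lemma sin_ratio_pos: "b \<noteq> 0 \<Longrightarrow> \<bar>b\<bar> < pi \<Longrightarrow> sin b / sin (T * b / (1 + T)) > 0"
proof (cases "b > 0")
  case True
  then show "\<bar>b\<bar> < pi \<Longrightarrow> ?thesis" using sin_q_pos[of b] sin_gt_zero[of b] by auto
next
  case False
  then show "b \<noteq> 0 \<Longrightarrow> \<bar>b\<bar> < pi \<Longrightarrow> ?thesis"
    using sin_q_pos[of "-b"] sin_gt_zero[of "-b"] by (auto simp: zero_less_divide_iff)
qed

lemma Ln_xi: "\<bar>b\<bar> < pi \<Longrightarrow> Ln (xi T b) = Complex (ln (rho T b)) b"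
proof -
  assume b: "\<bar>b\<bar> < pi"
  have "xi T b = exp (Complex (ln (rho T b)) b)"
    using rho_pos[of b] b by (simp add: xi_def exp_eq_polar)
  then show ?thesis using b by (simp add: Ln_exp)
qed

text \<open>The candidate b/(1+T) lies in (-pi, pi), so it is the principal argument. This makes the
  identities between logarithms exact, without multiples of 2 pi i.\<close>

lemma Ln_one_plus_xi: "\<bar>b\<bar> < pi \<Longrightarrow> 1 + xi T b \<noteq> 0 \<and> Ln (1 + xi T b) = Complex (ln (cmod (1 + xi T b))) (b / (1 + T))"
proof -
  assume b: "\<bar>b\<bar> < pi"
  have bb: "\<bar>b / (1 + T)\<bar> < pi"
  proof -
    have "\<bar>b / (1 + T)\<bar> \<le> \<bar>b\<bar>" using T_pos by (simp add: abs_mult field_simps)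
    then show ?thesis using b by linarith
  qed
  obtain R where R: "R > 0" "1 + xi T b = of_real R * cis (b / (1 + T))"
  proof (cases "b = 0")
    case True
    have "1 + 1 / T > 0" using T_pos by (simp add: add_pos_pos)
    then show ?thesis using True by (intro that[of "1 + 1 / T"]) auto
  next
    case False
    then show ?thesis using one_plus_xi[OF False] sin_ratio_pos[OF False b] b that by auto
  qed
  then have c: "cmod (1 + xi T b) = R" by (simp add: norm_mult)
  have "1 + xi T b = exp (Complex (ln R) (b / (1 + T)))"
    using R by (simp add: exp_eq_polar)
  moreover have "Ln (exp (Complex (ln R) (b / (1 + T)))) = Complex (ln R) (b / (1 + T))"
    by (rule Ln_exp) (use bb[unfolded abs_less_iff] in \<open>simp_all\<close>)
  ultimately have "Ln (1 + xi T b) = Complex (ln R) (b / (1 + T))" by simp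
  moreover have "1 + xi T b \<noteq> 0" using R by simp
  ultimately show ?thesis using c by simp
qed

lemma one_plus_xi_nonzero: "\<bar>b\<bar> < pi \<Longrightarrow> 1 + xi T b \<noteq> 0"
  using Ln_one_plus_xi by blast

lemma Arg_one_plus_xi: "\<bar>b\<bar> < pi \<Longrightarrow> \<bar>Im (Ln (1 + xi T b))\<bar> < pi"
proof -
  assume b: "\<bar>b\<bar> < pi"
  have "\<bar>b / (1 + T)\<bar> \<le> \<bar>b\<bar>" using T_pos by (simp add: abs_mult field_simps)
  then show ?thesis using b by (simp add: Ln_one_plus_xi)
qed

lemma one_plus_xi_nonpos: "\<bar>b\<bar> < pi \<Longrightarrow> 1 + xi T b \<notin> \<real>\<^sub>\<le>\<^sub>0"
proof
  assume b: "\<bar>b\<bar> < pi" and "1 + xi T b \<in> \<real>\<^sub>\<le>\<^sub>0"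
  then have im: "Im (1 + xi T b) = 0" "Re (1 + xi T b) \<le> 0" by (auto simp: complex_nonpos_Reals_iff)
  have nz: "1 + xi T b \<noteq> 0" using b one_plus_xi_nonzero by auto
  with im have "Re (1 + xi T b) < 0" by (metis complex_eq_iff order_le_less zero_complex.simps)
  with im have "Arg (1 + xi T b) = pi" using Arg_eq_pi by blast
  then show False using Arg_one_plus_xi[OF b] nz by (simp add: Arg_eq_Im_Ln)
qed

lemma xi_nonpos: "\<bar>b\<bar> < pi \<Longrightarrow> xi T b \<notin> \<real>\<^sub>\<le>\<^sub>0"
proof
  assume b: "\<bar>b\<bar> < pi" and "xi T b \<in> \<real>\<^sub>\<le>\<^sub>0"
  then have "Im (xi T b) = 0" "Re (xi T b) \<le> 0" by (auto simp: complex_nonpos_Reals_iff)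
  moreover have "xi T b \<noteq> 0" using b xi_nonzero by auto
  ultimately have "Re (xi T b) < 0" "Im (xi T b) = 0"
    by (auto simp: complex_eq_iff order_le_less)
  then have "Arg (xi T b) = pi" using Arg_eq_pi by blast
  then show False using Ln_xi[OF b] \<open>xi T b \<noteq> 0\<close> b by (simp add: Arg_eq_Im_Ln)
qed

lemma fc_quot_pos: "\<bar>b\<bar> < pi \<Longrightarrow> fc_quot T b > 0"
  using rho_pos[of b] one_plus_xi_nonzero[of b] by (simp add: fc_quot_def)

text \<open>The imaginary parts (1+T) b/(1+T) and b cancel.\<close>

lemma ln_fc_quot: "\<bar>b\<bar> < pi \<Longrightarrow> of_real (ln (fc_quot T b)) = of_real (1 + T) * Ln (1 + xi T b) - Ln (xi T b)"
proof -
  assume b: "\<bar>b\<bar> < pi"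
  have "ln (fc_quot T b) = (1 + T) * ln (cmod (1 + xi T b)) - ln (rho T b)"
    using rho_pos[of b] one_plus_xi_nonzero[of b] b by (simp add: fc_quot_def ln_div ln_powr)
  then show ?thesis using T_pos by (simp add: Ln_xi[OF b] Ln_one_plus_xi[OF b] complex_eq_iff)
qed

lemma powr_xi: "\<bar>b\<bar> \<le> pi \<Longrightarrow> (1 + xi T b) powr of_real (1 + T) = of_real (fc_quot T b) * xi T b"
proof -
  assume b: "\<bar>b\<bar> \<le> pi"
  consider "\<bar>b\<bar> < pi" | "b = pi" | "b = - pi" using b by linarith
  then show ?thesis
  proof cases
    case 1
    have "(1 + xi T b) powr of_real (1 + T) = exp (of_real (ln (fc_quot T b)) + Ln (xi T b))"
      using one_plus_xi_nonzero[OF 1] by (simp add: powr_def ln_fc_quot[OF 1])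
    also have "\<dots> = of_real (fc_quot T b) * xi T b"
      using fc_quot_pos[OF 1] xi_nonzero[OF b] by (simp add: exp_add exp_of_real)
    finally show ?thesis .
  qed auto
qed

lemma fc_fun_xi: "\<bar>b\<bar> \<le> pi \<Longrightarrow> fc_fun T a (xi T b) = of_real (fc_quot T b - a) * xi T b"
  by (simp add: fc_fun_def powr_xi algebra_simps del: of_real_add)

lemma ln_fc_quot_derivative:
  assumes "b \<noteq> 0" "\<bar>b\<bar> < pi"
  shows "((\<lambda>b. ln (fc_quot T b)) has_real_derivative dln_fc_quot T b) (at b)"
    and "of_real (dln_fc_quot T b) = dxi T b * (of_real T * xi T b - 1) / (xi T b * (1 + xi T b))"
proof -
  have d: "(xi T has_vector_derivative dxi T b) (at b)" using assms xi_has_derivative by simp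
  have nz: "xi T b \<noteq> 0" "1 + xi T b \<noteq> 0" using assms xi_nonzero one_plus_xi_nonzero by auto
  have 1: "((Ln \<circ> (\<lambda>b. 1 + xi T b)) has_vector_derivative (dxi T b * inverse (1 + xi T b))) (at b)"
    by (rule field_vector_diff_chain_at)
       (use d one_plus_xi_nonpos[OF assms(2)] nz in \<open>auto intro!: derivative_eq_intros simp: divide_inverse\<close>)
  have 2: "((Ln \<circ> xi T) has_vector_derivative (dxi T b * inverse (xi T b))) (at b)"
    by (rule field_vector_diff_chain_at)
       (use d xi_nonpos[OF assms(2)] nz in \<open>auto intro!: derivative_eq_intros simp: divide_inverse\<close>)
  define z where "z = of_real (1 + T) * (dxi T b * inverse (1 + xi T b)) - dxi T b * inverse (xi T b)"
  have "((\<lambda>b. of_real (1 + T) * (Ln \<circ> (\<lambda>b. 1 + xi T b)) b - (Ln \<circ> xi T) b) has_vector_derivative z) (at b)"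
    unfolding z_def by (intro has_vector_derivative_diff has_vector_derivative_mult_right 1 2)
  then have 3: "((\<lambda>b. of_real (ln (fc_quot T b))::complex) has_vector_derivative z) (at b)"
  proof (rule has_vector_derivative_transform_within_open[where S="{-pi<..<pi}"])
    show "\<And>y. y \<in> {- pi<..<pi} \<Longrightarrow>
         of_real (1 + T) * (Ln \<circ> (\<lambda>b. 1 + xi T b)) y - (Ln \<circ> xi T) y = of_real (ln (fc_quot T y))"
      using ln_fc_quot by (simp add: abs_less_iff del: of_real_add)
  qed (use assms in auto)
  have z: "z = dxi T b * (of_real T * xi T b - 1) / (xi T b * (1 + xi T b))"
    using nz by (simp add: z_def field_simps)
  have re: "((\<lambda>b. ln (fc_quot T b)) has_vector_derivative Re z) (at b)"
    using bounded_linear.has_vector_derivative[OF bounded_linear_Re 3] by simp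
  then show "((\<lambda>b. ln (fc_quot T b)) has_real_derivative dln_fc_quot T b) (at b)"
    by (simp add: has_real_derivative_iff_has_vector_derivative dln_fc_quot_def z)
  \<comment> \<open>The differentiated function is real-valued, so its derivative has imaginary part
    0; this identifies the complex expression with its real part.\<close>
  have "((\<lambda>b. 0::real) has_vector_derivative Im z) (at b)"
    using bounded_linear.has_vector_derivative[OF bounded_linear_Im 3] by simp
  then have "Im z = 0" using vector_derivative_unique_at has_vector_derivative_const by blast
  then have "of_real (Re z) = z" by (simp add: complex_eq_iff)
  then show "of_real (dln_fc_quot T b) = dxi T b * (of_real T * xi T b - 1) / (xi T b * (1 + xi T b))"
    by (simp add: dln_fc_quot_def z)
qed

lemma fc_quot_has_derivative:
  assumes "b \<noteq> 0" "\<bar>b\<bar> < pi"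
  shows "(fc_quot T has_real_derivative (fc_quot T b * dln_fc_quot T b)) (at b)"
proof -
  have "((\<lambda>b. exp (ln (fc_quot T b))) has_real_derivative (exp (ln (fc_quot T b)) * dln_fc_quot T b)) (at b)"
    by (rule DERIV_chain2[OF DERIV_exp ln_fc_quot_derivative(1)[OF assms]])
  then have "((\<lambda>b. exp (ln (fc_quot T b))) has_real_derivative (fc_quot T b * dln_fc_quot T b)) (at b)"
    using fc_quot_pos[OF assms(2)] by simp
  then show ?thesis
    by (rule has_field_derivative_transform_within_open[where S="{-pi<..<pi}"])
       (use assms fc_quot_pos in \<open>auto simp: abs_less_iff\<close>)
qed

lemma continuous_on_fc_quot: "continuous_on {-pi..pi} (fc_quot T)"
  unfolding fc_quot_def
proof (intro continuous_on_divide continuous_on_powr' continuous_on_norm continuous_on_add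
    continuous_on_const continuous_on_xi continuous_on_rho ballI)
  show "\<And>x. x \<in> {- pi..pi} \<Longrightarrow> rho T x \<noteq> 0" using rho_pos by (metis abs_le_iff atLeastAtMost_iff less_irrefl minus_le_iff)
qed (use T_pos in auto)

lemma Im_xi_pos: "0 < b \<Longrightarrow> b < pi \<Longrightarrow> Im (xi T b) > 0"
  using rho_pos[of b] by (simp add: xi_def sin_gt_zero)

text \<open>A zero would force T s = 1, but s is not real on the open upper arc.\<close>

lemma dln_fc_quot_nonzero: "0 < b \<Longrightarrow> b < pi \<Longrightarrow> dln_fc_quot T b \<noteq> 0"
proof
  assume b: "0 < b" "b < pi" and z: "dln_fc_quot T b = 0"
  have "of_real T * xi T b - 1 \<noteq> 0"
    using Im_xi_pos[OF b] T_pos by (auto simp: complex_eq_iff)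
  moreover have "dxi T b \<noteq> 0" "xi T b \<noteq> 0" "1 + xi T b \<noteq> 0"
    using b dxi_nonzero xi_nonzero one_plus_xi_nonzero by auto
  ultimately show False using ln_fc_quot_derivative(2)[of b] b z by auto
qed

lemma fc_quot_neq: "0 \<le> u \<Longrightarrow> u < v \<Longrightarrow> v \<le> pi \<Longrightarrow> fc_quot T u \<noteq> fc_quot T v"
proof
  assume a: "0 \<le> u" "u < v" "v \<le> pi" "fc_quot T u = fc_quot T v"
  have "\<exists>z. u < z \<and> z < v \<and> (\<lambda>h. (fc_quot T z * dln_fc_quot T z) * h) = (\<lambda>h. 0)"
  proof (rule Rolle_deriv[OF a(2) a(4)])
    show "continuous_on {u..v} (fc_quot T)" using a by (intro continuous_on_subset[OF continuous_on_fc_quot]) auto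
    show "\<And>x. u < x \<Longrightarrow> x < v \<Longrightarrow> (fc_quot T has_derivative (\<lambda>h. (fc_quot T x * dln_fc_quot T x) * h)) (at x)"
      using fc_quot_has_derivative a by (auto simp: has_field_derivative_def)
  qed
  then obtain z where z: "u < z" "z < v" "(\<lambda>h. (fc_quot T z * dln_fc_quot T z) * h) = (\<lambda>h. 0)" by blast
  from fun_cong[OF z(3), of 1] have "fc_quot T z * dln_fc_quot T z = 0" by simp
  then show False using fc_quot_pos[of z] dln_fc_quot_nonzero[of z] z a by auto
qed

text \<open>The sign of the derivative is never computed. Rolle's theorem gives injectivity on
  [0, pi], and an increase anywhere would make an earlier value reappear later, because the function
  falls to 0 at pi.\<close>

lemma fc_quot_strict: "0 \<le> u \<Longrightarrow> u < v \<Longrightarrow> v \<le> pi \<Longrightarrow> fc_quot T v < fc_quot T u"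
proof (rule ccontr)
  assume a: "0 \<le> u" "u < v" "v \<le> pi" and n: "\<not> fc_quot T v < fc_quot T u"
  have lt: "fc_quot T u < fc_quot T v" using n fc_quot_neq[OF a] by simp
  have "fc_quot T u > 0" using fc_quot_pos a by auto
  have "\<exists>w\<ge>v. w \<le> pi \<and> fc_quot T w = fc_quot T u"
  proof (rule IVT2')
    show "continuous_on {v..pi} (fc_quot T)" using a by (intro continuous_on_subset[OF continuous_on_fc_quot]) auto
  qed (use \<open>fc_quot T u > 0\<close> lt a in auto)
  then obtain w where "w \<ge> v" "w \<le> pi" "fc_quot T w = fc_quot T u" by blast
  then show False using fc_quot_neq[of u w] a by auto
qed

lemma Arg_of_real_mult_xi: "0 < r \<Longrightarrow> - pi < b \<Longrightarrow> b \<le> pi \<Longrightarrow> Arg (of_real r * xi T b) = b"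
proof -
  assume a: "0 < r" "- pi < b" "b \<le> pi"
  have "of_real r * xi T b = of_real (r * rho T b) * cis b" by (simp add: xi_def)
  moreover have "r * rho T b > 0" using a rho_pos[of b] by simp
  ultimately show ?thesis using a by (simp add: Arg_times_of_real cis_conv_exp Arg_exp del: of_real_mult)
qed

section \<open>Geometry of the inside\<close>

lemma mult_xi_in_fc_dom: "0 \<le> r \<Longrightarrow> r < 1 \<Longrightarrow> \<bar>b\<bar> \<le> pi \<Longrightarrow> of_real r * xi T b \<in> fc_dom T"
proof -
  assume a: "0 \<le> r" "r < 1" "\<bar>b\<bar> \<le> pi"
  show ?thesis
  proof (cases "r = 0")
    case True then show ?thesis using rho_pos[of 0] by (simp add: fc_dom_def Arg_zero)
  next
    case False
    have *: "of_real r * xi T b' \<in> fc_dom T" if "- pi < b'" "b' \<le> pi" for b'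
    proof -
      have "\<bar>b'\<bar> \<le> pi" using that by auto
      then show ?thesis using Arg_of_real_mult_xi[of r b'] that a False rho_pos[of b']
        by (simp add: fc_dom_def norm_mult norm_xi)
    qed
    show ?thesis
    \<comment> \<open>The angle - pi is not a value of \<open>Arg\<close>, but it gives the same
      point as pi.\<close>
    proof (cases "b = - pi")
      case True
      then have "xi T b = xi T pi" by simp
      then show ?thesis using *[of pi] by simp
    next
      case False then show ?thesis using *[of b] a by auto
    qed
  qed
qed

lemma xi_Arg: "s \<noteq> 0 \<Longrightarrow> s = of_real (cmod s / rho T (Arg s)) * xi T (Arg s)"
proof -
  assume "s \<noteq> 0"
  have "\<bar>Arg s\<bar> \<le> pi" using Arg_bounded[of s] by auto
  then have "rho T (Arg s) \<noteq> 0" using rho_pos by (metis less_irrefl)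
  then show ?thesis using Arg_eq[OF \<open>s \<noteq> 0\<close>] by (simp add: xi_def cis_conv_exp)
qed

text \<open>\<open>Arg\<close> jumps across the negative axis. As \<open>rho\<close> is even, only
  its absolute value matters, and this formula shows that to be continuous away from 0.\<close>

lemma abs_Arg: "s \<noteq> 0 \<Longrightarrow> \<bar>Arg s\<bar> = arccos (Re s / cmod s)"
proof -
  assume s: "s \<noteq> 0"
  have "Re s / cmod s = cos (Arg s)" using s by (simp add: cos_Arg)
  also have "\<dots> = cos \<bar>Arg s\<bar>" by simp
  finally have "Re s / cmod s = cos \<bar>Arg s\<bar>" .
  moreover have "arccos (cos \<bar>Arg s\<bar>) = \<bar>Arg s\<bar>"
    by (rule arccos_cos) (use Arg_bounded[of s] in auto)
  ultimately show ?thesis by simp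
qed

lemma zero_in_fc_dom: "0 \<in> fc_dom T"
  using mult_xi_in_fc_dom[of 0 0] by simp

lemma rho_lower: obtains m where "m > 0" "\<And>b. \<bar>b\<bar> \<le> pi \<Longrightarrow> m \<le> rho T b"
proof -
  obtain x where x: "x \<in> {-pi..pi}" "\<forall>y\<in>{-pi..pi}. rho T x \<le> rho T y"
    using continuous_attains_inf[OF compact_Icc _ continuous_on_rho] by auto
  show thesis by (rule that[of "rho T x"]) (use x rho_pos[of x] in \<open>auto simp: abs_le_iff\<close>)
qed

lemma open_fc_dom: "open (fc_dom T)"
proof -
  obtain m where m: "m > 0" "\<And>b. \<bar>b\<bar> \<le> pi \<Longrightarrow> m \<le> rho T b"
    using rho_lower by blast
  define A where "A = {s. cmod s - rho T (arccos (Re s / cmod s)) < 0} \<inter> - {0}"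
  have re: "\<bar>Re s / cmod s\<bar> \<le> 1" for s using abs_Re_le_cmod[of s] by (cases "s = 0") (auto simp: abs_divide)
  have "continuous_on (- {0}) (\<lambda>s. cmod s - rho T (arccos (Re s / cmod s)))"
  proof (intro continuous_on_diff continuous_on_norm_id)
    show "continuous_on (- {0}) (\<lambda>s. rho T (arccos (Re s / cmod s)))"
    proof (rule continuous_on_compose2[OF continuous_on_rho])
      show "continuous_on (- {0}) (\<lambda>x. arccos (Re x / cmod x))"
        using re by (intro continuous_intros) (auto simp only: abs_le_iff Compl_iff singleton_iff norm_eq_zero minus_le_iff)
      show "(\<lambda>x. arccos (Re x / cmod x)) ` (- {0}) \<subseteq> {- pi..pi}"
      proof (intro image_subsetI)
        fix s :: complex assume "s \<in> - {0}"
        then have "s \<noteq> 0" by simp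
        from abs_Arg[OF this] show "arccos (Re s / cmod s) \<in> {- pi..pi}"
          using Arg_bounded[of s] by auto
      qed
    qed
  qed
  then have "open ((\<lambda>s. cmod s - rho T (arccos (Re s / cmod s))) -` {..<0} \<inter> - {0})"
    by (subst (asm) continuous_on_open_vimage) auto
  then have "open A" by (simp add: A_def vimage_def)
  \<comment> \<open>The arccos description is useless at the origin, which is covered by a ball of
    radius the minimum of \<open>rho\<close>.\<close>
  moreover have "fc_dom T = A \<union> ball 0 m"
  proof -
    have "s \<in> fc_dom T \<longleftrightarrow> s \<in> A" if "s \<noteq> 0" for s
      using that abs_Arg[OF that] rho_abs[of "Arg s"] by (simp add: fc_dom_def A_def)
    moreover have "s \<in> fc_dom T" if "cmod s < m" for s
      using m(2)[of "Arg s"] Arg_bounded[of s] that by (auto simp: fc_dom_def abs_le_iff)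
    moreover have "0 \<notin> A" by (simp add: A_def)
    ultimately show ?thesis using zero_in_fc_dom m(1)
      by (intro set_eqI) (metis UnCI UnE mem_ball_0 norm_zero)
  qed
  ultimately show ?thesis by (simp add: open_Un)
qed

lemma scale_in_fc_dom: "s \<in> fc_dom T \<Longrightarrow> 0 \<le> r \<Longrightarrow> r \<le> 1 \<Longrightarrow> of_real r * s \<in> fc_dom T"
proof -
  assume s: "s \<in> fc_dom T" and r: "0 \<le> r" "r \<le> 1"
  show ?thesis
  proof (cases "r = 0 \<or> s = 0")
    case True then show ?thesis using zero_in_fc_dom by auto
  next
    case False
    then have "Arg (of_real r * s) = Arg s" using r by (simp add: Arg_times_of_real)
    moreover have "cmod (of_real r * s) \<le> cmod s" using r by (simp add: norm_mult mult_left_le_one_le)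
    ultimately show ?thesis using s by (simp add: fc_dom_def)
  qed
qed

lemma starlike_fc_dom: "starlike (fc_dom T)"
  unfolding starlike_def
proof (intro bexI[OF _ zero_in_fc_dom] ballI subsetI)
  fix x z assume x: "x \<in> fc_dom T" and "z \<in> closed_segment 0 x"
  then obtain u where "0 \<le> u" "u \<le> 1" "z = of_real u * x"
    by (auto simp: closed_segment_def scaleR_conv_of_real)
  then show "z \<in> fc_dom T" using scale_in_fc_dom[OF x] by simp
qed

lemma cnj_in_fc_dom: "s \<in> fc_dom T \<Longrightarrow> cnj s \<in> fc_dom T"
proof -
  assume s: "s \<in> fc_dom T"
  show ?thesis
  proof (cases "Arg s = pi \<or> s = 0")
    case True
    then have "cnj s = s" using Arg_eq_pi by (auto simp: complex_eq_iff)
    then show ?thesis using s by simp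
  next
    case False
    then show ?thesis using s by (simp add: fc_dom_def Arg_cnj)
  qed
qed

lemma real_in_fc_dom: "of_real x \<in> fc_dom T \<Longrightarrow> -1 < x \<and> x < 1 / T"
proof -
  assume x: "of_real x \<in> fc_dom T"
  show ?thesis
  proof (cases "x < 0")
    case True
    then have "Arg (of_real x) = pi" by (simp add: Arg_of_real)
    moreover have "x < 1 / T" using True T_pos by (smt (verit) divide_pos_pos)
    ultimately show ?thesis using x True by (simp add: fc_dom_def)
  next
    case False
    then have "Arg (of_real x) = 0" by (simp add: Arg_of_real)
    then show ?thesis using x False by (simp add: fc_dom_def rho_def)
  qed
qed

lemma one_plus_fc_dom_nonpos: "s \<in> fc_dom T \<Longrightarrow> 1 + s \<notin> \<real>\<^sub>\<le>\<^sub>0"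
proof
  assume s: "s \<in> fc_dom T" and n: "1 + s \<in> \<real>\<^sub>\<le>\<^sub>0"
  then have "Im s = 0" "Re s \<le> -1" by (auto simp: complex_nonpos_Reals_iff)
  then have "s = of_real (Re s)" by (simp add: complex_eq_iff)
  then show False using real_in_fc_dom[of "Re s"] s \<open>Re s \<le> -1\<close> by simp
qed

text \<open>Moving inwards along a ray keeps arg s and lowers arg (1 + s) below its value on the
  curve, which is arg s / (1+T). Hence the argument of the quotient, (1+T) arg (1+s) - arg s, lies
  strictly between - pi and 0.\<close>

lemma Im_quotient_neg:
  assumes s: "s \<in> fc_dom T" and im: "Im s > 0"
  shows "Im ((1 + s) powr of_real (1 + T) / s) < 0"
proof -
  define b r where "b = Arg s" and "r = cmod s"
  have nz: "s \<noteq> 0" using im by auto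
  have b: "0 < b" "b < pi" using im Arg_lt_pi[of s] by (auto simp: b_def)
  have r: "0 < r" "r < rho T b" using s nz by (auto simp: r_def fc_dom_def b_def)
  have sb: "s = of_real r * cis b" using Arg_eq[OF nz] by (simp add: b_def r_def cis_conv_exp)
  define R al where "R = cmod (1 + s)" and "al = Arg (1 + s)"
  have nz1: "1 + s \<noteq> 0" using im by (auto simp: complex_eq_iff)
  have al: "0 < al" "al < pi" using im Arg_lt_pi[of "1 + s"] by (auto simp: al_def)
  have R: "R > 0" using nz1 by (simp add: R_def)
  have sal: "1 + s = of_real R * cis al" using Arg_eq[OF nz1] by (simp add: al_def R_def cis_conv_exp)
  define P where "P = b / (1 + T)"
  define Q where "Q = T * b / (1 + T)"
  have bPQ: "b = P + Q" using T_pos by (simp add: P_def Q_def add_divide_distrib[symmetric]) (simp add: field_simps)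
  have "0 < P" "0 < Q" using b T_pos by (auto simp: P_def Q_def)
  then have P: "0 < P" "P < pi" using b bPQ by linarith+
  have sq: "sin Q > 0" using sin_q_pos[of b] b by (simp add: Q_def)
  have "r * sin Q < sin P" using r(2) sq b by (simp add: rho_def P_def[symmetric] Q_def[symmetric] field_simps)
  \<comment> \<open>Rotation by - P compares arg (1 + s) with P: the two evaluations of this
    imaginary part express its sign once through r < \<open>rho\<close> and once through sin (al -
    P).\<close>
  moreover have "Im ((1 + s) * cis (- P)) = r * sin Q - sin P"
  proof -
    have "(1 + s) * cis (- P) = cis (- P) + of_real r * cis Q"
      by (simp add: sb distrib_right mult.assoc cis_mult bPQ)
    then show ?thesis by simp
  qed
  moreover have "Im ((1 + s) * cis (- P)) = R * sin (al - P)"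
    by (simp only: sal mult.assoc cis_mult) simp
  ultimately have "R * sin (al - P) < 0" by linarith
  then have "sin (al - P) < 0" using R by (simp add: mult_less_0_iff)
  then have alP: "al < P" using al P sin_ge_zero[of "al - P"] by (smt (verit))
  have "(1 + s) powr of_real (1 + T) = exp (of_real (1 + T) * Ln (1 + s))" using nz1 by (simp add: powr_def)
  also have "Ln (1 + s) = of_real (ln R) + \<i> * of_real al"
    using nz1 by (simp add: Ln_Arg R_def al_def)
  also have "exp (of_real (1 + T) * (of_real (ln R) + \<i> * of_real al)) =
       of_real (R powr (1 + T)) * cis ((1 + T) * al)"
    using R by (simp add: cis_conv_exp powr_def exp_of_real[symmetric] exp_add[symmetric] algebra_simps del: exp_of_real)
  finally have "(1 + s) powr of_real (1 + T) / s = of_real (R powr (1 + T) / r) * (cis ((1 + T) * al) / cis b)"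
    by (simp add: sb)
  also have "\<dots> = of_real (R powr (1 + T) / r) * cis ((1 + T) * al - b)" by (simp only: cis_divide)
  finally have eq: "Im ((1 + s) powr of_real (1 + T) / s) = R powr (1 + T) / r * sin ((1 + T) * al - b)"
    by simp
  have "(1 + T) * al < b" using alP T_pos by (simp add: P_def field_simps)
  moreover have "0 < (1 + T) * al" using al T_pos by simp
  ultimately have "sin ((1 + T) * al - b) < 0"
    using sin_gt_zero[of "b - (1 + T) * al"] b sin_minus[of "b - (1 + T) * al"] by simp
  then show ?thesis using eq R r by (simp add: mult_less_0_iff zero_less_mult_iff divide_less_0_iff)
qed

text \<open>The logarithm of (1+x)^(1+T)/x decreases up to its critical point 1/T, where the
  quotient has the value \<open>fc_quot T 0\<close>.\<close>

lemma powr_ge_linear: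
  assumes "0 < s" "s \<le> 1 / T" shows "(1 + s) powr (1 + T) \<ge> fc_quot T 0 * s"
proof -
  have D: "\<exists>y. ((\<lambda>x. (1 + T) * ln (1 + x) - ln x) has_real_derivative y) (at x) \<and> y \<le> 0" if x: "s \<le> x" "x \<le> 1/T" for x
  proof (intro exI conjI)
    have x0: "x > 0" using x assms by linarith
    show "((\<lambda>x. (1 + T) * ln (1 + x) - ln x) has_real_derivative ((1 + T) * (1 / (1 + x)) - 1 / x)) (at x)"
      using x0 by (auto intro!: derivative_eq_intros)
    have "T * x \<le> 1" using x(2) T_pos by (simp add: field_simps)
    then have "(1 + T) * x \<le> 1 + x" by (simp add: algebra_simps)
    then have "(1 + T) * (1 / (1 + x)) \<le> 1 / x" using x0 by (simp add: divide_simps mult.commute)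
    then show "(1 + T) * (1 / (1 + x)) - 1 / x \<le> 0" by simp
  qed
  have "(1 + T) * ln (1 + 1/T) - ln (1/T) \<le> (1 + T) * ln (1 + s) - ln s"
    by (rule DERIV_nonpos_imp_nonincreasing[OF assms(2) D])
  then have "exp ((1 + T) * ln (1 + 1/T) - ln (1/T)) \<le> exp ((1 + T) * ln (1 + s) - ln s)" by simp
  moreover have "exp ((1 + T) * ln (1 + 1/T) - ln (1/T)) = fc_quot T 0"
  proof -
    have "1 + 1 / T > 0" using T_pos by (simp add: add_pos_pos)
    moreover have "exp ((1 + T) * ln (1 + 1/T) - ln (1/T)) = exp ((1 + T) * ln (1 + 1/T)) / exp (ln (1 / T))"
      by (rule exp_diff)
    ultimately show ?thesis using T_pos by (simp add: fc_quot_0 powr_def)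
  qed
  moreover have "exp ((1 + T) * ln (1 + s) - ln s) = (1 + s) powr (1 + T) / s"
    using assms by (simp add: exp_diff powr_def)
  ultimately have "fc_quot T 0 \<le> (1 + s) powr (1 + T) / s" by argo
  then show ?thesis using assms by (simp add: field_simps)
qed

lemma cnj_fc_fun: "s \<in> fc_dom T \<Longrightarrow> fc_fun T a (cnj s) = cnj (fc_fun T a s)"
proof -
  assume s: "s \<in> fc_dom T"
  have "cnj ((1 + s) powr of_real (1 + T)) = cnj (1 + s) powr cnj (of_real (1 + T))"
    by (rule cnj_powr) (use one_plus_fc_dom_nonpos[OF s] in \<open>auto simp: complex_nonpos_Reals_iff\<close>)
  then show ?thesis by (simp add: fc_fun_def)
qed

text \<open>Hence the principal logarithm of this function is holomorphic on the domain.\<close>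
lemma fc_fun_nonpos:
  assumes s: "s \<in> fc_dom T" and a: "0 \<le> a" "a < fc_quot T 0"
  shows "fc_fun T a s \<notin> \<real>\<^sub>\<le>\<^sub>0"
proof -
  \<comment> \<open>A value - t with t >= 0 would turn the quotient into a - t/s, whose imaginary
    part is nonnegative in the upper half-plane, against \<open>Im_quotient_neg\<close>. The bounds
    on \<open>a\<close> enter only on the real axis.\<close>
  have up: "fc_fun T a s \<notin> \<real>\<^sub>\<le>\<^sub>0" if s: "s \<in> fc_dom T" and im: "Im s > 0" for s
  proof
    assume "fc_fun T a s \<in> \<real>\<^sub>\<le>\<^sub>0"
    then have "Im (fc_fun T a s) = 0" "Re (fc_fun T a s) \<le> 0" by (auto simp: complex_nonpos_Reals_iff)
    then obtain t where t: "t \<ge> 0" "fc_fun T a s = - of_real t"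
      by (intro that[of "- Re (fc_fun T a s)"]) (auto simp: complex_eq_iff)
    have nz: "s \<noteq> 0" using im by auto
    have "(1 + s) powr of_real (1 + T) / s = of_real a - of_real t / s"
      using t(2) nz by (simp add: fc_fun_def field_simps)
    then have "Im ((1 + s) powr of_real (1 + T) / s) = t * Im s / (cmod s)\<^sup>2"
      by (simp add: Im_divide cmod_power2)
    also have "\<dots> \<ge> 0" using t im by simp
    finally show False using Im_quotient_neg[OF s im] by simp
  qed
  consider "Im s > 0" | "Im s < 0" | "Im s = 0" by linarith
  then show ?thesis
  proof cases
    case 1 then show ?thesis using up s by blast
  next
    case 2
    then have "fc_fun T a (cnj s) \<notin> \<real>\<^sub>\<le>\<^sub>0" using up[OF cnj_in_fc_dom[OF s]] by simp
    then show ?thesis by (simp add: cnj_fc_fun[OF s] complex_nonpos_Reals_iff)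
  next
    case 3
    then have sx: "s = of_real (Re s)" by (simp add: complex_eq_iff)
    define x where "x = Re s"
    have x: "-1 < x" "x < 1 / T" using real_in_fc_dom[of x] s sx by (auto simp: x_def)
    have "(1 + s) powr of_real (1 + T) = of_real ((1 + x) powr (1 + T))"
    proof -
      have "1 + s = of_real (1 + x)" using sx by (simp add: x_def complex_eq_iff)
      then show ?thesis using x by (simp only: powr_of_real)
    qed
    then have E: "fc_fun T a s = of_real ((1 + x) powr (1 + T) - a * x)"
      using sx by (simp add: fc_fun_def x_def)
    have "(1 + x) powr (1 + T) - a * x > 0"
    proof (cases "x \<le> 0")
      case True
      then have "a * x \<le> 0" using a by (simp add: mult_nonneg_nonpos)
      moreover have "(1 + x) powr (1 + T) > 0" using x by simp
      ultimately show ?thesis by linarith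
    next
      case False
      then have "a * x < fc_quot T 0 * x" using a by simp
      also have "\<dots> \<le> (1 + x) powr (1 + T)" using powr_ge_linear[of x] False x by simp
      finally show ?thesis by simp
    qed
    then show ?thesis unfolding E by (simp add: complex_nonpos_Reals_iff)
  qed
qed

end


section \<open>Cauchy's formula on the curve\<close>

context fc_curve begin

text \<open>The radial coordinate of a point is unique, so dilated curves with different factors are
  disjoint. The angle is unique only after - pi has been identified with pi, hence the normalisation
  at the start.\<close>

lemma mult_xi_eq:
  assumes "0 < r" "0 < r'" "\<bar>b\<bar> \<le> pi" "\<bar>b'\<bar> \<le> pi" "of_real r * xi T b = of_real r' * xi T b'"
  shows "r = r'"
proof -
  have norm: "\<exists>u. - pi < u \<and> u \<le> pi \<and> xi T u = xi T v" if "\<bar>v\<bar> \<le> pi" for v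
    using that by (cases "v = - pi") (auto intro: exI[of _ pi] exI[of _ v])
  obtain u where u: "- pi < u" "u \<le> pi" "xi T u = xi T b" using norm[OF assms(3)] by blast
  obtain u' where u': "- pi < u'" "u' \<le> pi" "xi T u' = xi T b'" using norm[OF assms(4)] by blast
  have eq: "of_real r * xi T u = of_real r' * xi T u'" using assms(5) u u' by simp
  have "u = u'" using Arg_of_real_mult_xi[of r u] Arg_of_real_mult_xi[of r' u'] assms u u' eq by simp
  moreover have "xi T u \<noteq> 0" using u xi_nonzero[of u] by auto
  ultimately show ?thesis using eq by simp
qed

lemma scaled_has_derivative:
  assumes "b \<noteq> 0" "\<bar>b\<bar> \<le> pi"
  shows "((\<lambda>b. of_real r * xi T b) has_vector_derivative (of_real r * dxi T b)) (at b)"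
  by (intro has_vector_derivative_mult_right xi_has_derivative assms)

text \<open>The dilated curve closes up at angle pi, so the endpoint values of a primitive cancel; b
  = 0 is exempted because the formula for the derivative was established only away from it.\<close>

lemma curve_primitive:
  assumes "\<And>b. \<bar>b\<bar> \<le> pi \<Longrightarrow> (g has_field_derivative f (of_real r * xi T b)) (at (of_real r * xi T b))"
  shows "((\<lambda>b. f (of_real r * xi T b) * (of_real r * dxi T b)) has_integral 0) {-pi..pi}"
proof -
  have "((\<lambda>b. f (of_real r * xi T b) * (of_real r * dxi T b)) has_integral
      ((g \<circ> (\<lambda>b. of_real r * xi T b)) pi - (g \<circ> (\<lambda>b. of_real r * xi T b)) (-pi))) {-pi..pi}"
  proof (rule fundamental_theorem_of_calculus_interior_strong[of "{0}"])
    fix b assume b: "b \<in> {-pi<..<pi} - {0}"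
    then have "((g \<circ> (\<lambda>b. of_real r * xi T b)) has_vector_derivative (of_real r * dxi T b) * f (of_real r * xi T b)) (at b)"
      by (intro field_vector_diff_chain_at scaled_has_derivative assms) auto
    then show "((g \<circ> (\<lambda>b. of_real r * xi T b)) has_vector_derivative f (of_real r * xi T b) * (of_real r * dxi T b)) (at b)"
      by (simp add: mult.commute)
  next
    have "continuous_on ((\<lambda>b. of_real r * xi T b) ` {-pi..pi}) g"
    proof (intro continuous_at_imp_continuous_on ballI)
      fix z assume "z \<in> (\<lambda>b. of_real r * xi T b) ` {-pi..pi}"
      then obtain b where b: "b \<in> {-pi..pi}" "z = of_real r * xi T b" by blast
      then have "\<bar>b\<bar> \<le> pi" by auto
      with b show "isCont g z" using DERIV_isCont[OF assms] by simp
    qed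
    then show "continuous_on {-pi..pi} (g \<circ> (\<lambda>b. of_real r * xi T b))"
      by (intro continuous_on_compose continuous_intros continuous_on_xi)
  qed auto
  then show ?thesis by simp
qed

text \<open>The domain is starlike, so a global primitive exists; r < 1 keeps the curve inside the
  open domain.\<close>

lemma curve_integral_holomorphic:
  assumes f: "f holomorphic_on fc_dom T" and r: "0 \<le> r" "r < 1"
  shows "((\<lambda>b. f (of_real r * xi T b) * (of_real r * dxi T b)) has_integral 0) {-pi..pi}"
proof -
  have "\<exists>g. \<forall>x\<in>fc_dom T. (g has_field_derivative f x) (at x)"
    by (rule holomorphic_starlike_primitive[of _ _ "{}"])
       (use f open_fc_dom starlike_fc_dom holomorphic_on_imp_continuous_on holomorphic_on_imp_differentiable_at in auto)
  then obtain g where g: "\<And>x. x \<in> fc_dom T \<Longrightarrow> (g has_field_derivative f x) (at x)" by blast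
  show ?thesis by (rule curve_primitive[where g=g]) (use g mult_xi_in_fc_dom r in auto)
qed

text \<open>Up to the constant ln r, the primitive \<open>L\<close> is log xi + Ln (1 - t / (r xi)).
  The second term is single-valued: a value 1 - t / (r xi) = k <= 0 would put t at radius (1 - k) r
  >= r > r1. The angle in the first term alone contributes 2 pi i.\<close>

lemma curve_winding:
  assumes r: "0 < r1" "r1 < r" and b1: "\<bar>b1\<bar> \<le> pi"
  shows "((\<lambda>b. 1 / (of_real r * xi T b - of_real r1 * xi T b1) * (of_real r * dxi T b)) has_integral (2 * pi * \<i>)) {-pi..pi}"
proof -
  define t where "t = of_real r1 * xi T b1"
  define L where "L = (\<lambda>b. (of_real (ln (rho T b)) + \<i> * of_real b) + Ln (1 - t / (of_real r * xi T b)))"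
  have nz: "xi T b \<noteq> 0" if "\<bar>b\<bar> \<le> pi" for b using xi_nonzero that .
  have rnz: "r > 0" using r by linarith
  have nt: "of_real r * xi T b \<noteq> t" if "\<bar>b\<bar> \<le> pi" for b
    using mult_xi_eq[of r r1 b b1] that b1 r by (auto simp: t_def)
  have npos: "1 - t / (of_real r * xi T b) \<notin> \<real>\<^sub>\<le>\<^sub>0" if b: "\<bar>b\<bar> \<le> pi" for b
  proof
    assume "1 - t / (of_real r * xi T b) \<in> \<real>\<^sub>\<le>\<^sub>0"
    then obtain k where k: "k \<le> 0" "1 - t / (of_real r * xi T b) = of_real k"
      by (auto elim!: nonpos_Reals_cases)
    then have "t = of_real ((1 - k) * r) * xi T b"
      using nz[OF b] rnz by (simp add: field_simps)
    then have "of_real r1 * xi T b1 = of_real ((1 - k) * r) * xi T b" by (simp add: t_def)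
    then have "r1 = (1 - k) * r" using r k rnz b b1 by (intro mult_xi_eq[of r1 _ b1 b]) auto
    moreover have "(1 - k) * r \<ge> 1 * r" using k rnz by (intro mult_right_mono) auto
    ultimately show False using r by simp
  qed
  have "((\<lambda>b. 1 / (of_real r * xi T b - t) * (of_real r * dxi T b)) has_integral (L pi - L (-pi))) {-pi..pi}"
  proof (rule fundamental_theorem_of_calculus_interior_strong[of "{0}"])
    fix b assume b: "b \<in> {-pi<..<pi} - {0}"
    then have b': "b \<noteq> 0" "\<bar>b\<bar> \<le> pi" by auto
    have rp: "rho T b > 0" using rho_pos b' by simp
    have "((\<lambda>b. ln (rho T b)) has_real_derivative (drho T b / rho T b)) (at b)"
      using rho_has_derivative[OF b'] rp by (auto intro!: derivative_eq_intros)
    then have 1: "((\<lambda>b. of_real (ln (rho T b)) + \<i> * of_real b) has_vector_derivative (of_real (drho T b / rho T b) + \<i>)) (at b)"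
    proof -
      assume l: "((\<lambda>b. ln (rho T b)) has_real_derivative (drho T b / rho T b)) (at b)"
      have "((\<lambda>b. complex_of_real (ln (rho T b))) has_vector_derivative of_real (drho T b / rho T b)) (at b)"
        using l by (intro has_vector_derivative_of_real) (simp add: has_real_derivative_iff_has_vector_derivative)
      moreover have "((\<lambda>b. \<i> * complex_of_real b) has_vector_derivative \<i> * of_real 1) (at b)"
        by (intro has_vector_derivative_mult_right has_vector_derivative_of_real) simp
      ultimately have "((\<lambda>b. of_real (ln (rho T b)) + \<i> * of_real b) has_vector_derivative (of_real (drho T b / rho T b) + \<i> * of_real 1)) (at b)"
        by (rule has_vector_derivative_add)
      then show ?thesis by simp
    qed
    have 11: "of_real (drho T b / rho T b) + \<i> = dxi T b / xi T b"
      using rp by (simp add: dxi_def xi_def field_simps)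
    have 2: "((\<lambda>z. Ln (1 - t / (of_real r * z))) has_field_derivative
        (t / (of_real r * xi T b ^ 2)) / (1 - t / (of_real r * xi T b))) (at (xi T b))"
    proof -
      have d: "((\<lambda>z. 1 - t / (of_real r * z)) has_field_derivative (t / (of_real r * xi T b ^ 2))) (at (xi T b))"
        by (rule derivative_eq_intros refl | use nz[OF b'(2)] rnz in \<open>simp add: power2_eq_square\<close>)+
      have "((\<lambda>z. Ln (1 - t / (of_real r * z))) has_field_derivative
        inverse (1 - t / (of_real r * xi T b)) * (t / (of_real r * xi T b ^ 2))) (at (xi T b))"
        by (rule DERIV_chain2[OF has_field_derivative_Ln[OF npos[OF b'(2)]] d])
      then show ?thesis by (simp add: divide_inverse mult.commute)
    qed
    have 3: "(((\<lambda>z. Ln (1 - t / (of_real r * z))) \<circ> xi T) has_vector_derivative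
        dxi T b * ((t / (of_real r * xi T b ^ 2)) / (1 - t / (of_real r * xi T b)))) (at b)"
      by (rule field_vector_diff_chain_at[OF xi_has_derivative[OF b'] 2])
    have 4: "dxi T b / xi T b + dxi T b * ((t / (of_real r * xi T b ^ 2)) / (1 - t / (of_real r * xi T b)))
       = 1 / (of_real r * xi T b - t) * (of_real r * dxi T b)"
    proof -
      define x where "x = of_real r * xi T b"
      have x: "x \<noteq> 0" "x \<noteq> t" "xi T b = x / of_real r" using nz[OF b'(2)] rnz nt[OF b'(2)] by (auto simp: x_def)
      have "t / (of_real r * xi T b ^ 2) = of_real r * t / (x * x)"
        using rnz by (simp add: x(3) power2_eq_square)
      moreover have "1 - t / x = (x - t) / x" using x by (simp add: diff_divide_distrib)
      ultimately have "t / (of_real r * xi T b ^ 2) / (1 - t / x) = of_real r * t / (x * (x - t))"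
        using x by simp
      moreover have "dxi T b / xi T b = dxi T b * of_real r / x" using x rnz by (simp add: x(3))
      moreover have "dxi T b * of_real r / x + dxi T b * (of_real r * t / (x * (x - t))) = 1 / (x - t) * (of_real r * dxi T b)"
        using x(1,2) by (simp add: field_simps)
      ultimately show ?thesis by (simp only: x_def[symmetric])
    qed
    show "(L has_vector_derivative 1 / (of_real r * xi T b - t) * (of_real r * dxi T b)) (at b)"
      using has_vector_derivative_add[OF 1[unfolded 11] 3] unfolding 4 L_def by (simp add: o_def)
  next
    have "continuous_on {-pi..pi} (\<lambda>b. Ln (1 - t / (of_real r * xi T b)))"
      using npos nz rnz by (intro continuous_intros continuous_on_xi) (auto simp: abs_le_iff)
    moreover have "continuous_on {-pi..pi} (\<lambda>b. ln (rho T b))"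
      using rho_pos by (intro continuous_intros continuous_on_rho) (metis abs_le_iff atLeastAtMost_iff less_irrefl minus_le_iff)
    ultimately show "continuous_on {-pi..pi} L" unfolding L_def
      by (intro continuous_on_add continuous_on_of_real continuous_on_mult continuous_on_const continuous_on_id)
  qed auto
  moreover have "L pi - L (-pi) = 2 * pi * \<i>" by (simp add: L_def)
  ultimately show ?thesis by (simp add: t_def)
qed

text \<open>Two removals of the singularity give f(x)/(x-t)^2 = F2(x) + f(t)/(x-t)^2 + f'(t)/(x-t)
  with F2 holomorphic inside. The first term integrates to 0 by holomorphy, the second because it
  has a primitive, and the third gives the winding number.\<close>

lemma curve_integral_deriv:
  assumes f: "f holomorphic_on fc_dom T" and r: "0 < r1" "r1 < r" "r < 1" and b1: "\<bar>b1\<bar> \<le> pi"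
    and t: "t = of_real r1 * xi T b1"
  shows "((\<lambda>b. f (of_real r * xi T b) * (1 / (of_real r * xi T b - t)\<^sup>2) * (of_real r * dxi T b)) has_integral (2 * pi * \<i> * deriv f t)) {-pi..pi}"
proof -
  have td: "t \<in> fc_dom T" using mult_xi_in_fc_dom[of r1 b1] r b1 by (simp add: t)
  then have ti: "t \<in> interior (fc_dom T)" using open_fc_dom interior_open by blast
  define F1 where "F1 = (\<lambda>z. if z = t then deriv f t else (f z - f t) / (z - t))"
  define F2 where "F2 = (\<lambda>z. if z = t then deriv F1 t else (F1 z - F1 t) / (z - t))"
  have F1: "F1 holomorphic_on fc_dom T" unfolding F1_def by (rule pole_lemma[OF f ti])
  have F2: "F2 holomorphic_on fc_dom T" unfolding F2_def by (rule pole_lemma[OF F1 ti])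
  have nt: "of_real r * xi T b \<noteq> t" if "\<bar>b\<bar> \<le> pi" for b
    using mult_xi_eq[of r r1 b b1] that b1 r by (auto simp: t)
  have 1: "((\<lambda>b. F2 (of_real r * xi T b) * (of_real r * dxi T b)) has_integral 0) {-pi..pi}"
    by (rule curve_integral_holomorphic[OF F2]) (use r in auto)
  have 2: "((\<lambda>b. 1 / (of_real r * xi T b - t)\<^sup>2 * (of_real r * dxi T b)) has_integral 0) {-pi..pi}"
  proof (rule curve_primitive[where f = "\<lambda>z. 1 / (z - t)\<^sup>2" and g = "\<lambda>z. - 1 / (z - t)"])
    fix b assume "\<bar>b\<bar> \<le> pi"
    from nt[OF this] show "((\<lambda>z. - 1 / (z - t)) has_field_derivative 1 / (of_real r * xi T b - t)\<^sup>2) (at (of_real r * xi T b))"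
      by (auto intro!: derivative_eq_intros simp: power2_eq_square)
  qed
  have 3: "((\<lambda>b. 1 / (of_real r * xi T b - t) * (of_real r * dxi T b)) has_integral (2 * pi * \<i>)) {-pi..pi}"
    unfolding t by (rule curve_winding) (use r b1 in auto)
  have "((\<lambda>b. F2 (of_real r * xi T b) * (of_real r * dxi T b)
      + f t * (1 / (of_real r * xi T b - t)\<^sup>2 * (of_real r * dxi T b))
      + deriv f t * (1 / (of_real r * xi T b - t) * (of_real r * dxi T b))) has_integral
        0 + f t * 0 + deriv f t * (2 * pi * \<i>)) {-pi..pi}"
    by (intro has_integral_add has_integral_mult_right 1 2 3)
  then have "((\<lambda>b. F2 (of_real r * xi T b) * (of_real r * dxi T b)
      + f t * (1 / (of_real r * xi T b - t)\<^sup>2 * (of_real r * dxi T b))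
      + deriv f t * (1 / (of_real r * xi T b - t) * (of_real r * dxi T b))) has_integral
        (2 * pi * \<i> * deriv f t)) {-pi..pi}" by (simp add: mult_ac)
  then show ?thesis
  proof (rule has_integral_eq[rotated])
    fix b assume "b \<in> {-pi..pi}"
    then have "\<bar>b\<bar> \<le> pi" by auto
    define x where "x = of_real r * xi T b"
    have x: "x - t \<noteq> 0" using nt[OF \<open>\<bar>b\<bar> \<le> pi\<close>] by (simp add: x_def)
    have F2x: "F2 x = (f x - f t) / (x - t)\<^sup>2 - deriv f t / (x - t)"
      using x by (simp add: F2_def F1_def power2_eq_square diff_divide_distrib)
    have "F2 x + f t * (1 / (x - t)\<^sup>2) + deriv f t * (1 / (x - t)) = f x * (1 / (x - t)\<^sup>2)"
      unfolding F2x by (simp add: diff_divide_distrib)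
    then have "(F2 x + f t * (1 / (x - t)\<^sup>2) + deriv f t * (1 / (x - t))) * (of_real r * dxi T b)
      = f x * (1 / (x - t)\<^sup>2) * (of_real r * dxi T b)" by (simp only:)
    then show "F2 (of_real r * xi T b) * (of_real r * dxi T b)
      + f t * (1 / (of_real r * xi T b - t)\<^sup>2 * (of_real r * dxi T b))
      + deriv f t * (1 / (of_real r * xi T b - t) * (of_real r * dxi T b)) =
      f (of_real r * xi T b) * (1 / (of_real r * xi T b - t)\<^sup>2) * (of_real r * dxi T b)"
      unfolding x_def[symmetric] by (simp only: distrib_right mult.assoc)
  qed
qed

lemma curve_dist_pos:
  assumes "r0 \<le> 1" "\<And>r b. r0 \<le> r \<Longrightarrow> r \<le> 1 \<Longrightarrow> \<bar>b\<bar> \<le> pi \<Longrightarrow> of_real r * xi T b \<noteq> s"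
  obtains d where "d > 0" "\<And>r b. r0 \<le> r \<Longrightarrow> r \<le> 1 \<Longrightarrow> \<bar>b\<bar> \<le> pi \<Longrightarrow> d \<le> cmod (of_real r * xi T b - s)"
proof -
  define K where "K = {r0..1} \<times> {-pi..pi}"
  have "compact K" "K \<noteq> {}" using assms(1) by (auto simp: K_def intro!: compact_Times)
  moreover have "continuous_on K (\<lambda>x. cmod (of_real (fst x) * xi T (snd x) - s))"
    unfolding K_def by (intro continuous_intros continuous_on_compose2[OF continuous_on_xi]) auto
  ultimately obtain x where x: "x \<in> K" "\<And>y. y \<in> K \<Longrightarrow> cmod (of_real (fst x) * xi T (snd x) - s) \<le> cmod (of_real (fst y) * xi T (snd y) - s)"
    using continuous_attains_inf[of K "\<lambda>x. cmod (of_real (fst x) * xi T (snd x) - s)"] by blast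
  show thesis
  proof (rule that[of "cmod (of_real (fst x) * xi T (snd x) - s)"])
    show "cmod (of_real (fst x) * xi T (snd x) - s) > 0"
      using assms(2)[of "fst x" "snd x"] x(1) by (auto simp: K_def abs_le_iff)
    fix r b assume "r0 \<le> r" "r \<le> 1" "\<bar>b\<bar> \<le> pi"
    then show "cmod (of_real (fst x) * xi T (snd x) - s) \<le> cmod (of_real r * xi T b - s)"
      using x(2)[of "(r, b)"] by (auto simp: K_def abs_le_iff)
  qed
qed

text \<open>Dominated convergence as the dilated curves grow to the curve: \<open>f\<close> has
  boundary values \<open>F\<close> off the finite set \<open>N\<close> and the majorant
  \<open>h\<close>, while \<open>k\<close> is a kernel continuous up to the curve. The point 0
  belongs to \<open>N\<close> because the bound on the velocity excludes it.\<close>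

lemma curve_limit:
  fixes f k :: "complex \<Rightarrow> complex" and F :: "real \<Rightarrow> complex"
  assumes r0: "r0 < 1" and N: "finite N" "0 \<in> N"
    and int: "\<And>r. r0 < r \<Longrightarrow> r < 1 \<Longrightarrow>
      ((\<lambda>b. f (of_real r * xi T b) * k (of_real r * xi T b) * (of_real r * dxi T b)) has_integral I) {-pi..pi}"
    and K: "\<And>r b. r0 < r \<Longrightarrow> r < 1 \<Longrightarrow> \<bar>b\<bar> \<le> pi \<Longrightarrow> cmod (k (of_real r * xi T b)) \<le> K"
    and k: "\<And>b. \<bar>b\<bar> \<le> pi \<Longrightarrow> isCont k (xi T b)"
    and h: "h integrable_on {-pi..pi}"
    and dom: "\<And>r b. r0 < r \<Longrightarrow> 0 < r \<Longrightarrow> r < 1 \<Longrightarrow> b \<in> {-pi..pi} - N \<Longrightarrow> cmod (f (of_real r * xi T b)) \<le> h b"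
    and lim: "\<And>b. b \<in> {-pi..pi} - N \<Longrightarrow> ((\<lambda>r. f (of_real r * xi T b)) \<longlongrightarrow> F b) (at_left 1)"
  shows "((\<lambda>b. F b * k (xi T b) * dxi T b) has_integral I) {-pi..pi}"
proof -
  \<comment> \<open>Cutting off at 0 keeps all radii positive, whatever the sign of
    \<open>r0\<close>.\<close>
  define r1 where "r1 = max r0 0"
  have r1: "r0 \<le> r1" "0 \<le> r1" "r1 < 1" using r0 by (auto simp: r1_def)
  define r where "r = (\<lambda>n. 1 - (1 - r1) / 2 * inverse (real (Suc n)))"
  have rb: "r1 < r n" "r n < 1" for n
  proof -
    have i: "0 < inverse (real (Suc n))" "inverse (real (Suc n)) \<le> 1" by (auto simp: field_simps)
    have "(1 - r1) / 2 * inverse (real (Suc n)) \<le> (1 - r1) / 2 * 1"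
      using i r1 by (intro mult_left_mono) auto
    then show "r1 < r n" using r1 unfolding r_def by (simp add: field_simps)
    have "0 < (1 - r1) / 2 * inverse (real (Suc n))" using i r1 by (intro mult_pos_pos) auto
    then show "r n < 1" unfolding r_def by linarith
  qed
  have rlim: "r \<longlonglongrightarrow> 1"
  proof -
    have "(\<lambda>n. 1 - (1 - r1) / 2 * inverse (real (Suc n))) \<longlonglongrightarrow> 1 - (1 - r1) / 2 * 0"
      by (intro tendsto_intros LIMSEQ_inverse_real_of_nat)
    then show ?thesis by (simp add: r_def)
  qed
  have rfl: "filterlim r (at_left 1) sequentially"
    unfolding filterlim_at using rlim rb by (auto intro!: always_eventually simp: less_imp_neq)
  obtain M where M: "M > 0" "\<And>b. 0 < \<bar>b\<bar> \<Longrightarrow> \<bar>b\<bar> \<le> pi \<Longrightarrow> cmod (dxi T b) \<le> M" using dxi_bounded by blast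
  define S where "S = {-pi..pi} - N"
  define g where "g = (\<lambda>n b. f (of_real (r n) * xi T b) * k (of_real (r n) * xi T b) * (of_real (r n) * dxi T b))"
  have ns: "(u has_integral i) {-pi..pi} \<longleftrightarrow> (u has_integral i) S" for u :: "real \<Rightarrow> complex" and i
    unfolding S_def by (rule has_integral_spike_set_eq; rule negligible_subset[OF negligible_finite[OF N(1)]]) auto
  have nsr: "u integrable_on {-pi..pi} \<longleftrightarrow> u integrable_on S" for u :: "real \<Rightarrow> real"
    unfolding S_def integrable_on_def
    by (rule ex_cong1, rule has_integral_spike_set_eq; rule negligible_subset[OF negligible_finite[OF N(1)]]) auto
  have gi: "(g n has_integral I) S" for n
    unfolding g_def using int[of "r n"] rb[of n] r1 ns by auto
  have p1: "g n integrable_on S" for n using gi by blast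
  have p2: "(\<lambda>b. h b * (K * M)) integrable_on S" using h nsr by (intro integrable_on_mult_left) auto
  have p3: "cmod (g n b) \<le> h b * (K * M)" if b: "b \<in> S" for n b
  proof -
    from b have bb: "b \<noteq> 0" "\<bar>b\<bar> \<le> pi" using N by (auto simp: S_def)
    have "cmod (g n b) = cmod (f (of_real (r n) * xi T b)) * (cmod (k (of_real (r n) * xi T b)) * (r n * cmod (dxi T b)))"
      using rb[of n] r1 by (simp add: g_def norm_mult)
    also have "\<dots> \<le> h b * (K * (1 * M))"
    proof (intro mult_mono)
      show "cmod (f (of_real (r n) * xi T b)) \<le> h b" using dom[of "r n" b] b rb[of n] r1 by (auto simp: S_def)
      then show "0 \<le> h b" using norm_ge_zero order_trans by blast
      show "cmod (k (of_real (r n) * xi T b)) \<le> K" using K[of "r n" b] bb rb[of n] r1 by auto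
      then show "0 \<le> K" using norm_ge_zero order_trans by blast
      show "cmod (dxi T b) \<le> M" using M bb by auto
    qed (use rb[of n] r1 in auto)
    finally show "cmod (g n b) \<le> h b * (K * M)" by simp
  qed
  have p4: "(\<lambda>n. g n b) \<longlonglongrightarrow> F b * k (xi T b) * dxi T b" if b: "b \<in> S" for b
  proof -
    from b have bb: "b \<noteq> 0" "\<bar>b\<bar> \<le> pi" using N by (auto simp: S_def)
    have 1: "(\<lambda>n. f (of_real (r n) * xi T b)) \<longlonglongrightarrow> F b"
      using filterlim_compose[OF lim rfl] b by (auto simp: S_def)
    have 2: "(\<lambda>n. of_real (r n) * xi T b) \<longlonglongrightarrow> of_real 1 * xi T b" by (intro tendsto_intros rlim)
    then have 3: "(\<lambda>n. k (of_real (r n) * xi T b)) \<longlonglongrightarrow> k (xi T b)"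
      using isCont_tendsto_compose[OF k[OF bb(2)]] by simp
    have "(\<lambda>n. g n b) \<longlonglongrightarrow> F b * k (xi T b) * (of_real 1 * dxi T b)"
      unfolding g_def by (intro tendsto_intros 1 3 rlim)
    then show "(\<lambda>n. g n b) \<longlonglongrightarrow> F b * k (xi T b) * dxi T b" by simp
  qed
  note DC1 = dominated_convergence(1)[OF p1 p2 p3 p4] and DC2 = dominated_convergence(2)[OF p1 p2 p3 p4]
  have "integral S (g n) = I" for n using gi by blast
  then have "integral S (\<lambda>b. F b * k (xi T b) * dxi T b) = I"
    using DC2 LIMSEQ_unique by (simp add: LIMSEQ_const_iff)
  then have "((\<lambda>b. F b * k (xi T b) * dxi T b) has_integral I) S" using DC1 by blast
  then show ?thesis using ns by blast
qed

end


section \<open>The logarithm of the defining function up to the boundary\<close>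

lemma isCont_times_ln_abs: "isCont (\<lambda>x::real. x * ln \<bar>x\<bar>) x"
proof (cases "x = 0")
  case True
  have "((\<lambda>x::real. x * ln x) \<longlongrightarrow> 0) (at_right 0)" by real_asymp
  then have r: "((\<lambda>x::real. x * ln \<bar>x\<bar>) \<longlongrightarrow> 0) (at_right 0)"
    by (rule Lim_transform_eventually) (auto simp: eventually_at_filter)
  have "((\<lambda>x::real. x * ln (-x)) \<longlongrightarrow> 0) (at_left 0)" by real_asymp
  then have l: "((\<lambda>x::real. x * ln \<bar>x\<bar>) \<longlongrightarrow> 0) (at_left 0)"
    by (rule Lim_transform_eventually) (auto simp: eventually_at_filter)
  show ?thesis using filterlim_split_at[OF l r] True by (simp add: isCont_def)
next
  case False
  then show ?thesis by (intro continuous_intros) auto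
qed

text \<open>The primitive extends continuously across x = a, so the fundamental theorem with one
  exceptional point covers the improper integral.\<close>

lemma ln_abs_has_integral:
  assumes "u \<le> v"
  shows "((\<lambda>x::real. ln \<bar>x - a\<bar>) has_integral
    ((v - a) * ln \<bar>v - a\<bar> - (v - a)) - ((u - a) * ln \<bar>u - a\<bar> - (u - a))) {u..v}"
proof (rule fundamental_theorem_of_calculus_interior_strong[of "{a}" u v "\<lambda>x. (x - a) * ln \<bar>x - a\<bar> - (x - a)"])
  fix x assume x: "x \<in> {u<..<v} - {a}"
  have "((\<lambda>x. (x - a) * ln \<bar>x - a\<bar> - (x - a)) has_real_derivative ln \<bar>x - a\<bar>) (at x)"
  proof (cases "x > a")
    case True
    have "((\<lambda>x. (x - a) * ln (x - a) - (x - a)) has_real_derivative ln \<bar>x - a\<bar>) (at x)"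
      using True by (auto intro!: derivative_eq_intros)
    then show ?thesis
      by (rule has_field_derivative_transform_within_open[where S="{a<..}"]) (use True in auto)
  next
    case False
    then have lt: "x < a" using x by auto
    have "((\<lambda>x. (x - a) * ln (a - x) - (x - a)) has_real_derivative ln \<bar>x - a\<bar>) (at x)"
    proof -
      have "((\<lambda>x. (x - a) * ln (a - x) - (x - a)) has_real_derivative
        (1 * ln (a - x) + (-1) / (a - x) * (x - a)) - 1) (at x)"
        using lt by (auto intro!: derivative_eq_intros)
      moreover have "(-1) / (a - x) * (x - a) = 1" using lt by (simp add: divide_simps)
      ultimately show ?thesis using lt by simp
    qed
    then show ?thesis
      by (rule has_field_derivative_transform_within_open[where S="{..<a}"]) (use lt in auto)
  qed
  then show "((\<lambda>x. (x - a) * ln \<bar>x - a\<bar> - (x - a)) has_vector_derivative ln \<bar>x - a\<bar>) (at x)"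
    by (simp add: has_real_derivative_iff_has_vector_derivative)
next
  have "continuous_on {u..v} (\<lambda>x. (\<lambda>y. y * ln \<bar>y\<bar>) (x - a))"
    by (intro continuous_at_imp_continuous_on ballI isCont_o2[OF _ isCont_times_ln_abs] continuous_intros)
  then show "continuous_on {u..v} (\<lambda>x. (x - a) * ln \<bar>x - a\<bar> - (x - a))"
    by (intro continuous_on_diff continuous_on_id continuous_on_const)
qed (use assms in auto)

text \<open>The logarithm is bounded above on the interval; for a constant \<open>B\<close> above
  it, B - ln is nonnegative and integrable, hence absolutely integrable.\<close>

lemma ln_abs_integrable: "(\<lambda>x::real. \<bar>ln \<bar>x - a\<bar>\<bar>) integrable_on {u..v}"
proof (cases "u \<le> v")
  case True
  have int: "(\<lambda>x. ln \<bar>x - a\<bar>) integrable_on {u..v}"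
    using ln_abs_has_integral[OF True] by blast
  define B where "B = \<bar>u - a\<bar> + \<bar>v - a\<bar>"
  have le: "ln \<bar>x - a\<bar> \<le> B" if "x \<in> {u..v}" for x
  proof (cases "x = a")
    case False
    then have "ln \<bar>x - a\<bar> \<le> \<bar>x - a\<bar>" using ln_le_minus_one[of "\<bar>x - a\<bar>"] by simp
    then show ?thesis using that by (auto simp: B_def abs_if split: if_splits)
  qed (simp add: B_def)
  have "(\<lambda>x. B - ln \<bar>x - a\<bar>) absolutely_integrable_on {u..v}"
    using le by (intro nonnegative_absolutely_integrable_1 integrable_diff int) auto
  from set_integral_diff(1)[OF absolutely_integrable_on_const[of "{u..v}" B] this]
  have "(\<lambda>x. ln \<bar>x - a\<bar>) absolutely_integrable_on {u..v}" by simp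
  then show ?thesis unfolding absolutely_integrable_on_def by simp
qed (simp add: integrable_on_empty)

text \<open>The squared distance is (A - B)^2 + 4 A B sin^2 ((b - b')/2). The sine is bounded below
  linearly by \<open>sin_q_lower\<close> for T = 1, where T b / (1+T) = b/2.\<close>

lemma cis_dist_lower:
  obtains k where "k > 0" "\<And>A B m b b'. m \<ge> 0 \<Longrightarrow> A \<ge> m \<Longrightarrow> B \<ge> m \<Longrightarrow> \<bar>b - b'\<bar> \<le> pi \<Longrightarrow>
    k * m * \<bar>b - b'\<bar> \<le> cmod (of_real A * cis b - of_real B * cis b')"
proof -
  interpret h: fc_curve 1 by unfold_locales simp
  obtain k where k: "k > 0" "\<And>b. 0 \<le> b \<Longrightarrow> b \<le> pi \<Longrightarrow> k * b \<le> sin (b / 2)"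
    using h.sin_q_lower by auto
  show thesis
  proof (rule that[of "2 * k"])
    show "2 * k > 0" using k by simp
    fix A B m b b' :: real
    assume a: "m \<ge> 0" "A \<ge> m" "B \<ge> m" "\<bar>b - b'\<bar> \<le> pi"
    define u where "u = \<bar>b - b'\<bar> / 2"
    have cu: "cos (b - b') = 1 - 2 * (sin u)\<^sup>2"
    proof -
      have "cos (b - b') = cos (2 * u)" by (simp add: u_def abs_if cos_diff)
      then show ?thesis by (simp add: cos_double_sin)
    qed
    have "(cmod (of_real A * cis b - of_real B * cis b'))\<^sup>2 = A\<^sup>2 + B\<^sup>2 - 2 * A * B * cos (b - b')"
    proof -
      have "(cmod (of_real A * cis b - of_real B * cis b'))\<^sup>2 =
        (A * cos b - B * cos b')\<^sup>2 + (A * sin b - B * sin b')\<^sup>2" by (simp add: cmod_power2)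
      also have "\<dots> = A\<^sup>2 * ((sin b)\<^sup>2 + (cos b)\<^sup>2) + B\<^sup>2 * ((sin b')\<^sup>2 + (cos b')\<^sup>2) - 2 * A * B * (cos b * cos b' + sin b * sin b')"
        by algebra
      finally show ?thesis by (simp only: cos_diff sin_cos_squared_add mult_1_right)
    qed
    also have "\<dots> = (A - B)\<^sup>2 + 4 * (A * B) * (sin u)\<^sup>2"
      unfolding cu by (simp add: power2_eq_square algebra_simps)
    also have "\<dots> \<ge> 0 + 4 * (m * m) * (k * \<bar>b - b'\<bar>)\<^sup>2"
    proof -
      have "k * \<bar>b - b'\<bar> \<le> sin u" using k(2)[of "\<bar>b - b'\<bar>"] a by (simp add: u_def)
      then have "(k * \<bar>b - b'\<bar>)\<^sup>2 \<le> (sin u)\<^sup>2" using k(1) by (intro power_mono) auto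
      then show ?thesis using a by (intro add_mono mult_mono) auto
    qed
    finally have "(2 * k * m * \<bar>b - b'\<bar>)\<^sup>2 \<le> (cmod (of_real A * cis b - of_real B * cis b'))\<^sup>2"
      by (simp add: power_mult_distrib power2_eq_square mult_ac)
    then show "2 * k * m * \<bar>b - b'\<bar> \<le> cmod (of_real A * cis b - of_real B * cis b')"
      by (rule power2_le_imp_le) simp
  qed
qed

lemma norm_Ln_le: "w \<noteq> 0 \<Longrightarrow> cmod (Ln w) \<le> \<bar>ln (cmod w)\<bar> + pi"
proof -
  assume w: "w \<noteq> 0"
  have "cmod (Ln w) \<le> \<bar>Re (Ln w)\<bar> + \<bar>Im (Ln w)\<bar>" by (rule cmod_le)
  moreover have "\<bar>Im (Ln w)\<bar> \<le> pi" using mpi_less_Im_Ln[OF w] Im_Ln_le_pi[OF w] by auto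
  ultimately show ?thesis using w by simp
qed

context fc_curve begin

text \<open>Both angles are taken in [0, pi], so their difference is at most pi and the closeness of
  - pi and pi does not interfere.\<close>

lemma xi_dist_lower:
  obtains k where "k > 0" "\<And>r r' b b'. r \<ge> 1/2 \<Longrightarrow> r' \<ge> 1/2 \<Longrightarrow> 0 \<le> b \<Longrightarrow> b \<le> pi \<Longrightarrow> 0 \<le> b' \<Longrightarrow> b' \<le> pi \<Longrightarrow>
    k * \<bar>b - b'\<bar> \<le> cmod (of_real r * xi T b - of_real r' * xi T b')"
proof -
  obtain m where m: "m > 0" "\<And>b. \<bar>b\<bar> \<le> pi \<Longrightarrow> m \<le> rho T b" using rho_lower by blast
  obtain k where k: "k > 0" "\<And>A B m b b'. m \<ge> 0 \<Longrightarrow> A \<ge> m \<Longrightarrow> B \<ge> m \<Longrightarrow> \<bar>b - b'\<bar> \<le> pi \<Longrightarrow>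
    k * m * \<bar>b - b'\<bar> \<le> cmod (of_real A * cis b - of_real B * cis b')" using cis_dist_lower by metis
  show thesis
  proof (rule that[of "k * (m / 2)"])
    show "k * (m / 2) > 0" using k m by simp
    fix r r' b b' :: real
    assume a: "r \<ge> 1/2" "r' \<ge> 1/2" "0 \<le> b" "b \<le> pi" "0 \<le> b'" "b' \<le> pi"
    have mb: "m / 2 \<le> r * rho T b" if "r \<ge> 1/2" "0 \<le> b" "b \<le> pi" for r b
    proof -
      have "(1/2) * m \<le> r * rho T b" using m(1) m(2)[of b] that by (intro mult_mono) auto
      then show ?thesis by simp
    qed
    have "k * (m / 2) * \<bar>b - b'\<bar> \<le> cmod (of_real (r * rho T b) * cis b - of_real (r' * rho T b') * cis b')"
      using a m(1) by (intro k(2) mb) auto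
    then show "k * (m / 2) * \<bar>b - b'\<bar> \<le> cmod (of_real r * xi T b - of_real r' * xi T b')"
      by (simp add: xi_def mult.assoc)
  qed
qed

text \<open>The closed inside, given as an image of a rectangle so that compactness is
  immediate.\<close>

definition fc_cdom where "fc_cdom = (\<lambda>(r, b). of_real r * xi T b) ` ({0..1} \<times> {-pi..pi})"

lemma compact_fc_cdom: "compact fc_cdom"
  unfolding fc_cdom_def
  by (intro compact_continuous_image compact_Times compact_Icc)
     (auto simp: case_prod_unfold intro!: continuous_intros continuous_on_compose2[OF continuous_on_xi])

lemma fc_cdom_cases:
  assumes "s \<in> fc_cdom" obtains "s \<in> fc_dom T" | b where "\<bar>b\<bar> \<le> pi" "s = xi T b"
proof -
  obtain r b where rb: "0 \<le> r" "r \<le> 1" "-pi \<le> b" "b \<le> pi" "s = of_real r * xi T b"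
    using assms by (auto simp: fc_cdom_def)
  have ab: "\<bar>b\<bar> \<le> pi" using rb by auto
  show thesis
  proof (cases "r = 1")
    case True then show thesis using that(2)[OF ab] rb by simp
  next
    case False then show thesis using that(1) mult_xi_in_fc_dom[of r b] ab rb by simp
  qed
qed

text \<open>On the closed inside 1 + s meets the branch cut only at s = -1, and there a power with
  positive exponent is still continuous.\<close>

lemma continuous_on_fc_fun: "continuous_on fc_cdom (fc_fun T a)"
proof -
  have "\<not> (Re (1 + s) < 0 \<and> Im (1 + s) = 0)" if "s \<in> fc_cdom" for s
    using that
  proof (cases rule: fc_cdom_cases)
    case 1 then show ?thesis using one_plus_fc_dom_nonpos[OF 1] by (auto simp: complex_nonpos_Reals_iff)
  next
    case (2 b)
    show ?thesis
    proof (cases "\<bar>b\<bar> < pi")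
      case True then show ?thesis using one_plus_xi_nonpos[OF True] 2 by (auto simp: complex_nonpos_Reals_iff)
    next
      case False
      then have "b = pi \<or> b = - pi" using 2 by linarith
      then show ?thesis using 2 by auto
    qed
  qed
  then show ?thesis unfolding fc_fun_def using T_pos
    by (intro continuous_intros) (auto simp: not_less)
qed

lemma fc_fun_has_derivative:
  assumes "1 + s \<notin> \<real>\<^sub>\<le>\<^sub>0"
  shows "(fc_fun T a has_field_derivative (of_real (1 + T) * (1 + s) powr of_real (1 + T) / (1 + s) - of_real a)) (at s)"
proof -
  have "((\<lambda>s. (1 + s) powr of_real (1 + T)) has_field_derivative of_real (1 + T) * (1 + s) powr (of_real (1 + T) - 1)) (at s)"
    using assms by (auto intro!: derivative_eq_intros)
  moreover have "(1 + s) powr (of_real (1 + T) - 1) = (1 + s) powr of_real (1 + T) / (1 + s)"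
    using assms by (subst powr_diff) (auto simp: powr_to_1)
  ultimately have 1: "((\<lambda>s. (1 + s) powr of_real (1 + T)) has_field_derivative of_real (1 + T) * (1 + s) powr of_real (1 + T) / (1 + s)) (at s)"
    by simp
  have 2: "((\<lambda>s. of_real a * s) has_field_derivative of_real a) (at s)"
    using DERIV_cmult_Id by blast
  show ?thesis unfolding fc_fun_def by (rule DERIV_diff[OF 1 2])
qed

text \<open>The only zeros of the function on the closed domain are the two simple ones on the curve, so it is
  bounded below by the distance to them; this dominates its logarithm.\<close>
lemma fc_fun_lower:
  assumes a: "0 < a" "a < fc_quot T 0" and ba: "0 < ba" "ba < pi" "fc_quot T ba = a"
  obtains k where "k > 0" "\<And>r b. 1/2 \<le> r \<Longrightarrow> r < 1 \<Longrightarrow> \<bar>b\<bar> \<le> pi \<Longrightarrow> k * \<bar>\<bar>b\<bar> - ba\<bar> \<le> cmod (fc_fun T a (of_real r * xi T b))"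
proof -
  define x where "x = xi T ba"
  define d where "d = of_real (1 + T) * (1 + x) powr of_real (1 + T) / (1 + x) - of_real a"
  have abp: "\<bar>ba\<bar> < pi" "\<bar>ba\<bar> \<le> pi" using ba by auto
  have nz: "1 + x \<noteq> 0" using one_plus_xi_nonzero[OF abp(1)] by (simp add: x_def)
  have Ex: "fc_fun T a x = 0" using fc_fun_xi[OF abp(2)] ba by (simp add: x_def)
  \<comment> \<open>The zero is simple: \<open>fc_quot T ba = a\<close> brings the derivative into
    this form, and x is not real.\<close>
  have d_eq: "d = of_real a * (of_real T * x - 1) / (1 + x)"
  proof -
    have "(1 + x) powr of_real (1 + T) = of_real a * x" using powr_xi[OF abp(2)] ba by (simp add: x_def)
    then show ?thesis using nz by (simp add: d_def field_simps)
  qed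
  have "of_real T * x - 1 \<noteq> 0" using Im_xi_pos[OF ba(1,2)] T_pos by (auto simp: x_def complex_eq_iff)
  then have dnz: "d \<noteq> 0" using a nz by (simp add: d_eq)
  have der: "(fc_fun T a has_field_derivative d) (at x)"
    unfolding d_def by (rule fc_fun_has_derivative) (use one_plus_xi_nonpos[OF abp(1)] in \<open>simp add: x_def\<close>)
  define g where "g = (\<lambda>s. if s = x then d else fc_fun T a s / (s - x))"
  \<comment> \<open>Only the upper half is examined, where x is the single zero; conjugation
    transfers the bound to the lower half. The restriction r >= 1/2 is the range of
    \<open>xi_dist_lower\<close>.\<close>
  define K where "K = (\<lambda>(r, b). of_real r * xi T b) ` ({1/2..1} \<times> {0..pi})"
  have Kc: "K \<subseteq> fc_cdom" unfolding K_def fc_cdom_def by (intro image_mono Sigma_mono) auto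
  have "continuous_on {-pi..pi} (xi T)" by (rule continuous_on_xi)
  then have "compact K"
    unfolding K_def
    by (intro compact_continuous_image compact_Times compact_Icc)
       (auto simp: case_prod_unfold intro!: continuous_intros continuous_on_compose2[OF continuous_on_xi])
  moreover have "K \<noteq> {}" by (auto simp: K_def)
  moreover have "continuous_on K g"
    unfolding continuous_on_eq_continuous_within
  proof
    fix s assume s: "s \<in> K"
    show "continuous (at s within K) g"
    proof (cases "s = x")
      case True
      have "((\<lambda>s. fc_fun T a s / (s - x)) \<longlongrightarrow> d) (at x)" using der Ex by (simp add: has_field_derivative_iff)
      then have "(g \<longlongrightarrow> d) (at x)"
        by (rule Lim_transform_eventually) (auto simp: g_def eventually_at_filter)
      then show ?thesis unfolding continuous_within using True by (auto simp: g_def intro: Lim_at_imp_Lim_at_within)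
    next
      case False
      have "continuous (at s within K) (\<lambda>s. fc_fun T a s / (s - x))"
        using continuous_on_subset[OF continuous_on_fc_fun Kc] s False
        by (intro continuous_intros) (auto simp: continuous_on_eq_continuous_within)
      then have "((\<lambda>s. fc_fun T a s / (s - x)) \<longlongrightarrow> g s) (at s within K)"
        using False by (simp add: continuous_within g_def)
      moreover have "\<forall>\<^sub>F y in at s within K. fc_fun T a y / (y - x) = g y"
      proof -
        have "\<forall>\<^sub>F y in nhds s. y \<noteq> x" using t1_space_nhds[OF False] .
        then have "\<forall>\<^sub>F y in at s within K. y \<noteq> x" by (rule filter_leD[OF at_within_le_nhds])
        then show ?thesis by eventually_elim (simp add: g_def)
      qed
      ultimately have "(g \<longlongrightarrow> g s) (at s within K)" by (rule Lim_transform_eventually)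
      then show ?thesis by (simp add: continuous_within)
    qed
  qed
  ultimately obtain s0 where s0: "s0 \<in> K" "\<And>s. s \<in> K \<Longrightarrow> cmod (g s0) \<le> cmod (g s)"
    using continuous_attains_inf[of K "\<lambda>s. cmod (g s)"] continuous_on_norm by blast
  have gnz: "g s \<noteq> 0" if "s \<in> K" for s
  proof (cases "s = x")
    case True then show ?thesis using dnz by (simp add: g_def)
  next
    case False
    have "fc_fun T a s \<noteq> 0"
    proof -
      obtain r b where rb: "1/2 \<le> r" "r \<le> 1" "0 \<le> b" "b \<le> pi" "s = of_real r * xi T b"
        using \<open>s \<in> K\<close> by (auto simp: K_def)
      show ?thesis
      proof (cases "r = 1")
        case True
        have "b \<noteq> ba" using False rb True by (auto simp: x_def)
        then have "fc_quot T b \<noteq> a" using fc_quot_neq[of b ba] fc_quot_neq[of ba b] ba rb by (cases "b < ba") auto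
        then show ?thesis using fc_fun_xi[of b a] xi_nonzero[of b] rb True by simp
      next
        case f: False
        then have "s \<in> fc_dom T" using mult_xi_in_fc_dom[of r b] rb by auto
        from fc_fun_nonpos[OF this, of a] a show ?thesis by auto
      qed
    qed
    then show ?thesis using False by (simp add: g_def)
  qed
  define k0 where "k0 = cmod (g s0)"
  have k0: "k0 > 0" using gnz s0 by (simp add: k0_def)
  have low: "k0 * cmod (s - x) \<le> cmod (fc_fun T a s)" if "s \<in> K" for s
  proof (cases "s = x")
    case False
    then show ?thesis using s0(2)[OF that] by (simp add: k0_def g_def norm_divide field_simps)
  qed simp
  obtain k1 where k1: "k1 > 0" "\<And>r r' b b'. r \<ge> 1/2 \<Longrightarrow> r' \<ge> 1/2 \<Longrightarrow> 0 \<le> b \<Longrightarrow> b \<le> pi \<Longrightarrow> 0 \<le> b' \<Longrightarrow> b' \<le> pi \<Longrightarrow>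
    k1 * \<bar>b - b'\<bar> \<le> cmod (of_real r * xi T b - of_real r' * xi T b')" using xi_dist_lower by metis
  show thesis
  proof (rule that[of "k0 * k1"])
    show "k0 * k1 > 0" using k0 k1 by simp
    fix r b :: real assume rb: "1/2 \<le> r" "r < 1" "\<bar>b\<bar> \<le> pi"
    define s where "s = of_real r * xi T \<bar>b\<bar>"
    have sK: "s \<in> K" unfolding s_def K_def using rb by (auto intro!: image_eqI[of _ _ "(r, \<bar>b\<bar>)"])
    have "k1 * \<bar>\<bar>b\<bar> - ba\<bar> \<le> cmod (s - x)"
      using k1(2)[of r 1 "\<bar>b\<bar>" ba] rb ba by (simp add: s_def x_def)
    then have "k0 * (k1 * \<bar>\<bar>b\<bar> - ba\<bar>) \<le> k0 * cmod (s - x)" using k0 by (intro mult_left_mono) auto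
    also have "\<dots> \<le> cmod (fc_fun T a s)" by (rule low[OF sK])
    also have "\<dots> = cmod (fc_fun T a (of_real r * xi T b))"
    proof (cases "b \<ge> 0")
      case True then show ?thesis by (simp add: s_def)
    next
      case False
      then have "s = cnj (of_real r * xi T b)" by (simp add: s_def xi_minus)
      moreover have "of_real r * xi T b \<in> fc_dom T" using mult_xi_in_fc_dom rb by auto
      ultimately show ?thesis by (simp add: cnj_fc_fun del: complex_cnj_mult)
    qed
    finally show "k0 * k1 * \<bar>\<bar>b\<bar> - ba\<bar> \<le> cmod (fc_fun T a (of_real r * xi T b))" by (simp add: mult.assoc)
  qed
qed

lemma fc_quot_surj: "0 < a \<Longrightarrow> a < fc_quot T 0 \<Longrightarrow> \<exists>b. 0 < b \<and> b < pi \<and> fc_quot T b = a"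
proof -
  assume a: "0 < a" "a < fc_quot T 0"
  have "\<exists>b\<ge>0. b \<le> pi \<and> fc_quot T b = a"
    by (rule IVT2') (use a continuous_on_subset[OF continuous_on_fc_quot] in auto)
  then obtain b where b: "0 \<le> b" "b \<le> pi" "fc_quot T b = a" by blast
  then have "b \<noteq> 0" "b \<noteq> pi" using a by auto
  then show ?thesis using b by (intro exI[of _ b]) auto
qed

text \<open>One passage to the boundary for both positions of the pole: \<open>lam < 1\<close> puts
  \<open>s0\<close> inside, \<open>lam > 1\<close> outside.\<close>

lemma Ln_fc_fun_limit:
  assumes a: "0 < a" "a < fc_quot T 0" and s0: "s0 = of_real lam * xi T b0" "lam > 0" "lam \<noteq> 1" "\<bar>b0\<bar> \<le> pi"
    and int: "\<And>r. max (1/2) (if lam < 1 then lam else 0) < r \<Longrightarrow> r < 1 \<Longrightarrow>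
      ((\<lambda>b. Ln (fc_fun T a (of_real r * xi T b)) * (1 / (of_real r * xi T b - s0)\<^sup>2) * (of_real r * dxi T b)) has_integral I) {-pi..pi}"
  shows "((\<lambda>b. Ln (fc_fun T a (xi T b)) * (1 / (xi T b - s0)\<^sup>2) * dxi T b) has_integral I) {-pi..pi}"
proof -
  obtain ba where ba: "0 < ba" "ba < pi" "fc_quot T ba = a" using fc_quot_surj[OF a] by blast
  \<comment> \<open>The radii must exceed 1/2 for \<open>fc_fun_lower\<close> and, if the pole is
    inside, also its radius \<open>lam\<close>. Taking \<open>r0\<close> halfway between
    \<open>l\<close> and 1 keeps the closed range [r0, 1] away from the pole.\<close>
  define l where "l = max (1/2) (if lam < 1 then lam else 0)"
  define r0 where "r0 = (l + 1) / 2"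
  have l1: "l < 1" "l \<ge> 1/2" using s0 by (auto simp: l_def)
  have r0: "l < r0" "r0 < 1" using l1 by (auto simp: r0_def)
  have ne: "of_real r * xi T b \<noteq> s0" if "r0 \<le> r" "r \<le> 1" "\<bar>b\<bar> \<le> pi" for r b
  proof
    assume "of_real r * xi T b = s0"
    then have "r = lam" using mult_xi_eq[of r lam b b0] that s0 r0 l1 by auto
    then show False using that r0 l1 s0 by (auto simp: l_def split: if_splits)
  qed
  obtain dd where dd: "dd > 0" "\<And>r b. r0 \<le> r \<Longrightarrow> r \<le> 1 \<Longrightarrow> \<bar>b\<bar> \<le> pi \<Longrightarrow> dd \<le> cmod (of_real r * xi T b - s0)"
    using curve_dist_pos[of r0 s0] ne r0 by (metis less_imp_le)
  obtain k where k: "k > 0" "\<And>r b. 1/2 \<le> r \<Longrightarrow> r < 1 \<Longrightarrow> \<bar>b\<bar> \<le> pi \<Longrightarrow> k * \<bar>\<bar>b\<bar> - ba\<bar> \<le> cmod (fc_fun T a (of_real r * xi T b))"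
    using fc_fun_lower[OF a ba] by metis
  have "bounded (fc_fun T a ` fc_cdom)"
    by (intro compact_imp_bounded compact_continuous_image continuous_on_fc_fun compact_fc_cdom)
  then obtain M where M: "M > 0" "\<And>s. s \<in> fc_cdom \<Longrightarrow> cmod (fc_fun T a s) \<le> M"
    unfolding bounded_pos by auto
  \<comment> \<open>The constants come from the lower bound \<open>k\<close>, the upper bound
    \<open>M\<close> and the argument; the two logarithms carry the singularities at the zeros of
    the boundary function.\<close>
  define h where "h = (\<lambda>b. (\<bar>ln k\<bar> + \<bar>ln M\<bar> + pi) + (\<bar>ln \<bar>b - ba\<bar>\<bar> + \<bar>ln \<bar>b - (- ba)\<bar>\<bar>))"
  \<comment> \<open>Besides the zeros at \<open>ba\<close> and \<open>- ba\<close>, the angles with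
    a real curve point are excluded. Everywhere else the boundary value is a nonzero real multiple
    of a nonreal point, hence off the cut of \<open>Ln\<close>.\<close>
  define N where "N = {0, pi, - pi, ba, - ba}"
  show ?thesis
  proof (rule curve_limit[where ?r0.0=r0 and N=N and h=h and K="1 / dd\<^sup>2" and f="\<lambda>s. Ln (fc_fun T a s)" and k = "\<lambda>s. 1 / (s - s0)\<^sup>2"])
    show "r0 < 1" "finite N" "0 \<in> N" using r0 by (auto simp: N_def)
    show "\<And>r. r0 < r \<Longrightarrow> r < 1 \<Longrightarrow> ((\<lambda>b. Ln (fc_fun T a (of_real r * xi T b)) * (1 / (of_real r * xi T b - s0)\<^sup>2) * (of_real r * dxi T b)) has_integral I) {-pi..pi}"
      using int r0 by (auto simp: l_def)
    show "h integrable_on {-pi..pi}" unfolding h_def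
      by (intro integrable_add ln_abs_integrable integrable_const_ivl)
    show "cmod (1 / (of_real r * xi T b - s0)\<^sup>2) \<le> 1 / dd\<^sup>2" if "r0 < r" "r < 1" "\<bar>b\<bar> \<le> pi" for r b
    proof -
      have "dd\<^sup>2 \<le> (cmod (of_real r * xi T b - s0))\<^sup>2" using dd(1) dd(2)[of r b] that by (intro power_mono) auto
      then show ?thesis using dd(1) by (simp add: norm_divide norm_power frac_le)
    qed
    show "isCont (\<lambda>s. 1 / (s - s0)\<^sup>2) (xi T b)" if "\<bar>b\<bar> \<le> pi" for b
      using ne[of 1 b] that r0 by (intro continuous_intros) auto
  next
    fix r b assume rb: "r0 < r" "0 < r" "r < 1" "b \<in> {-pi..pi} - N"
    then have bb: "\<bar>b\<bar> \<le> pi" "\<bar>\<bar>b\<bar> - ba\<bar> > 0" using ba by (auto simp: N_def abs_if split: if_splits)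
    define w where "w = fc_fun T a (of_real r * xi T b)"
    have lo: "k * \<bar>\<bar>b\<bar> - ba\<bar> \<le> cmod w" using k(2)[of r b] rb r0 l1 bb by (simp add: w_def)
    have "of_real r * xi T b \<in> fc_cdom" unfolding fc_cdom_def using rb by (auto intro!: image_eqI[of _ _ "(r, b)"])
    then have hi: "cmod w \<le> M" using M by (simp add: w_def)
    have pos: "k * \<bar>\<bar>b\<bar> - ba\<bar> > 0" using k bb by simp
    then have wnz: "w \<noteq> 0" "cmod w > 0" using lo by auto
    have "ln (cmod w) \<le> \<bar>ln M\<bar>" using hi wnz M by (meson abs_ge_self ln_le_cancel_iff order_trans)
    moreover have "ln (cmod w) \<ge> ln k + ln \<bar>\<bar>b\<bar> - ba\<bar>"
    proof -
      have "ln (k * \<bar>\<bar>b\<bar> - ba\<bar>) \<le> ln (cmod w)" using lo pos wnz by (subst ln_le_cancel_iff) auto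
      then show ?thesis using k bb by (simp add: ln_mult)
    qed
    moreover have "\<bar>ln \<bar>\<bar>b\<bar> - ba\<bar>\<bar> \<le> \<bar>ln \<bar>b - ba\<bar>\<bar> + \<bar>ln \<bar>b - (- ba)\<bar>\<bar>"
    proof (cases "b \<ge> 0")
      case True then show ?thesis by simp
    next
      case False
      then have "\<bar>\<bar>b\<bar> - ba\<bar> = \<bar>b - (- ba)\<bar>" by simp
      then show ?thesis by (simp only:)
    qed
    ultimately have "\<bar>ln (cmod w)\<bar> \<le> \<bar>ln k\<bar> + \<bar>ln M\<bar> + (\<bar>ln \<bar>b - ba\<bar>\<bar> + \<bar>ln \<bar>b - (- ba)\<bar>\<bar>)" by linarith
    then show "cmod (Ln (fc_fun T a (of_real r * xi T b))) \<le> h b"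
      using norm_Ln_le[OF wnz(1)] by (simp add: h_def w_def)
  next
    fix b assume b: "b \<in> {-pi..pi} - N"
    then have bb: "\<bar>b\<bar> < pi" "\<bar>b\<bar> \<le> pi" "b \<noteq> 0" "\<bar>b\<bar> \<noteq> ba" by (auto simp: N_def abs_if split: if_splits)
    have "Im (xi T b) \<noteq> 0"
    proof (cases "b > 0")
      case True then show ?thesis using Im_xi_pos[of b] bb by auto
    next
      case False then show ?thesis using Im_xi_pos[of "-b"] bb by (auto simp: xi_minus)
    qed
    moreover have "fc_quot T b \<noteq> a"
    proof -
      have "fc_quot T \<bar>b\<bar> \<noteq> a" using fc_quot_neq[of "\<bar>b\<bar>" ba] fc_quot_neq[of ba "\<bar>b\<bar>"] ba bb by (cases "\<bar>b\<bar> < ba") auto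
      then show ?thesis by (auto simp: abs_if split: if_splits)
    qed
    ultimately have np: "fc_fun T a (xi T b) \<notin> \<real>\<^sub>\<le>\<^sub>0"
      using fc_fun_xi[OF bb(2)] by (auto simp: complex_nonpos_Reals_iff)
    have "isCont (fc_fun T a) (xi T b)"
      using fc_fun_has_derivative[OF one_plus_xi_nonpos[OF bb(1)]] DERIV_isCont by blast
    then have c: "isCont (\<lambda>s. Ln (fc_fun T a s)) (xi T b)" using np by (intro continuous_intros) auto
    have "((\<lambda>r. of_real r * xi T b) \<longlongrightarrow> of_real 1 * xi T b) (at_left 1)" by (intro tendsto_intros)
    then show "((\<lambda>r. Ln (fc_fun T a (of_real r * xi T b))) \<longlongrightarrow> Ln (fc_fun T a (xi T b))) (at_left 1)"
      using isCont_tendsto_compose[OF c] by simp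
  qed
qed

lemma Ln_fc_fun_holomorphic: "0 < a \<Longrightarrow> a < fc_quot T 0 \<Longrightarrow> (\<lambda>s. Ln (fc_fun T a s)) holomorphic_on fc_dom T"
proof -
  assume a: "0 < a" "a < fc_quot T 0"
  have "fc_fun T a field_differentiable at s" if "s \<in> fc_dom T" for s
    using fc_fun_has_derivative[OF one_plus_fc_dom_nonpos[OF that]] field_differentiable_def by blast
  then have "fc_fun T a holomorphic_on fc_dom T"
    unfolding holomorphic_on_def using field_differentiable_at_within by blast
  then show ?thesis using fc_fun_nonpos a by (intro holomorphic_intros) auto
qed

text \<open>The double pole is not in the domain, so the whole integrand is holomorphic
  there.\<close>

lemma Ln_fc_fun_integral_outside:
  assumes a: "0 < a" "a < fc_quot T 0" and s0: "s0 = of_real lam * xi T b0" "lam > 1" "\<bar>b0\<bar> \<le> pi"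
  shows "((\<lambda>b. Ln (fc_fun T a (xi T b)) * (1 / (xi T b - s0)\<^sup>2) * dxi T b) has_integral 0) {-pi..pi}"
proof (rule Ln_fc_fun_limit[OF a s0(1) _ _ s0(3)])
  fix r :: real assume r: "max (1/2) (if lam < 1 then lam else 0) < r" "r < 1"
  have "s0 \<notin> fc_dom T"
  proof
    assume f: "s0 \<in> fc_dom T"
    have nz: "s0 \<noteq> 0" using s0 xi_nonzero by auto
    define k where "k = cmod s0 / rho T (Arg s0)"
    have A: "\<bar>Arg s0\<bar> \<le> pi" using Arg_bounded[of s0] by auto
    have "of_real k * xi T (Arg s0) = of_real lam * xi T b0" using xi_Arg[OF nz] s0 by (simp add: k_def)
    moreover have "k > 0" using nz rho_pos[OF A] by (simp add: k_def)
    ultimately have "k = lam" using mult_xi_eq[of k lam "Arg s0" b0] s0 A by simp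
    moreover have "k < 1" using f rho_pos[OF A] by (simp add: k_def fc_dom_def)
    ultimately show False using s0 by simp
  qed
  then have "(\<lambda>s. Ln (fc_fun T a s) * (1 / (s - s0)\<^sup>2)) holomorphic_on fc_dom T"
    by (intro holomorphic_intros Ln_fc_fun_holomorphic a) auto
  from curve_integral_holomorphic[OF this, of r] r
  show "((\<lambda>b. Ln (fc_fun T a (of_real r * xi T b)) * (1 / (of_real r * xi T b - s0)\<^sup>2) * (of_real r * dxi T b)) has_integral 0) {-pi..pi}"
    by (simp add: mult.assoc)
qed (use s0 in auto)

lemma Ln_fc_fun_integral_inside:
  assumes a: "0 < a" "a < fc_quot T 0" and t: "t = of_real r1 * xi T b1" "0 < r1" "r1 < 1" "\<bar>b1\<bar> \<le> pi"
  shows "((\<lambda>b. Ln (fc_fun T a (xi T b)) * (1 / (xi T b - t)\<^sup>2) * dxi T b) has_integral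
     2 * pi * \<i> * ((of_real (1 + T) * (1 + t) powr of_real (1 + T) / (1 + t) - of_real a) / fc_fun T a t)) {-pi..pi}"
proof -
  have td: "t \<in> fc_dom T" using mult_xi_in_fc_dom[of r1 b1] t by simp
  have "((\<lambda>s. Ln (fc_fun T a s)) has_field_derivative inverse (fc_fun T a t) * (of_real (1 + T) * (1 + t) powr of_real (1 + T) / (1 + t) - of_real a)) (at t)"
    by (rule DERIV_chain2[OF has_field_derivative_Ln fc_fun_has_derivative])
       (use fc_fun_nonpos[OF td, of a] a one_plus_fc_dom_nonpos[OF td] in auto)
  from DERIV_imp_deriv[OF this]
  have d: "deriv (\<lambda>s. Ln (fc_fun T a s)) t = (of_real (1 + T) * (1 + t) powr of_real (1 + T) / (1 + t) - of_real a) / fc_fun T a t"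
    by (simp add: divide_inverse mult.commute)
  show ?thesis unfolding d[symmetric]
    by (rule Ln_fc_fun_limit[OF a t(1) t(2) _ t(4)])
       (use t curve_integral_deriv[OF Ln_fc_fun_holomorphic[OF a] t(2) _ _ t(4) t(1)] in auto)
qed

end


section \<open>The kernel identity for a point mass\<close>

text \<open>\<open>Jc\<close> at the curve point \<open>xi th b\<close> in real powers, since (1+s)
  ((1+s)/s)^(1/th) is the (1/th)-th power of (1+s)^(1+th)/s; for 0 < b < pi this is
  \<open>Jc_xi\<close>.\<close>

definition Jr :: "real \<Rightarrow> real \<Rightarrow> real \<Rightarrow> real" where
  "Jr c th b = c * fc_quot th b powr (1 / th)"

definition dJr :: "real \<Rightarrow> real \<Rightarrow> real \<Rightarrow> real" where
  "dJr c th b = Jr c th b * dln_fc_quot th b / th"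

locale fuss =
  fixes th c :: real
  assumes th_pos: "th > 0" and c_pos: "c > 0"
begin

text \<open>\<open>A\<close> is the curve itself and \<open>S\<close> its image under s ->
  1/s.\<close>

sublocale A: fc_curve th by unfold_locales (rule th_pos)
sublocale S: fc_curve "1 / th" by unfold_locales (simp add: th_pos)

abbreviation "\<xi> \<equiv> xi th"
abbreviation "\<xi>' \<equiv> dxi th"
abbreviation "J \<equiv> Jr c th"
abbreviation "J' \<equiv> dJr c th"
abbreviation "sg \<equiv> complex_of_real (1 / th)"

lemma J_minus [simp]: "J (- b) = J b"
  by (simp add: Jr_def)

lemma J_pi [simp]: "J pi = 0"
  by (simp add: Jr_def)

lemma J_pos: "\<bar>b\<bar> < pi \<Longrightarrow> J b > 0"
  using A.fc_quot_pos[of b] c_pos by (simp add: Jr_def)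

lemma J_nonneg: "J b \<ge> 0"
  using c_pos by (simp add: Jr_def)

lemma J_0: "J 0 = c * (1 + th) powr (1 + 1 / th) / th"
proof -
  have "fc_quot th 0 powr (1 / th) = (1 + 1 / th) powr ((1 + th) * (1 / th)) * th powr (1 / th)"
    using th_pos by (simp add: A.fc_quot_0 powr_mult powr_powr)
  also have "(1 + th) * (1 / th) = 1 + 1 / th" using th_pos by (simp add: field_simps)
  also have "1 + 1 / th = (1 + th) / th" using th_pos by (simp add: field_simps)
  also have "((1 + th) / th) powr ((1 + th) / th) = (1 + th) powr ((1 + th) / th) / th powr ((1 + th) / th)"
    using th_pos by (simp add: powr_divide)
  also have "(1 + th) / th = 1 + 1 / th" using th_pos by (simp add: field_simps)
  also have "th powr (1 + 1 / th) = th * th powr (1 / th)" using th_pos by (simp add: powr_add)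
  finally show ?thesis using th_pos by (simp add: Jr_def)
qed

lemma J_strict: "0 \<le> u \<Longrightarrow> u < v \<Longrightarrow> v \<le> pi \<Longrightarrow> J v < J u"
proof -
  assume a: "0 \<le> u" "u < v" "v \<le> pi"
  have "fc_quot th v \<ge> 0" using A.fc_quot_pos[of v] a by (cases "v = pi") auto
  then have "fc_quot th v powr (1 / th) < fc_quot th u powr (1 / th)"
    using A.fc_quot_strict[OF a] th_pos by (intro powr_less_mono2) auto
  then show ?thesis using c_pos by (simp add: Jr_def)
qed

lemma continuous_on_J: "continuous_on {-pi..pi} J"
proof -
  have "fc_quot th x \<ge> 0" if "x \<in> {-pi..pi}" for x
    unfolding fc_quot_def using A.rho_pos[of x] that by (auto simp: abs_le_iff)
  then show ?thesis unfolding Jr_def using th_pos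
    by (intro continuous_on_mult continuous_on_const continuous_on_powr' A.continuous_on_fc_quot) auto
qed

lemma J_range: "\<bar>b\<bar> \<le> pi \<Longrightarrow> J b \<in> {0..J 0}"
proof -
  assume b: "\<bar>b\<bar> \<le> pi"
  have "J b = J \<bar>b\<bar>" by (auto simp: abs_if)
  then show ?thesis using J_strict[of 0 "\<bar>b\<bar>"] b J_nonneg by (cases "b = 0") auto
qed

lemma J_surj: "0 < x \<Longrightarrow> x < J 0 \<Longrightarrow> \<exists>b. 0 < b \<and> b < pi \<and> J b = x"
proof -
  assume x: "0 < x" "x < J 0"
  have "\<exists>b\<ge>0. b \<le> pi \<and> J b = x"
    by (rule IVT2') (use x continuous_on_subset[OF continuous_on_J] in auto)
  then obtain b where b: "0 \<le> b" "b \<le> pi" "J b = x" by blast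
  then have "b \<noteq> 0" "b \<noteq> pi" using x by auto
  then show ?thesis using b by (intro exI[of _ b]) auto
qed

lemma J_has_derivative:
  assumes "b \<noteq> 0" "\<bar>b\<bar> < pi"
  shows "(J has_real_derivative J' b) (at b)"
proof -
  have q: "fc_quot th b > 0" using A.fc_quot_pos assms by simp
  have "((\<lambda>b. exp ((1 / th) * ln (fc_quot th b))) has_real_derivative (exp ((1 / th) * ln (fc_quot th b)) * ((1 / th) * dln_fc_quot th b))) (at b)"
    by (rule DERIV_chain2[OF DERIV_exp DERIV_cmult[OF A.ln_fc_quot_derivative(1)[OF assms]]])
  then have "((\<lambda>b. c * exp ((1 / th) * ln (fc_quot th b))) has_real_derivative (c * (exp ((1 / th) * ln (fc_quot th b)) * ((1 / th) * dln_fc_quot th b)))) (at b)"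
    by (rule DERIV_cmult)
  moreover have "c * (exp ((1 / th) * ln (fc_quot th b)) * ((1 / th) * dln_fc_quot th b)) = J' b"
    using q by (simp add: dJr_def Jr_def powr_def)
  ultimately have "((\<lambda>b. c * exp ((1 / th) * ln (fc_quot th b))) has_real_derivative J' b) (at b)" by simp
  then show ?thesis
    by (rule has_field_derivative_transform_within_open[where S="{-pi<..<pi}"])
       (use assms A.fc_quot_pos in \<open>auto simp: abs_less_iff Jr_def powr_def less_imp_neq[symmetric]\<close>)
qed

text \<open>The differential equation J'/J = (s - 1/th) / (s (s+1)) along the curve, with
  denominators cleared so that it can be used near the critical points.\<close>

lemma dJ_eq:
  assumes "b \<noteq> 0" "\<bar>b\<bar> < pi"
  shows "of_real (J' b) * (\<xi> b * (\<xi> b + 1)) = of_real (J b) * \<xi>' b * (\<xi> b - sg)"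
proof -
  have nz: "\<xi> b \<noteq> 0" "1 + \<xi> b \<noteq> 0" using A.xi_nonzero[of b] A.one_plus_xi_nonzero[of b] assms by auto
  have "of_real (J' b) = of_real (J b) * of_real (dln_fc_quot th b) / complex_of_real th" by (simp add: dJr_def)
  also have "\<dots> = of_real (J b) * (\<xi>' b * (of_real th * \<xi> b - 1) / (\<xi> b * (1 + \<xi> b))) / complex_of_real th"
    by (simp only: A.ln_fc_quot_derivative(2)[OF assms])
  finally have e: "of_real (J' b) = of_real (J b) * (\<xi>' b * (of_real th * \<xi> b - 1) / (\<xi> b * (1 + \<xi> b))) / complex_of_real th" .
  have "of_real (J' b) * (\<xi> b * (\<xi> b + 1)) = of_real (J b) * (\<xi>' b * (of_real th * \<xi> b - 1)) / complex_of_real th"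
    unfolding e using nz by (simp add: add.commute)
  also have "\<dots> = of_real (J b) * \<xi>' b * ((of_real th * \<xi> b - 1) / complex_of_real th)" by simp
  also have "(of_real th * \<xi> b - 1) / complex_of_real th = \<xi> b - sg"
    using th_pos by (simp add: diff_divide_distrib)
  finally show ?thesis .
qed

lemma dJ_minus: "J' (- b) = - J' b"
proof -
  have "dln_fc_quot th (- b) = - dln_fc_quot th b"
  proof -
    have "dxi th (- b) * (of_real th * \<xi> (- b) - 1) / (\<xi> (- b) * (1 + \<xi> (- b)))
      = - cnj (dxi th b * (of_real th * \<xi> b - 1) / (\<xi> b * (1 + \<xi> b)))"
      by (simp add: A.dxi_minus A.xi_minus)
    then show ?thesis unfolding dln_fc_quot_def by (simp only: uminus_complex.sel cnj.sel)
  qed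
  then show ?thesis by (simp add: dJr_def)
qed

lemma dJ_nonzero: "0 < b \<Longrightarrow> b < pi \<Longrightarrow> J' b \<noteq> 0"
  using A.dln_fc_quot_nonzero[of b] J_pos[of b] th_pos by (simp add: dJr_def)

lemma xi_S: "xi (1 / th) (- b) = 1 / \<xi> b"
  by (rule xi_inverse[OF th_pos])

text \<open>On the inverted curve the real quotient is J/c, on the original one it is (J/c)^th. This
  is why the two functions \<open>fc_fun\<close> produce the two factors x - z and x^th -
  z^th.\<close>

lemma fc_quot_S: "\<bar>b\<bar> \<le> pi \<Longrightarrow> fc_quot (1 / th) b = J b / c"
proof -
  assume b: "\<bar>b\<bar> \<le> pi"
  have r: "rho th b > 0" using A.rho_pos b by simp
  have "fc_quot (1 / th) b = fc_quot (1 / th) (- b)" by simp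
  also have "\<dots> = cmod (1 + 1 / \<xi> b) powr (1 + 1 / th) / (1 / rho th b)"
    unfolding fc_quot_def using rho_inverse[OF th_pos, of "- b"] by (simp add: xi_S)
  also have "cmod (1 + 1 / \<xi> b) = cmod (1 + \<xi> b) / rho th b"
  proof -
    have "1 + 1 / \<xi> b = (1 + \<xi> b) / \<xi> b" using A.xi_nonzero[OF b] by (simp add: field_simps)
    then show ?thesis using A.norm_xi[OF b] by (simp add: norm_divide)
  qed
  also have "(cmod (1 + \<xi> b) / rho th b) powr (1 + 1 / th) / (1 / rho th b)
     = cmod (1 + \<xi> b) powr (1 + 1 / th) / rho th b powr (1 / th)"
    using r by (simp add: powr_divide powr_add)
  also have "\<dots> = fc_quot th b powr (1 / th)"
  proof -
    have "1 + 1 / th = (1 + th) * (1 / th)" using th_pos by (simp add: field_simps)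
    then show ?thesis unfolding fc_quot_def using r by (simp add: powr_divide powr_powr del: times_divide_eq_right)
  qed
  finally show ?thesis using c_pos by (simp add: Jr_def)
qed

lemma fc_quot_J: "\<bar>b\<bar> \<le> pi \<Longrightarrow> fc_quot th b = (J b / c) powr th"
proof -
  assume b: "\<bar>b\<bar> \<le> pi"
  have "fc_quot th b \<ge> 0" unfolding fc_quot_def using A.rho_pos[OF b] by simp
  then show ?thesis using th_pos c_pos by (simp add: Jr_def powr_powr)
qed

lemma dxi_S:
  assumes "b \<noteq> 0" "\<bar>b\<bar> \<le> pi"
  shows "dxi (1 / th) (- b) = \<xi>' b / (\<xi> b)\<^sup>2"
proof -
  have nz: "\<xi> b \<noteq> 0" using A.xi_nonzero assms by simp
  have "((xi (1 / th) \<circ> uminus) has_vector_derivative (- 1) *\<^sub>R dxi (1 / th) (- b)) (at b)"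
    by (rule vector_diff_chain_at)
       (use S.xi_has_derivative[of "- b"] assms in \<open>auto intro!: derivative_eq_intros\<close>)
  moreover have "xi (1 / th) \<circ> uminus = (\<lambda>b. 1 / \<xi> b)" using xi_S by (auto simp: fun_eq_iff)
  moreover have "((\<lambda>b. 1 / \<xi> b) has_vector_derivative - \<xi>' b / (\<xi> b)\<^sup>2) (at b)"
  proof -
    have "((\<lambda>z. 1 / z) has_field_derivative - 1 / (\<xi> b)\<^sup>2) (at (\<xi> b))"
      using nz by (auto intro!: derivative_eq_intros simp: power2_eq_square)
    from field_vector_diff_chain_at[OF A.xi_has_derivative[OF assms] this]
    show ?thesis by (simp add: o_def)
  qed
  ultimately have "(- 1) *\<^sub>R dxi (1 / th) (- b) = - \<xi>' b / (\<xi> b)\<^sup>2"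
    using vector_derivative_unique_at by metis
  then show ?thesis by simp
qed

lemma Im_xi_nonzero: "b \<noteq> 0 \<Longrightarrow> \<bar>b\<bar> < pi \<Longrightarrow> Im (\<xi> b) \<noteq> 0"
  using A.Im_xi_pos[of b] A.Im_xi_pos[of "-b"] by (cases "b > 0") (auto simp: A.xi_minus)

text \<open>The arguments of the two logarithms are opposite, so the sum is real.\<close>
lemma Ln_sum:
  assumes z: "0 < z" "z < J 0" and b: "b \<noteq> 0" "\<bar>b\<bar> < pi" "J b \<noteq> z"
  shows "Ln (fc_fun th ((z / c) powr th) (\<xi> b)) + Ln (fc_fun (1 / th) (z / c) (xi (1 / th) (- b)))
    = of_real (ln \<bar>J b - z\<bar> + ln \<bar>J b powr th - z powr th\<bar> - (1 + th) * ln c)"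
proof -
  have bb: "\<bar>b\<bar> \<le> pi" using b by simp
  define D where "D = (J b / c) powr th - (z / c) powr th"
  define D' where "D' = J b / c - z / c"
  have E1: "fc_fun th ((z / c) powr th) (\<xi> b) = of_real D * \<xi> b"
    using A.fc_fun_xi[OF bb] fc_quot_J[OF bb] by (simp add: D_def)
  have E2: "fc_fun (1 / th) (z / c) (xi (1 / th) (- b)) = of_real D' * (1 / \<xi> b)"
    using S.fc_fun_xi[of "- b"] fc_quot_S[of "- b"] bb by (simp add: D'_def xi_S)
  have Jb: "J b > 0" using J_pos b by simp
  \<comment> \<open>Both real factors D and D' have the sign of J b - z. Absorbing this sign into u
    leaves positive multiples of u and 1/u, and Ln (1/u) = - Ln u because u is not real.\<close>
  define e where "e = (if J b > z then 1 else - 1 :: real)"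
  define u where "u = of_real e * \<xi> b"
  have e2: "e * e = 1" by (simp add: e_def)
  have u: "Im u \<noteq> 0" using Im_xi_nonzero[OF b(1,2)] by (simp add: u_def e_def)
  then have unp: "u \<notin> \<real>\<^sub>\<le>\<^sub>0" "u \<noteq> 0" by (auto simp: complex_nonpos_Reals_iff)
  have pm: "(J b / c) powr th > (z / c) powr th \<longleftrightarrow> J b > z"
  proof -
    have "(J b / c) powr th > (z / c) powr th \<longleftrightarrow> J b / c > z / c"
      using z Jb c_pos th_pos by (metis divide_pos_pos linorder_neqE_linordered_idom not_less_iff_gr_or_eq powr_less_mono2 less_imp_le)
    then show ?thesis using c_pos by (simp add: divide_less_cancel)
  qed
  have pm2: "(J b / c) powr th \<noteq> (z / c) powr th"
  proof
    assume "(J b / c) powr th = (z / c) powr th"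
    then have "((J b / c) powr th) powr (1 / th) = ((z / c) powr th) powr (1 / th)" by simp
    then show False using Jb z c_pos th_pos b by (simp add: powr_powr)
  qed
  have D: "D = \<bar>D\<bar> * e" "\<bar>D\<bar> > 0" using pm pm2 by (auto simp: D_def e_def)
  have D': "D' = \<bar>D'\<bar> * e" "\<bar>D'\<bar> > 0" using b(3) c_pos by (auto simp: D'_def e_def divide_simps)
  have "of_real D * \<xi> b = of_real \<bar>D\<bar> * u" by (subst D(1)) (simp add: u_def)
  then have L1: "Ln (of_real D * \<xi> b) = of_real (ln \<bar>D\<bar>) + Ln u"
    using Ln_times_of_real[OF D(2) unp(2)] Ln_of_real[OF D(2)] by simp
  have "1 / \<xi> b = of_real e * inverse u" using e2 unp by (simp add: u_def e_def divide_inverse)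
  then have "of_real D' * (1 / \<xi> b) = of_real (\<bar>D'\<bar> * (e * e)) * inverse u"
    by (subst D'(1)) (simp only: of_real_mult mult.assoc)
  then have "of_real D' * (1 / \<xi> b) = of_real \<bar>D'\<bar> * inverse u" by (simp only: e2 mult_1_right)
  then have L2: "Ln (of_real D' * (1 / \<xi> b)) = of_real (ln \<bar>D'\<bar>) - Ln u"
    using Ln_times_of_real[OF D'(2), of "inverse u"] Ln_of_real[OF D'(2)] unp by (simp add: Ln_inverse)
  have l1: "ln \<bar>D\<bar> = ln \<bar>J b powr th - z powr th\<bar> - th * ln c"
  proof -
    have "D = (J b powr th - z powr th) / c powr th"
      using Jb z c_pos by (simp add: D_def powr_divide diff_divide_distrib)
    then have "\<bar>D\<bar> = \<bar>J b powr th - z powr th\<bar> / c powr th" using c_pos by (simp add: abs_divide)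
    moreover have "\<bar>J b powr th - z powr th\<bar> > 0" using calculation D(2) c_pos by (auto simp: zero_less_divide_iff)
    ultimately show ?thesis using c_pos by (simp add: ln_div ln_powr)
  qed
  have l2: "ln \<bar>D'\<bar> = ln \<bar>J b - z\<bar> - ln c"
  proof -
    have "\<bar>D'\<bar> = \<bar>J b - z\<bar> / c" using c_pos by (simp add: D'_def abs_divide flip: diff_divide_distrib)
    then show ?thesis using c_pos b(3) by (simp add: ln_div)
  qed
  show ?thesis unfolding E1 E2 L1 L2 l1 l2 by (simp add: algebra_simps)
qed

text \<open>The function J outside the curve, written in the variable 1/s.\<close>
definition w_of :: "complex \<Rightarrow> complex" where
  "w_of s = of_real c * (1 + 1 / s) powr of_real (1 + 1 / th) * s"

lemma lam_xi_facts:
  assumes "lam > 1" "\<bar>b0\<bar> \<le> pi" "s0 = of_real lam * \<xi> b0"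
  shows "s0 \<noteq> 0" "\<And>b. \<bar>b\<bar> \<le> pi \<Longrightarrow> \<xi> b \<noteq> s0" "1 / s0 \<in> fc_dom (1 / th)" "1 / s0 = of_real (1 / lam) * xi (1 / th) (- b0)"
    "s0 \<noteq> -1"
proof -
  show s0: "s0 \<noteq> 0" using assms(1,3) A.xi_nonzero[OF assms(2)] by simp
  show ne: "\<xi> b \<noteq> s0" if "\<bar>b\<bar> \<le> pi" for b
  proof
    assume "\<xi> b = s0"
    then have "of_real 1 * \<xi> b = of_real lam * \<xi> b0" using assms by simp
    from A.mult_xi_eq[OF _ _ _ _ this] show False using assms that by simp
  qed
  show t: "1 / s0 = of_real (1 / lam) * xi (1 / th) (- b0)" using assms by (simp add: xi_S)
  show "1 / s0 \<in> fc_dom (1 / th)" unfolding t using assms by (intro S.mult_xi_in_fc_dom) auto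
  show "s0 \<noteq> -1" using ne[of pi] by simp
qed

text \<open>Since w'/w = (s - 1/th)/(s (s+1)), the value is - 2 pi i times the derivative of log ((w
  - z)/s) at \<open>s0\<close>. It stems from the function holomorphic outside alone; the one
  holomorphic inside contributes 0. The second claim holds because (w - z)/s is a multiple of a
  nonvanishing \<open>fc_fun\<close>.\<close>

lemma key_identity:
  assumes z: "0 < z" "z < J 0" and s0: "lam > 1" "\<bar>b0\<bar> \<le> pi" "s0 = of_real lam * \<xi> b0"
  shows "((\<lambda>b. of_real (ln \<bar>J b - z\<bar> + ln \<bar>J b powr th - z powr th\<bar>) * (1 / (\<xi> b - s0)\<^sup>2) * \<xi>' b)
     has_integral 2 * pi * \<i> * (1 / s0 - (w_of s0 / (w_of s0 - of_real z)) * ((s0 - sg) / (s0 * (s0 + 1))))) {-pi..pi}"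
    and "w_of s0 \<noteq> of_real z"
proof -
  define t where "t = 1 / s0"
  note f = lam_xi_facts[OF s0]
  have tnz: "t \<noteq> 0" using f(1) by (simp add: t_def)
  define P where "P = (1 + t) powr of_real (1 + 1 / th)"
  have a1: "0 < (z / c) powr th" "(z / c) powr th < fc_quot th 0"
  proof -
    show "0 < (z / c) powr th" using z c_pos by simp
    have "(z / c) powr th < (J 0 / c) powr th" using z c_pos th_pos by (intro powr_less_mono2) (auto simp: divide_strict_right_mono)
    then show "(z / c) powr th < fc_quot th 0" using fc_quot_J[of 0] by simp
  qed
  have a2: "0 < z / c" "z / c < fc_quot (1 / th) 0"
    using z c_pos fc_quot_S[of 0] by (auto simp: divide_strict_right_mono)
  have I1: "((\<lambda>b. Ln (fc_fun th ((z / c) powr th) (\<xi> b)) * (1 / (\<xi> b - s0)\<^sup>2) * \<xi>' b) has_integral 0) {-pi..pi}"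
    by (rule A.Ln_fc_fun_integral_outside[OF a1 s0(3,1,2)])
  define val where "val = (of_real (1 + 1 / th) * P / (1 + t) - of_real (z / c)) / fc_fun (1 / th) (z / c) t"
  have I2: "((\<lambda>b. Ln (fc_fun (1 / th) (z / c) (xi (1 / th) b)) * (1 / (xi (1 / th) b - t)\<^sup>2) * dxi (1 / th) b) has_integral
      (2 * pi * \<i> * val)) {-pi..pi}"
    unfolding val_def P_def
    by (rule S.Ln_fc_fun_integral_inside[OF a2, where ?r1.0="1 / lam" and ?b1.0="- b0"]) (use s0 f(4) in \<open>auto simp: t_def\<close>)
  have "((\<lambda>b. Ln (fc_fun (1 / th) (z / c) (xi (1 / th) (- b))) * (1 / (xi (1 / th) (- b) - t)\<^sup>2) * dxi (1 / th) (- b)) has_integral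
      (2 * pi * \<i> * val)) {-pi..- (- pi)}"
    using I2 by (subst has_integral_reflect_real[of "\<lambda>b. Ln (fc_fun (1 / th) (z / c) (xi (1 / th) b)) * (1 / (xi (1 / th) b - t)\<^sup>2) * dxi (1 / th) b"]) auto
  then have "((\<lambda>b. t\<^sup>2 * (Ln (fc_fun (1 / th) (z / c) (xi (1 / th) (- b))) * (1 / (xi (1 / th) (- b) - t)\<^sup>2) * dxi (1 / th) (- b))) has_integral
      t\<^sup>2 * (2 * pi * \<i> * val)) {-pi..pi}" by (intro has_integral_mult_right) simp
  then have I3: "((\<lambda>b. Ln (fc_fun (1 / th) (z / c) (xi (1 / th) (- b))) * (1 / (\<xi> b - s0)\<^sup>2) * \<xi>' b) has_integral
      t\<^sup>2 * (2 * pi * \<i> * val)) {-pi..pi}"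
  proof (rule has_integral_spike_finite[of "{0}", rotated 2])
    fix b assume b: "b \<in> {-pi..pi} - {0}"
    then have bb: "b \<noteq> 0" "\<bar>b\<bar> \<le> pi" by auto
    have nz: "\<xi> b \<noteq> 0" "\<xi> b - s0 \<noteq> 0" using A.xi_nonzero[OF bb(2)] f(2)[OF bb(2)] by auto
    \<comment> \<open>Inversion carries the kernel over into itself: t^2 times the squared kernel at
      1/\<xi>, times the derivative of 1/\<xi> up to sign, is the kernel at \<xi>.\<close>
    have "xi (1 / th) (- b) - t = (s0 - \<xi> b) / (\<xi> b * s0)" using nz f(1) by (simp add: xi_S t_def field_simps)
    then have "t\<^sup>2 * (1 / (xi (1 / th) (- b) - t)\<^sup>2 * dxi (1 / th) (- b)) = t\<^sup>2 * (1 / ((s0 - \<xi> b) / (\<xi> b * s0))\<^sup>2 * (\<xi>' b / (\<xi> b)\<^sup>2))"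
      by (simp only: dxi_S[OF bb])
    also have "\<dots> = 1 / (\<xi> b - s0)\<^sup>2 * \<xi>' b"
      using nz f(1) by (simp add: t_def power_divide power_mult_distrib power2_commute[of s0])
    finally have e: "t\<^sup>2 * (1 / (xi (1 / th) (- b) - t)\<^sup>2 * dxi (1 / th) (- b)) = 1 / (\<xi> b - s0)\<^sup>2 * \<xi>' b" .
    have aux: "a * (l * x * y) = l * (a * (x * y))" for a l x y :: complex by (simp add: mult_ac)
    show "Ln (fc_fun (1 / th) (z / c) (xi (1 / th) (- b))) * (1 / (\<xi> b - s0)\<^sup>2) * \<xi>' b =
       t\<^sup>2 * (Ln (fc_fun (1 / th) (z / c) (xi (1 / th) (- b))) * (1 / (xi (1 / th) (- b) - t)\<^sup>2) * dxi (1 / th) (- b))"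
      unfolding aux e by (simp only: mult.assoc)
  qed auto
  \<comment> \<open>The kernel annihilates constants; this disposes of (1 + th) ln c from
    \<open>Ln_sum\<close>.\<close>
  have I4: "((\<lambda>b. 1 / (\<xi> b - s0)\<^sup>2 * \<xi>' b) has_integral 0) {-pi..pi}"
  proof -
    have "((\<lambda>b. 1 / (of_real 1 * \<xi> b - s0)\<^sup>2 * (of_real 1 * \<xi>' b)) has_integral 0) {-pi..pi}"
    proof (rule A.curve_primitive[where f = "\<lambda>z. 1 / (z - s0)\<^sup>2" and g = "\<lambda>z. - 1 / (z - s0)"])
      fix b assume "\<bar>b\<bar> \<le> pi"
      from f(2)[OF this] show "((\<lambda>z. - 1 / (z - s0)) has_field_derivative 1 / (of_real 1 * \<xi> b - s0)\<^sup>2) (at (of_real 1 * \<xi> b))"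
        by (auto intro!: derivative_eq_intros simp: power2_eq_square)
    qed
    then show ?thesis by simp
  qed
  obtain bz where bz: "0 < bz" "bz < pi" "J bz = z" using J_surj[OF z] by blast
  have Jne: "J b \<noteq> z" if "\<bar>b\<bar> \<le> pi" "b \<noteq> bz" "b \<noteq> - bz" for b
  proof -
    have "\<bar>b\<bar> \<noteq> bz" using that by (auto simp: abs_if split: if_splits)
    then have "J \<bar>b\<bar> \<noteq> z" using J_strict[of "\<bar>b\<bar>" bz] J_strict[of bz "\<bar>b\<bar>"] that bz by (cases "\<bar>b\<bar> < bz") auto
    then show ?thesis by (auto simp: abs_if split: if_splits)
  qed
  have "((\<lambda>b. (Ln (fc_fun th ((z / c) powr th) (\<xi> b)) * (1 / (\<xi> b - s0)\<^sup>2) * \<xi>' b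
      + Ln (fc_fun (1 / th) (z / c) (xi (1 / th) (- b))) * (1 / (\<xi> b - s0)\<^sup>2) * \<xi>' b)
      + of_real ((1 + th) * ln c) * (1 / (\<xi> b - s0)\<^sup>2 * \<xi>' b))
     has_integral (0 + t\<^sup>2 * (2 * pi * \<i> * val)) + of_real ((1 + th) * ln c) * 0) {-pi..pi}"
    by (intro has_integral_add has_integral_mult_right I1 I3 I4)
  then have I5: "((\<lambda>b. of_real (ln \<bar>J b - z\<bar> + ln \<bar>J b powr th - z powr th\<bar>) * (1 / (\<xi> b - s0)\<^sup>2) * \<xi>' b)
     has_integral (0 + t\<^sup>2 * (2 * pi * \<i> * val)) + of_real ((1 + th) * ln c) * 0) {-pi..pi}"
  proof (rule has_integral_spike_finite[of "{0, pi, - pi, bz, - bz}", rotated 2])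
    fix b assume b: "b \<in> {-pi..pi} - {0, pi, - pi, bz, - bz}"
    have *: "Ln (fc_fun th ((z / c) powr th) (\<xi> b)) + Ln (fc_fun (1 / th) (z / c) (xi (1 / th) (- b))) + of_real ((1 + th) * ln c)
      = of_real (ln \<bar>J b - z\<bar> + ln \<bar>J b powr th - z powr th\<bar>)"
    proof -
      have "b \<noteq> 0" "\<bar>b\<bar> < pi" using b by auto
      moreover have "J b \<noteq> z" using b calculation by (intro Jne) auto
      ultimately have "b \<noteq> 0" "\<bar>b\<bar> < pi" "J b \<noteq> z" by auto
      from Ln_sum[OF z this] show ?thesis by simp
    qed
    show "of_real (ln \<bar>J b - z\<bar> + ln \<bar>J b powr th - z powr th\<bar>) * (1 / (\<xi> b - s0)\<^sup>2) * \<xi>' b =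
      (Ln (fc_fun th ((z / c) powr th) (\<xi> b)) * (1 / (\<xi> b - s0)\<^sup>2) * \<xi>' b
      + Ln (fc_fun (1 / th) (z / c) (xi (1 / th) (- b))) * (1 / (\<xi> b - s0)\<^sup>2) * \<xi>' b)
      + of_real ((1 + th) * ln c) * (1 / (\<xi> b - s0)\<^sup>2 * \<xi>' b)"
      unfolding *[symmetric] by (simp only: distrib_right mult.assoc)
  qed auto
  have Enz: "fc_fun (1 / th) (z / c) t \<noteq> 0"
    using S.fc_fun_nonpos[OF f(3), of "z / c"] a2 by (auto simp: t_def)
  have w: "w_of s0 = of_real c * P / t" by (simp add: w_of_def P_def t_def)
  have EEt: "fc_fun (1 / th) (z / c) t = t * (w_of s0 - of_real z) / of_real c"
    using tnz c_pos by (simp add: fc_fun_def w P_def field_simps)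
  show wz: "w_of s0 \<noteq> of_real z" using Enz EEt by auto
  have t1: "1 + t \<noteq> 0" using S.one_plus_fc_dom_nonpos[OF f(3)] by (auto simp: t_def)
  have tv: "t\<^sup>2 * val = 1 / s0 - (w_of s0 / (w_of s0 - of_real z)) * ((s0 - sg) / (s0 * (s0 + 1)))"
  proof -
    define w where "w = w_of s0"
    define D where "D = w - of_real z"
    have Dnz: "D \<noteq> 0" using wz by (simp add: D_def w_def)
    have Pw: "P = w * t / of_real c" using w tnz c_pos by (simp add: w_def)
    have "val = ((1 + sg) * (w * t / of_real c) / (1 + t) - of_real z / of_real c) / (t * D / of_real c)"
      unfolding val_def EEt Pw by (simp add: D_def w_def)
    also have "(1 + sg) * (w * t / of_real c) / (1 + t) - of_real z / of_real c = ((1 + sg) * w * t / (1 + t) - of_real z) / complex_of_real c"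
      by (simp only: diff_divide_distrib) (simp add: mult.assoc)
    also have "((1 + sg) * w * t / (1 + t) - of_real z) / complex_of_real c / (t * D / of_real c)
      = ((1 + sg) * w * t / (1 + t) - of_real z) / (t * D)"
      using c_pos by simp
    finally have "t\<^sup>2 * val = t * (((1 + sg) * w * t / (1 + t) - of_real z) / D)"
      using tnz by (simp add: power2_eq_square)
    moreover have "(1 + sg) * w * t / (1 + t) - of_real z = D - w * (1 - sg * t) / (1 + t)"
    proof -
      have "w = w * (1 + t) / (1 + t)" using t1 by simp
      then have "D - w * (1 - sg * t) / (1 + t) = w * (1 + t) / (1 + t) - w * (1 - sg * t) / (1 + t) - of_real z"
        by (simp add: D_def)
      also have "\<dots> = (w * (1 + t) - w * (1 - sg * t)) / (1 + t) - of_real z" by (simp only: diff_divide_distrib)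
      also have "w * (1 + t) - w * (1 - sg * t) = (1 + sg) * w * t" by (simp only: ring_distribs) simp
      finally show ?thesis by simp
    qed
    ultimately have "t\<^sup>2 * val = t * ((D - w * (1 - sg * t) / (1 + t)) / D)" by (simp only:)
    also have "(D - w * (1 - sg * t) / (1 + t)) / D = 1 - w * (1 - sg * t) / (1 + t) / D"
      using Dnz by (subst diff_divide_distrib) simp
    also have "w * (1 - sg * t) / (1 + t) / D = w / D * ((1 - sg * t) / (1 + t))" by simp
    also have "(1 - sg * t) / (1 + t) = (s0 - sg) / (s0 + 1)"
    proof -
      have "1 - sg * t = (s0 - sg) / s0" "1 + t = (s0 + 1) / s0" using f(1) by (simp_all add: t_def field_simps)
      then show ?thesis using f(1) by simp
    qed
    finally have "t\<^sup>2 * val = t * (1 - w / D * ((s0 - sg) / (s0 + 1)))" .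
    also have "\<dots> = t - w / D * (t * ((s0 - sg) / (s0 + 1)))"
      by (simp only: right_diff_distrib mult_1_right mult.left_commute)
    also have "t * ((s0 - sg) / (s0 + 1)) = (s0 - sg) / (s0 * (s0 + 1))" by (simp add: t_def)
    finally show ?thesis by (simp only: t_def D_def w_def)
  qed
  have "(0 + t\<^sup>2 * (2 * pi * \<i> * val)) + of_real ((1 + th) * ln c) * 0
    = 2 * pi * \<i> * (t\<^sup>2 * val)" by simp
  also note tv
  finally have "(0 + t\<^sup>2 * (2 * pi * \<i> * val)) + of_real ((1 + th) * ln c) * 0
    = 2 * pi * \<i> * (1 / s0 - (w_of s0 / (w_of s0 - of_real z)) * ((s0 - sg) / (s0 * (s0 + 1))))" .
  with I5 show "((\<lambda>b. of_real (ln \<bar>J b - z\<bar> + ln \<bar>J b powr th - z powr th\<bar>) * (1 / (\<xi> b - s0)\<^sup>2) * \<xi>' b)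
     has_integral 2 * pi * \<i> * (1 / s0 - (w_of s0 / (w_of s0 - of_real z)) * ((s0 - sg) / (s0 * (s0 + 1))))) {-pi..pi}"
    by (simp only:)
qed

end


section \<open>Integration against the equilibrium measure\<close>

lemma integrable_bounded_except:
  fixes f :: "real \<Rightarrow> 'a::euclidean_space"
  assumes "finite N" "continuous_on ({u..v} - N) f" "\<And>x. x \<in> {u..v} - N \<Longrightarrow> norm (f x) \<le> B"
  shows "f integrable_on {u..v}"
proof -
  have S: "{u..v} - N \<in> sets lebesgue"
    using assms(1) by (intro sets.Diff) (auto intro: negligible_imp_sets negligible_finite)
  have "(\<lambda>x. B) integrable_on {u..v} - N"
    by (rule integrable_spike_set[OF integrable_const_ivl[of B u v]])
       (rule negligible_subset[OF negligible_finite[OF assms(1)]]; auto)+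
  then have "f integrable_on {u..v} - N"
    by (rule measurable_bounded_by_integrable_imp_integrable
       [OF continuous_imp_measurable_on_sets_lebesgue[OF assms(2) S] _ _ S, where g="\<lambda>x. B"]) (use assms(3) in auto)
  then show ?thesis
    by (rule integrable_spike_set) (rule negligible_subset[OF negligible_finite[OF assms(1)]]; auto)+
qed

text \<open>Differentiating the logarithm of the modulus avoids choosing a branch of log u along the
  curve.\<close>

lemma ln_norm_derivative:
  fixes u :: "real \<Rightarrow> complex"
  assumes "(u has_vector_derivative u') (at x)" "u x \<noteq> 0"
  shows "((\<lambda>x. ln (cmod (u x))) has_real_derivative Re (u' / u x)) (at x)"
proof -
  have "((\<lambda>x. cmod (u x)) has_derivative (\<lambda>h. inner (h *\<^sub>R u') (sgn (u x)))) (at x)"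
    by (rule has_derivative_compose[OF assms(1)[unfolded has_vector_derivative_def] has_derivative_norm[OF assms(2)]])
  then have "((\<lambda>x. cmod (u x)) has_real_derivative (inner u' (sgn (u x)))) (at x)"
    by (rule has_derivative_imp_has_field_derivative) simp
  then have "((\<lambda>x. ln (cmod (u x))) has_real_derivative (1 / cmod (u x) * inner u' (sgn (u x)))) (at x)"
    by (rule DERIV_chain2[OF DERIV_ln_divide, rotated]) (use assms in auto)
  moreover have "1 / cmod (u x) * inner u' (sgn (u x)) = Re (u' / u x)"
  proof -
    have "Re (u' / u x) = (Re u' * Re (u x) + Im u' * Im (u x)) / (cmod (u x))\<^sup>2"
      by (simp add: Re_divide cmod_power2)
    then show ?thesis
      using assms(2) by (simp add: sgn_div_norm inner_complex_def power2_eq_square field_simps)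
  qed
  ultimately show ?thesis by simp
qed

text \<open>The right endpoint appears as \<open>J 0\<close>, to which b is equal by the choice of
  c. The variational inequality is supplied separately to the lemmas on the edge
  coefficient.\<close>

locale equil = fuss th c for th c +
  fixes V V' V'' \<psi> :: "real \<Rightarrow> real" and mu :: "real measure" and l :: real
  assumes V1: "\<And>x. x \<ge> 0 \<Longrightarrow> (V has_real_derivative V' x) (at x within {0..})"
    and V2: "\<And>x. x \<ge> 0 \<Longrightarrow> (V' has_real_derivative V'' x) (at x within {0..})"
    and V3: "continuous_on {0..} V''"
    and prob: "prob_space mu"
    and psi_cont: "continuous_on {0<..<J 0} \<psi>"
    and psi_nonneg: "\<And>x. x \<in> {0<..<J 0} \<Longrightarrow> \<psi> x \<ge> 0"
    and mu_eq: "mu = density lborel (\<lambda>x. ennreal (indicator {0<..<J 0} x * \<psi> x))"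
    and EL: "\<And>x. x \<in> {0..J 0} \<Longrightarrow> integrable mu (\<lambda>y. ln \<bar>x - y\<bar>)"
            "\<And>x. x \<in> {0..J 0} \<Longrightarrow> integrable mu (\<lambda>y. ln \<bar>x powr th - y powr th\<bar>)"
            "\<And>x. x \<in> {0..J 0} \<Longrightarrow> (\<integral>y. ln \<bar>x - y\<bar> \<partial>mu) + (\<integral>y. ln \<bar>x powr th - y powr th\<bar> \<partial>mu) = V x + l"
begin

lemma sets_mu [measurable_cong, simp]: "sets mu = sets borel"
  by (simp add: mu_eq)

lemma space_mu [simp]: "space mu = UNIV"
  by (simp add: mu_eq)

lemma dens_measurable [measurable]: "(\<lambda>x. indicator {0<..<J 0} x * \<psi> x) \<in> borel_measurable borel"
  using borel_measurable_continuous_on_indicator[OF _ psi_cont] by simp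

lemma AE_mu: "AE z in mu. 0 < z \<and> z < J 0"
proof -
  have "(\<lambda>x. ennreal (indicator {0<..<J 0} x * \<psi> x)) \<in> borel_measurable lborel" by measurable
  from AE_density[OF this] show ?thesis unfolding mu_eq by (auto simp: indicator_def)
qed

lemma continuous_on_V: "continuous_on {0..} V"
  using V1 by (intro continuous_on_eq_continuous_within[THEN iffD2] ballI DERIV_continuous) auto

lemma continuous_on_V': "continuous_on {0..} V'"
  using V2 by (intro continuous_on_eq_continuous_within[THEN iffD2] ballI DERIV_continuous) auto

lemma V_deriv: "x > 0 \<Longrightarrow> (V has_real_derivative V' x) (at x)"
  using V1[of x] at_within_interior[of x "{0..}"] by (simp add: interior_real_atLeast)

lemma V'_deriv: "x > 0 \<Longrightarrow> (V' has_real_derivative V'' x) (at x)"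
  using V2[of x] at_within_interior[of x "{0..}"] by (simp add: interior_real_atLeast)

lemma continuous_on_comp_J: "continuous_on {0..} f \<Longrightarrow> continuous_on {-pi..pi} (\<lambda>b. f (J b))"
  for f :: "real \<Rightarrow> real"
  using J_nonneg by (intro continuous_on_compose2[OF _ continuous_on_J]) auto

text \<open>Both logarithms are bounded above on the support and their integrals have a bounded sum, so the two potentials
  are bounded individually.\<close>
lemma potential_bound:
  obtains C where "C \<ge> 0" "\<And>y. y \<in> {0..J 0} \<Longrightarrow> (\<integral>z. \<bar>ln \<bar>y - z\<bar>\<bar> + \<bar>ln \<bar>y powr th - z powr th\<bar>\<bar> \<partial>mu) \<le> C"
proof -
  interpret prob_space mu by (rule prob)
  have "bounded (V ` {0..J 0})"
    by (intro compact_imp_bounded compact_continuous_image continuous_on_subset[OF continuous_on_V]) auto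
  then obtain B where "\<forall>x\<in>V ` {0..J 0}. norm x \<le> B"
    unfolding bounded_iff by blast
  then have B: "\<And>y. y \<in> {0..J 0} \<Longrightarrow> \<bar>V y\<bar> \<le> B" by auto
  \<comment> \<open>\<open>M\<close> bounds both |y - z| and |y^th - z^th| on the support. From ln u
    <= M follows |ln u| <= 2 M - ln u, which trades the absolute value for the potential itself; at
    u = 0 this rests on \<open>ln 0 = 0\<close>.\<close>
  define M where "M = J 0 + J 0 powr th"
  have J0: "J 0 > 0" using J_pos[of 0] by simp
  then have M: "M \<ge> 0" by (simp add: M_def)
  have lnb: "\<bar>ln \<bar>u\<bar>\<bar> \<le> 2 * M - ln \<bar>u\<bar>" if "\<bar>u\<bar> \<le> M" for u
  proof (cases "u = 0")
    case False
    then have "ln \<bar>u\<bar> \<le> \<bar>u\<bar>" using ln_le_minus_one[of "\<bar>u\<bar>"] by simp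
    then show ?thesis using that M by linarith
  qed (use M in simp)
  show thesis
  proof (rule that[of "4 * M + B + \<bar>l\<bar>"])
    have "B \<ge> 0" using B[of 0] J0 by auto
    then show "4 * M + B + \<bar>l\<bar> \<ge> 0" using M by simp
    fix y assume y: "y \<in> {0..J 0}"
    have "(\<integral>z. \<bar>ln \<bar>y - z\<bar>\<bar> + \<bar>ln \<bar>y powr th - z powr th\<bar>\<bar> \<partial>mu)
      \<le> (\<integral>z. (2 * M - ln \<bar>y - z\<bar>) + (2 * M - ln \<bar>y powr th - z powr th\<bar>) \<partial>mu)"
    proof (rule integral_mono_AE)
      show "integrable mu (\<lambda>z. \<bar>ln \<bar>y - z\<bar>\<bar> + \<bar>ln \<bar>y powr th - z powr th\<bar>\<bar>)"
        using EL(1,2)[OF y] by (intro Bochner_Integration.integrable_add integrable_abs)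
      show "integrable mu (\<lambda>z. (2 * M - ln \<bar>y - z\<bar>) + (2 * M - ln \<bar>y powr th - z powr th\<bar>))"
        using EL(1,2)[OF y] by (intro Bochner_Integration.integrable_add Bochner_Integration.integrable_diff) auto
      show "AE z in mu. \<bar>ln \<bar>y - z\<bar>\<bar> + \<bar>ln \<bar>y powr th - z powr th\<bar>\<bar>
         \<le> (2 * M - ln \<bar>y - z\<bar>) + (2 * M - ln \<bar>y powr th - z powr th\<bar>)"
        using AE_mu
      proof eventually_elim
        fix z assume z: "0 < z \<and> z < J 0"
        have "\<bar>y - z\<bar> \<le> J 0" using y z by auto
        then have 1: "\<bar>y - z\<bar> \<le> M" by (simp add: M_def add_increasing2)
        have "y powr th \<le> J 0 powr th" "z powr th \<le> J 0 powr th" "0 \<le> y powr th" "0 \<le> z powr th"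
          using y z th_pos by (auto intro!: powr_mono2)
        then have "\<bar>y powr th - z powr th\<bar> \<le> J 0 powr th" by linarith
        then have 2: "\<bar>y powr th - z powr th\<bar> \<le> M" using J0 by (simp add: M_def)
        show "\<bar>ln \<bar>y - z\<bar>\<bar> + \<bar>ln \<bar>y powr th - z powr th\<bar>\<bar>
         \<le> (2 * M - ln \<bar>y - z\<bar>) + (2 * M - ln \<bar>y powr th - z powr th\<bar>)"
          using lnb[OF 1] lnb[OF 2] by linarith
      qed
    qed
    also have "\<dots> = 4 * M - (V y + l)"
      using EL[OF y] prob_space by simp
    also have "\<dots> \<le> 4 * M + B + \<bar>l\<bar>" using B[OF y] by linarith
    finally show "(\<integral>z. \<bar>ln \<bar>y - z\<bar>\<bar> + \<bar>ln \<bar>y powr th - z powr th\<bar>\<bar> \<partial>mu) \<le> 4 * M + B + \<bar>l\<bar>" .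
  qed
qed

text \<open>Absolute integrability on the product holds because \<open>s0\<close> is off the curve,
  which bounds the kernel, and because \<open>potential_bound\<close> bounds the inner integrals
  uniformly. The equality condition then replaces the inner integral by V + l.\<close>

lemma fubini:
  assumes s0: "lam > 1" "\<bar>b0\<bar> \<le> pi" "s0 = of_real lam * \<xi> b0"
  defines "N \<equiv> (\<integral>z. w_of s0 / (w_of s0 - of_real z) \<partial>mu)"
  assumes wint: "integrable mu (\<lambda>z. w_of s0 / (w_of s0 - of_real z))"
  shows "((\<lambda>b. of_real (V (J b) + l) * (1 / (\<xi> b - s0)\<^sup>2) * \<xi>' b) has_integral
    2 * pi * \<i> * (1 / s0 - N * ((s0 - sg) / (s0 * (s0 + 1))))) {-pi..pi}"
proof -
  interpret prob_space mu by (rule prob)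
  interpret P: pair_sigma_finite lborel mu by unfold_locales
  note f = lam_xi_facts[OF s0]
  define S where "S = {-pi..pi} - {0}"
  have S [measurable]: "S \<in> sets borel" by (simp add: S_def)
  define K where "K = (\<lambda>b. (1 / (\<xi> b - s0)\<^sup>2) * \<xi>' b)"
  define Kt where "Kt = (\<lambda>b. indicator S b *\<^sub>R K b)"
  \<comment> \<open>Off \<open>S\<close> the value is 0, which still belongs to the support. The
    equilibrium equality thus applies to every b, while \<open>Kt\<close> removes the
    contribution.\<close>
  define jt where "jt = (\<lambda>b. indicator S b *\<^sub>R J b)"
  have contK: "continuous_on S K"
    unfolding K_def S_def
    by (intro continuous_intros continuous_on_subset[OF A.continuous_on_xi] A.continuous_on_dxi) (use f(2) in \<open>auto simp: abs_le_iff\<close>)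
  have Km [measurable]: "Kt \<in> borel_measurable borel"
    unfolding Kt_def by (rule borel_measurable_continuous_on_indicator[OF S contK])
  have jm [measurable]: "jt \<in> borel_measurable borel"
    unfolding jt_def by (rule borel_measurable_continuous_on_indicator[OF S])
      (use continuous_on_J in \<open>auto simp: S_def intro: continuous_on_subset\<close>)
  define h where "h = (\<lambda>b z. ln \<bar>jt b - z\<bar> + ln \<bar>jt b powr th - z powr th\<bar>)"
  define g where "g = (\<lambda>p. of_real (h (fst p) (snd p)) * Kt (fst p))"
  have jr: "jt b \<in> {0..J 0}" for b
    using J_range[of b] J_pos[of 0] by (auto simp: jt_def indicator_def S_def abs_le_iff)
  have gm: "g \<in> borel_measurable (lborel \<Otimes>\<^sub>M mu)"
    unfolding g_def h_def by measurable
  have hint: "integrable mu (h b)" for b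
    unfolding h_def using EL(1,2)[OF jr] by (intro Bochner_Integration.integrable_add)
  have hval: "(\<integral>z. h b z \<partial>mu) = V (jt b) + l" for b
    unfolding h_def using EL[OF jr[of b]] by simp
  obtain C where C: "C \<ge> 0" "\<And>y. y \<in> {0..J 0} \<Longrightarrow> (\<integral>z. \<bar>ln \<bar>y - z\<bar>\<bar> + \<bar>ln \<bar>y powr th - z powr th\<bar>\<bar> \<partial>mu) \<le> C"
    using potential_bound by blast
  have habs: "(\<integral>z. \<bar>h b z\<bar> \<partial>mu) \<le> C" for b
  proof -
    have "(\<integral>z. \<bar>h b z\<bar> \<partial>mu) \<le> (\<integral>z. \<bar>ln \<bar>jt b - z\<bar>\<bar> + \<bar>ln \<bar>jt b powr th - z powr th\<bar>\<bar> \<partial>mu)"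
      using hint[of b] EL(1,2)[OF jr[of b]]
      by (intro integral_mono integrable_abs Bochner_Integration.integrable_add) (auto simp: h_def)
    also have "\<dots> \<le> C" by (rule C(2)[OF jr])
    finally show ?thesis .
  qed
  obtain dd where dd: "dd > 0" "\<And>b. \<bar>b\<bar> \<le> pi \<Longrightarrow> dd \<le> cmod (\<xi> b - s0)"
  proof -
    obtain d where "d > 0" "\<And>r b. 1 \<le> r \<Longrightarrow> r \<le> 1 \<Longrightarrow> \<bar>b\<bar> \<le> pi \<Longrightarrow> d \<le> cmod (of_real r * \<xi> b - s0)"
    proof (rule A.curve_dist_pos[of 1 s0])
      fix r b :: real assume "1 \<le> r" "r \<le> 1" "\<bar>b\<bar> \<le> pi"
      then show "of_real r * \<xi> b \<noteq> s0" using f(2)[of b] by simp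
    qed auto
    then show thesis using that[of d] by force
  qed
  obtain M where M: "M > 0" "\<And>b. 0 < \<bar>b\<bar> \<Longrightarrow> \<bar>b\<bar> \<le> pi \<Longrightarrow> cmod (\<xi>' b) \<le> M" using A.dxi_bounded by blast
  have Kb: "cmod (Kt b) \<le> indicator {-pi..pi} b * (1 / dd\<^sup>2 * M)" for b
  proof (cases "b \<in> S")
    case True
    then have b: "0 < \<bar>b\<bar>" "\<bar>b\<bar> \<le> pi" by (auto simp: S_def)
    have "dd\<^sup>2 \<le> (cmod (\<xi> b - s0))\<^sup>2" using dd(1) dd(2)[OF b(2)] by (intro power_mono) auto
    then have "cmod (1 / (\<xi> b - s0)\<^sup>2) \<le> 1 / dd\<^sup>2" using dd(1) by (simp add: norm_divide norm_power frac_le)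
    then have "cmod (K b) \<le> 1 / dd\<^sup>2 * M" unfolding K_def norm_mult using M(2)[OF b] by (intro mult_mono) auto
    then show ?thesis using True by (simp add: Kt_def S_def)
  next
    case False
    then show ?thesis using dd M by (simp add: Kt_def)
  qed
  have nrm: "(\<integral>z. norm (g (b, z)) \<partial>mu) = (\<integral>z. \<bar>h b z\<bar> \<partial>mu) * cmod (Kt b)" for b
    by (simp add: g_def norm_mult)
  have gi: "integrable (lborel \<Otimes>\<^sub>M mu) g"
  proof (rule P.Fubini_integrable[OF gm])
    show "integrable lborel (\<lambda>b. \<integral>z. norm (g (b, z)) \<partial>mu)"
    proof (rule Bochner_Integration.integrable_bound)
      show "integrable lborel (\<lambda>b. indicator {-pi..pi} b * (C * (1 / dd\<^sup>2 * M)))"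
        by (intro integrable_mult_left) (auto simp: integrable_indicator_iff)
      show "(\<lambda>b. \<integral>z. norm (g (b, z)) \<partial>mu) \<in> borel_measurable lborel"
        using gm by measurable
      show "AE b in lborel. norm (\<integral>z. norm (g (b, z)) \<partial>mu) \<le> norm (indicator {-pi..pi} b * (C * (1 / dd\<^sup>2 * M)))"
      proof (intro AE_I2)
        fix b :: real
        have "0 \<le> (\<integral>z. norm (g (b, z)) \<partial>mu)" by simp
        moreover have "(\<integral>z. norm (g (b, z)) \<partial>mu) \<le> C * (indicator {-pi..pi} b * (1 / dd\<^sup>2 * M))"
          unfolding nrm using habs[of b] Kb[of b] C(1) by (intro mult_mono) auto
        ultimately show "norm (\<integral>z. norm (g (b, z)) \<partial>mu) \<le> norm (indicator {-pi..pi} b * (C * (1 / dd\<^sup>2 * M)))"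
          using C(1) M dd by (simp add: mult_ac)
      qed
    qed
    show "AE b in lborel. integrable mu (\<lambda>z. g (b, z))"
      using hint by (intro AE_I2) (auto simp: g_def intro!: integrable_mult_left integrable_of_real)
  qed
  have inner1: "(\<integral>z. g (b, z) \<partial>mu) = indicator S b *\<^sub>R (of_real (V (J b) + l) * K b)" for b
  proof -
    have "(\<integral>z. g (b, z) \<partial>mu) = (\<integral>z. of_real (h b z) \<partial>mu) * Kt b" by (simp add: g_def)
    also have "(\<integral>z. of_real (h b z) \<partial>mu) = complex_of_real (V (jt b) + l)" using hval[of b] by simp
    finally show ?thesis by (simp add: Kt_def jt_def indicator_def)
  qed
  have "integrable lborel (\<lambda>b. \<integral>z. g (b, z) \<partial>mu)" using P.integrable_fst'[OF gi] .
  then have i1: "integrable lborel (\<lambda>b. indicator S b *\<^sub>R (of_real (V (J b) + l) * K b))" by (simp only: inner1)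
  define val where "val = (\<lambda>z. 2 * pi * \<i> * (1 / s0 - (w_of s0 / (w_of s0 - of_real z)) * ((s0 - sg) / (s0 * (s0 + 1)))))"
  have "AE z in mu. integrable lborel (\<lambda>b. g (b, z))"
    using P.AE_integrable_snd[of "\<lambda>x y. g (x, y)"] gi by simp
  then have ae: "AE z in mu. (\<integral>b. g (b, z) \<partial>lborel) = val z"
    using AE_mu
  proof eventually_elim
    fix z assume i: "integrable lborel (\<lambda>b. g (b, z))" and z: "0 < z \<and> z < J 0"
    have geq: "g (b, z) = (if b \<in> S then of_real (ln \<bar>J b - z\<bar> + ln \<bar>J b powr th - z powr th\<bar>) * (1 / (\<xi> b - s0)\<^sup>2) * \<xi>' b else 0)" for b
      by (simp add: g_def h_def Kt_def jt_def K_def indicator_def mult.assoc)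
    have "((\<lambda>b. g (b, z)) has_integral (\<integral>b. g (b, z) \<partial>lborel)) UNIV" by (rule has_integral_integral_lborel[OF i])
    then have "((\<lambda>b. of_real (ln \<bar>J b - z\<bar> + ln \<bar>J b powr th - z powr th\<bar>) * (1 / (\<xi> b - s0)\<^sup>2) * \<xi>' b) has_integral (\<integral>b. g (b, z) \<partial>lborel)) S"
      unfolding geq by (subst (asm) has_integral_restrict_UNIV)
    moreover have "((\<lambda>b. of_real (ln \<bar>J b - z\<bar> + ln \<bar>J b powr th - z powr th\<bar>) * (1 / (\<xi> b - s0)\<^sup>2) * \<xi>' b) has_integral val z) S"
      using key_identity(1)[of z, OF _ _ s0] z
      unfolding S_def val_def by (subst has_integral_spike_set_eq[of _ "{-pi..pi}"]) (auto intro: negligible_subset[of "{0}"])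
    ultimately show "(\<integral>b. g (b, z) \<partial>lborel) = val z" using has_integral_unique by blast
  qed
  have "(\<integral>b. (\<integral>z. g (b, z) \<partial>mu) \<partial>lborel) = (\<integral>z. (\<integral>b. g (b, z) \<partial>lborel) \<partial>mu)"
    using P.Fubini_integral[of "\<lambda>x y. g (x, y)"] gi by simp
  also have "\<dots> = (\<integral>z. val z \<partial>mu)"
    by (rule integral_cong_AE) (use ae gm in \<open>auto simp: val_def\<close>)
  also have "\<dots> = 2 * pi * \<i> * (1 / s0 - N * ((s0 - sg) / (s0 * (s0 + 1))))"
  proof -
    define F where "F = (\<lambda>z. w_of s0 / (w_of s0 - complex_of_real z))"
    define q where "q = (s0 - sg) / (s0 * (s0 + 1))"
    have "integrable mu F" using wint by (simp add: F_def)
    then have "(\<integral>z. 2 * pi * \<i> * (1 / s0 - F z * q) \<partial>mu) = 2 * pi * \<i> * (1 / s0 - (\<integral>z. F z \<partial>mu) * q)"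
      using prob_space by simp
    then show ?thesis by (simp only: val_def N_def F_def q_def)
  qed
  finally have tot: "(\<integral>b. indicator S b *\<^sub>R (of_real (V (J b) + l) * K b) \<partial>lborel) = 2 * pi * \<i> * (1 / s0 - N * ((s0 - sg) / (s0 * (s0 + 1))))"
    by (simp only: inner1)
  have "((\<lambda>b. indicator S b *\<^sub>R (of_real (V (J b) + l) * K b)) has_integral 2 * pi * \<i> * (1 / s0 - N * ((s0 - sg) / (s0 * (s0 + 1))))) UNIV"
    using has_integral_integral_lborel[OF i1] unfolding tot .
  moreover have "indicator S b *\<^sub>R (of_real (V (J b) + l) * K b) = (if b \<in> S then of_real (V (J b) + l) * K b else 0)" for b
    by (simp add: indicator_def)
  ultimately have "((\<lambda>b. of_real (V (J b) + l) * K b) has_integral 2 * pi * \<i> * (1 / s0 - N * ((s0 - sg) / (s0 * (s0 + 1))))) S"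
    by (simp only: has_integral_restrict_UNIV)
  then have "((\<lambda>b. of_real (V (J b) + l) * K b) has_integral 2 * pi * \<i> * (1 / s0 - N * ((s0 - sg) / (s0 * (s0 + 1))))) {-pi..pi}"
    unfolding S_def by (subst (asm) has_integral_spike_set_eq[of _ "{-pi..pi}"]) (auto intro: negligible_subset[of "{0}"])
  then show ?thesis by (simp only: K_def mult.assoc)
qed

end

section \<open>Integration by parts: the identity for the Stieltjes-type integral off the
  curve\<close>

context equil begin

definition DV :: "real \<Rightarrow> real" where "DV y = y * V' y"
definition dDV :: "real \<Rightarrow> real" where "dDV y = V'' y * y + V' y"

lemma continuous_on_DV: "continuous_on {0..} DV"
  unfolding DV_def by (intro continuous_intros continuous_on_V')

lemma continuous_on_dDV: "continuous_on {0..} dDV"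
  unfolding dDV_def by (intro continuous_intros continuous_on_V' V3)

lemma DV_deriv: "x > 0 \<Longrightarrow> (DV has_real_derivative dDV x) (at x)"
  unfolding DV_def dDV_def using V'_deriv[of x] by (auto intro!: derivative_eq_intros)

text \<open>The contour integral in the theorem equals i times this number, so the condition to be
  proved is \<open>DV_total\<close> = 2 pi (1 + th).\<close>

definition DV_total :: real where "DV_total = integral {-pi..pi} (\<lambda>b. DV (J b))"
definition edge_coeff :: real where "edge_coeff = (1 + 1 / th) - DV_total / (2 * pi * th)"

lemma has_integral_DV_total: "((\<lambda>b. DV (J b)) has_integral DV_total) {-pi..pi}"
  unfolding DV_total_def by (intro integrable_integral integrable_continuous_interval continuous_on_comp_J continuous_on_DV)

lemma comp_J_deriv:
  assumes "\<And>x. x > 0 \<Longrightarrow> (f has_real_derivative f' x) (at x)" "b \<noteq> 0" "\<bar>b\<bar> < pi"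
  shows "((\<lambda>b. f (J b)) has_real_derivative f' (J b) * J' b) (at b)"
  using DERIV_chain2[OF assms(1)[OF J_pos] J_has_derivative] assms by simp

text \<open>In \<open>dJ_eq\<close> the divisor \<xi> + 1 vanishes at the angles pi and - pi. It
  cancels against J, which contains |1 + \<xi>|^(1 + 1/th), and leaves the continuous function
  \<open>g\<close> times the bounded velocity.\<close>

lemma dJ_bounded: "\<exists>M>0. \<forall>b. 0 < \<bar>b\<bar> \<longrightarrow> \<bar>b\<bar> < pi \<longrightarrow> \<bar>J' b\<bar> \<le> M"
proof -
  obtain M where M: "M > 0" "\<And>b. 0 < \<bar>b\<bar> \<Longrightarrow> \<bar>b\<bar> \<le> pi \<Longrightarrow> cmod (\<xi>' b) \<le> M" using A.dxi_bounded by blast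
  define g where "g = (\<lambda>b. c * cmod (1 + \<xi> b) powr (1 / th) * cmod (\<xi> b - sg) / (rho th b powr (1 / th) * rho th b))"
  have rp: "rho th b > 0" if "b \<in> {-pi..pi}" for b using A.rho_pos[of b] that by (auto simp: abs_le_iff)
  have "continuous_on {-pi..pi} g"
    unfolding g_def
    by (intro continuous_on_divide continuous_on_mult continuous_on_powr' continuous_on_norm continuous_on_add
      continuous_on_diff continuous_on_const A.continuous_on_xi A.continuous_on_rho ballI)
      (use rp th_pos in \<open>fastforce+\<close>)
  then have "bounded (g ` {-pi..pi})" by (intro compact_imp_bounded compact_continuous_image) auto
  then obtain G where "G > 0" "\<forall>x\<in>g ` {-pi..pi}. norm x \<le> G" unfolding bounded_pos by blast
  then have G: "G > 0" "\<And>b. b \<in> {-pi..pi} \<Longrightarrow> \<bar>g b\<bar> \<le> G" by auto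
  have "\<bar>J' b\<bar> \<le> M * G" if b: "0 < \<bar>b\<bar>" "\<bar>b\<bar> < pi" for b
  proof -
    have bb: "b \<noteq> 0" "\<bar>b\<bar> \<le> pi" "b \<in> {-pi..pi}" using b by auto
    have nz: "\<xi> b \<noteq> 0" "cmod (1 + \<xi> b) > 0" using A.xi_nonzero[of b] A.one_plus_xi_nonzero[of b] b by auto
    have r: "rho th b > 0" using rp bb by simp
    have "\<bar>J' b\<bar> * (rho th b * cmod (1 + \<xi> b)) = J b * cmod (\<xi>' b) * cmod (\<xi> b - sg)"
      using arg_cong[OF dJ_eq[OF bb(1) b(2)], of cmod] A.norm_xi[OF bb(2)] J_nonneg[of b]
      by (simp add: norm_mult add.commute)
    moreover have "J b = c * (cmod (1 + \<xi> b) powr (1 / th) * cmod (1 + \<xi> b)) / rho th b powr (1 / th)"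
    proof -
      have "(1 + th) * (1 / th) = 1 / th + 1" using th_pos by (simp add: field_simps)
      then have "(cmod (1 + \<xi> b) powr (1 + th)) powr (1 / th) = cmod (1 + \<xi> b) powr (1 / th) * cmod (1 + \<xi> b)"
        by (simp only: powr_powr) (use nz in \<open>simp add: powr_add\<close>)
      then show ?thesis using r nz by (simp add: Jr_def fc_quot_def powr_divide)
    qed
    ultimately have "\<bar>J' b\<bar> * (rho th b * cmod (1 + \<xi> b)) = cmod (\<xi>' b) * g b * (rho th b * cmod (1 + \<xi> b))"
      using r by (simp add: g_def)
    then have "\<bar>J' b\<bar> = cmod (\<xi>' b) * g b" using r nz by simp
    also have "\<dots> \<le> M * G"
    proof -
      have "cmod (\<xi>' b) * g b \<le> cmod (\<xi>' b) * \<bar>g b\<bar>" by (intro mult_left_mono) auto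
      also have "\<dots> \<le> M * G" using M G bb b by (intro mult_mono) auto
      finally show ?thesis .
    qed
    finally show ?thesis .
  qed
  then show ?thesis using M(1) G(1) by (intro exI[of _ "M * G"]) auto
qed

lemma continuous_on_dJ: "continuous_on ({-pi<..<pi} - {0}) J'"
proof -
  have eq: "J' b = Re (of_real (J b) * \<xi>' b * (\<xi> b - sg) / (\<xi> b * (\<xi> b + 1)))" if "b \<in> {-pi<..<pi} - {0}" for b
  proof -
    have b: "b \<noteq> 0" "\<bar>b\<bar> < pi" using that by auto
    have nz: "\<xi> b \<noteq> 0" "\<xi> b + 1 \<noteq> 0" using A.xi_nonzero[of b] A.one_plus_xi_nonzero[of b] b by (auto simp: add.commute)
    have "of_real (J' b) = of_real (J b) * \<xi>' b * (\<xi> b - sg) / (\<xi> b * (\<xi> b + 1))"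
      using dJ_eq[OF b] nz by (simp add: eq_divide_eq)
    then show ?thesis by (metis Re_complex_of_real)
  qed
  have "continuous_on ({-pi<..<pi} - {0}) (\<lambda>b. Re (of_real (J b) * \<xi>' b * (\<xi> b - sg) / (\<xi> b * (\<xi> b + 1))))"
  proof (intro continuous_intros ballI)
    show "continuous_on ({-pi<..<pi} - {0}) J" by (rule continuous_on_subset[OF continuous_on_J]) auto
    show "continuous_on ({-pi<..<pi} - {0}) \<xi>" by (rule continuous_on_subset[OF A.continuous_on_xi]) auto
    then show "continuous_on ({-pi<..<pi} - {0}) \<xi>" .
    then show "continuous_on ({-pi<..<pi} - {0}) \<xi>" .
    show "continuous_on ({-pi<..<pi} - {0}) \<xi>'" by (rule continuous_on_subset[OF A.continuous_on_dxi]) auto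
    show "\<xi> x * (\<xi> x + 1) \<noteq> 0" if "x \<in> {-pi<..<pi} - {0}" for x
      using that A.xi_nonzero[of x] A.one_plus_xi_nonzero[of x] by (auto simp: add.commute abs_less_iff abs_le_iff)
  qed
  then show ?thesis by (rule continuous_on_eq) (rule eq[symmetric])
qed

lemma integrable_dxi:
  fixes g :: "real \<Rightarrow> complex"
  assumes "continuous_on {-pi..pi} g"
  shows "(\<lambda>b. g b * \<xi>' b) integrable_on {-pi..pi}"
proof -
  obtain M where M: "M > 0" "\<And>b. 0 < \<bar>b\<bar> \<Longrightarrow> \<bar>b\<bar> \<le> pi \<Longrightarrow> cmod (\<xi>' b) \<le> M" using A.dxi_bounded by blast
  have "bounded (g ` {-pi..pi})" by (intro compact_imp_bounded compact_continuous_image assms) auto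
  then obtain G where "G > 0" "\<forall>x\<in>g ` {-pi..pi}. norm x \<le> G" unfolding bounded_pos by blast
  then have G: "G > 0" "\<And>b. b \<in> {-pi..pi} \<Longrightarrow> cmod (g b) \<le> G" by auto
  show ?thesis
  proof (rule integrable_bounded_except[of "{0}" _ _ _ "G * M"])
    show "continuous_on ({-pi..pi} - {0}) (\<lambda>b. g b * \<xi>' b)"
      by (intro continuous_intros A.continuous_on_dxi continuous_on_subset[OF assms]) auto
    fix x assume x: "x \<in> {-pi..pi} - {0}"
    then show "cmod (g x * \<xi>' x) \<le> G * M"
      unfolding norm_mult using G M by (intro mult_mono) auto
  qed auto
qed

text \<open>Along the curve \<xi>'/\<xi> = rho'/rho + i. The real part is odd and J is even, so
  averaging with the reflected integral leaves only i.\<close>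

lemma has_integral_m_xi: "((\<lambda>b. of_real (DV (J b)) * (\<xi>' b / \<xi> b)) has_integral (\<i> * of_real DV_total)) {-pi..pi}"
proof -
  have "(\<lambda>b. (of_real (DV (J b)) / \<xi> b) * \<xi>' b) integrable_on {-pi..pi}"
    by (intro integrable_dxi continuous_intros A.continuous_on_xi continuous_on_of_real continuous_on_comp_J continuous_on_DV)
       (use A.xi_nonzero in \<open>auto simp: abs_le_iff\<close>)
  then obtain I where I: "((\<lambda>b. of_real (DV (J b)) * (\<xi>' b / \<xi> b)) has_integral I) {-pi..pi}"
    by (auto simp: integrable_on_def)
  have "((\<lambda>b. of_real (DV (J (- b))) * (\<xi>' (- b) / \<xi> (- b))) has_integral I) {-pi..- (- pi)}"
    using I by (subst has_integral_reflect_real[of "\<lambda>b. of_real (DV (J b)) * (\<xi>' b / \<xi> b)"]) auto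
  then have I2: "((\<lambda>b. of_real (DV (J b)) * (- cnj (\<xi>' b / \<xi> b))) has_integral I) {-pi..pi}"
    by (simp add: A.dxi_minus A.xi_minus)
  have "((\<lambda>b. of_real (DV (J b)) * (\<xi>' b / \<xi> b) + of_real (DV (J b)) * (- cnj (\<xi>' b / \<xi> b))) has_integral I + I) {-pi..pi}"
    by (rule has_integral_add[OF I I2])
  moreover have "((\<lambda>b. of_real (DV (J b)) * (2 * \<i>)) has_integral of_real DV_total * (2 * \<i>)) {-pi..pi}"
    by (intro has_integral_mult_left has_integral_of_real has_integral_DV_total)
  moreover have "((\<lambda>b. of_real (DV (J b)) * (2 * \<i>)) has_integral of_real DV_total * (2 * \<i>)) {-pi..pi} \<Longrightarrow>
    ((\<lambda>b. of_real (DV (J b)) * (\<xi>' b / \<xi> b) + of_real (DV (J b)) * (- cnj (\<xi>' b / \<xi> b))) has_integral of_real DV_total * (2 * \<i>)) {-pi..pi}"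
  proof (erule has_integral_spike_finite[of "{0}", rotated 2])
    fix b assume "b \<in> {-pi..pi} - {0}"
    then have r: "rho th b > 0" using A.rho_pos[of b] by (auto simp: abs_le_iff)
    have "\<xi>' b / \<xi> b = of_real (drho th b / rho th b) + \<i>" using r by (simp add: dxi_def xi_def field_simps)
    then have "\<xi>' b / \<xi> b - cnj (\<xi>' b / \<xi> b) = 2 * \<i>" by simp
    then show "of_real (DV (J b)) * (\<xi>' b / \<xi> b) + of_real (DV (J b)) * (- cnj (\<xi>' b / \<xi> b)) = of_real (DV (J b)) * (2 * \<i>)"
      by (simp only: distrib_left[symmetric] add_uminus_conv_diff)
  qed auto
  ultimately have "I + I = of_real DV_total * (2 * \<i>)" using has_integral_unique by blast
  then have "I = \<i> * of_real DV_total" by (simp add: complex_eq_iff)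
  then show ?thesis using I by simp
qed

text \<open>With E(s) = J/J' = s (s+1) / (s - 1/th), the difference quotient of E is 1 minus a product of a function of
  s and a function of \<xi>; this separates off the term with the edge coefficient.\<close>
lemma N_formula:
  assumes s0: "lam > 1" "\<bar>b0\<bar> \<le> pi" "s0 = of_real lam * \<xi> b0"
  defines "N \<equiv> (\<integral>z. w_of s0 / (w_of s0 - of_real z) \<partial>mu)"
  assumes wint: "integrable mu (\<lambda>z. w_of s0 / (w_of s0 - of_real z))"
  shows "((\<lambda>b. of_real (DV (J b)) * (\<xi>' b / (\<xi> b - s0))) has_integral
     2 * pi * \<i> * (1 + of_real edge_coeff / (s0 - sg) - N)) {-pi..pi}"
proof -
  note f = lam_xi_facts[OF s0]
  have sns: "s0 - sg \<noteq> 0" using f(2)[of 0] by simp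
  have s1: "s0 + 1 \<noteq> 0" using f(5) by (simp add: add_eq_0_iff2)
  define q where "q = (s0 - sg) / (s0 * (s0 + 1))"
  define R where "R = 2 * pi * \<i> * (1 / s0 - N * q)"
  have X1: "((\<lambda>b. of_real (V (J b) + l) * (1 / (\<xi> b - s0)\<^sup>2) * \<xi>' b) has_integral R) {-pi..pi}"
    using fubini[OF s0 wint] by (simp only: R_def q_def N_def)
  \<comment> \<open>Integration by parts against - 1/(\<xi> - s0). The boundary terms cancel because
    the curve is closed and J agrees at both ends.\<close>
  have X2: "((\<lambda>b. of_real (V (J b) + l) * (1 / (\<xi> b - s0)\<^sup>2) * \<xi>' b - of_real (V' (J b) * J' b) / (\<xi> b - s0)) has_integral
     (- of_real (V (J pi) + l) / (\<xi> pi - s0)) - (- of_real (V (J (- pi)) + l) / (\<xi> (- pi) - s0))) {-pi..pi}"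
  proof (rule fundamental_theorem_of_calculus_interior_strong[of "{0}" _ _ "\<lambda>b. - of_real (V (J b) + l) / (\<xi> b - s0)"])
    fix b assume "b \<in> {-pi<..<pi} - {0}"
    then have b: "b \<noteq> 0" "\<bar>b\<bar> < pi" "\<bar>b\<bar> \<le> pi" by auto
    have nz: "\<xi> b - s0 \<noteq> 0" using f(2)[OF b(3)] by simp
    have "((\<lambda>b. V (J b) + l) has_real_derivative V' (J b) * J' b) (at b)"
      using DERIV_add[OF comp_J_deriv[of V V', OF V_deriv b(1,2)] DERIV_const[of l]] by simp
    then have d1: "((\<lambda>b. complex_of_real (V (J b) + l)) has_vector_derivative of_real (V' (J b) * J' b)) (at b)"
      by (intro has_vector_derivative_of_real) (simp add: has_real_derivative_iff_has_vector_derivative)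
    have d2: "(((\<lambda>z. - 1 / (z - s0)) \<circ> \<xi>) has_vector_derivative \<xi>' b * (1 / (\<xi> b - s0)\<^sup>2)) (at b)"
      by (rule field_vector_diff_chain_at[OF A.xi_has_derivative[OF b(1,3)]])
         (use nz in \<open>auto intro!: derivative_eq_intros simp: power2_eq_square\<close>)
    from has_vector_derivative_mult[OF d1 d2]
    show "((\<lambda>b. - of_real (V (J b) + l) / (\<xi> b - s0)) has_vector_derivative
       of_real (V (J b) + l) * (1 / (\<xi> b - s0)\<^sup>2) * \<xi>' b - of_real (V' (J b) * J' b) / (\<xi> b - s0)) (at b)"
      by (simp add: o_def mult_ac minus_divide_left[symmetric] del: of_real_add)
  next
    show "continuous_on {-pi..pi} (\<lambda>b. - of_real (V (J b) + l) / (\<xi> b - s0))"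
      by (intro continuous_intros A.continuous_on_xi continuous_on_of_real continuous_on_comp_J continuous_on_V)
         (use f(2) in \<open>auto simp: abs_le_iff\<close>)
  qed auto
  then have X2': "((\<lambda>b. of_real (V (J b) + l) * (1 / (\<xi> b - s0)\<^sup>2) * \<xi>' b - of_real (V' (J b) * J' b) / (\<xi> b - s0)) has_integral 0) {-pi..pi}"
    by simp
  have X3: "((\<lambda>b. of_real (V' (J b) * J' b) / (\<xi> b - s0)) has_integral R) {-pi..pi}"
    using has_integral_diff[OF X1 X2'] by simp
  have X4: "((\<lambda>b. complex_of_real (V' (J b) * J' b)) has_integral 0) {-pi..pi}"
  proof -
    have "((\<lambda>b. V' (J b) * J' b) has_integral V (J pi) - V (J (- pi))) {-pi..pi}"
    proof (rule fundamental_theorem_of_calculus_interior_strong[of "{0}"])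
      show "continuous_on {-pi..pi} (\<lambda>b. V (J b))" by (intro continuous_on_comp_J continuous_on_V)
      fix x assume "x \<in> {-pi<..<pi} - {0}"
      then show "((\<lambda>b. V (J b)) has_vector_derivative V' (J x) * J' x) (at x)"
        using comp_J_deriv[of V V', OF V_deriv, of x] by (auto simp: has_real_derivative_iff_has_vector_derivative)
    qed auto
    then have "((\<lambda>b. V' (J b) * J' b) has_integral 0) {-pi..pi}" by simp
    from has_integral_of_real[OF this] show ?thesis by simp
  qed
  \<comment> \<open>The difference quotient of E equals 1 - sg (1+sg) / ((x-sg) (s0-sg)).
    Multiplying by x - sg and splitting 1 + sg as (x+1) - (x-sg) gives the identity
    \<open>key\<close> below, with this k.\<close>
  define k where "k = sg / (s0 - sg)"
  have Y: "((\<lambda>b. (1 / q) * (of_real (V' (J b) * J' b) / (\<xi> b - s0)) + (1 + k) * of_real (V' (J b) * J' b) - k * (of_real (DV (J b)) * (\<xi>' b / \<xi> b))) has_integral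
      (1 / q) * R + (1 + k) * 0 - k * (\<i> * of_real DV_total)) {-pi..pi}"
    by (intro has_integral_add has_integral_diff has_integral_mult_right X3 X4 has_integral_m_xi)
  then have "((\<lambda>b. of_real (DV (J b)) * (\<xi>' b / (\<xi> b - s0))) has_integral
      (1 / q) * R + (1 + k) * 0 - k * (\<i> * of_real DV_total)) {-pi..pi}"
  proof (rule has_integral_spike_finite[of "{0, pi, - pi}", rotated 2])
    fix b assume "b \<in> {-pi..pi} - {0, pi, - pi}"
    then have b: "b \<noteq> 0" "\<bar>b\<bar> < pi" "\<bar>b\<bar> \<le> pi" by auto
    define x where "x = \<xi> b"
    have nz: "x \<noteq> 0" "x + 1 \<noteq> 0" "x - s0 \<noteq> 0"
      using A.xi_nonzero[OF b(3)] A.one_plus_xi_nonzero[OF b(2)] f(2)[OF b(3)] by (auto simp: x_def add.commute)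
    \<comment> \<open>A common factor: J \<xi>' = j x (x+1) and J' = j (x - sg). After
      multiplication by V'(J) j, every term of \<open>key\<close> is one of the integrands of
      \<open>Y\<close>.\<close>
    define j where "j = of_real (J b) * \<xi>' b / (x * (x + 1))"
    have Jx: "of_real (J b) * \<xi>' b = j * (x * (x + 1))" using nz by (simp add: j_def)
    have dJx: "of_real (J' b) = j * (x - sg)"
      using dJ_eq[OF b(1,2)] nz by (simp add: j_def x_def[symmetric] eq_divide_eq)
    have key: "x * (x + 1) / (x - s0) = (s0 * (s0 + 1) / (s0 - sg)) * ((x - sg) / (x - s0)) + (1 + k) * (x - sg) - k * (x + 1)"
    proof -
      have "k * (s0 - sg) = sg" using sns by (simp add: k_def)
      have "((s0 * (s0 + 1) / (s0 - sg)) * ((x - sg) / (x - s0)) + (1 + k) * (x - sg) - k * (x + 1)) * ((s0 - sg) * (x - s0))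
         = s0 * (s0 + 1) * (x - sg) + (s0 - sg + sg) * (x - sg) * (x - s0) - sg * (x + 1) * (x - s0)"
      proof -
        have "((s0 * (s0 + 1) / (s0 - sg)) * ((x - sg) / (x - s0))) * ((s0 - sg) * (x - s0)) = s0 * (s0 + 1) * (x - sg)"
          using sns nz(3) by simp
        moreover have "((1 + k) * (x - sg)) * ((s0 - sg) * (x - s0)) = (s0 - sg + k * (s0 - sg)) * (x - sg) * (x - s0)"
          by (simp only: ring_distribs mult_ac) (simp add: algebra_simps)
        moreover have "(k * (x + 1)) * ((s0 - sg) * (x - s0)) = (k * (s0 - sg)) * (x + 1) * (x - s0)"
          by (simp only: mult_ac)
        ultimately show ?thesis using \<open>k * (s0 - sg) = sg\<close> by (simp only: left_diff_distrib distrib_right)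
      qed
      also have "\<dots> = x * (x + 1) * (s0 - sg)" by (simp only: ring_distribs) (simp add: algebra_simps)
      finally show ?thesis using sns nz(3) by (simp add: divide_eq_eq)
    qed
    have m: "of_real (DV (J b)) * \<xi>' b = of_real (V' (J b)) * (j * (x * (x + 1)))"
      by (simp add: DV_def Jx[symmetric] mult_ac)
    have "of_real (DV (J b)) * (\<xi>' b / (x - s0)) = of_real (V' (J b)) * j * (x * (x + 1) / (x - s0))"
      using m by (simp add: mult_ac)
    also have "\<dots> = of_real (V' (J b)) * j * ((1 / q) * ((x - sg) / (x - s0)) + (1 + k) * (x - sg) - k * (x + 1))"
      unfolding key by (simp only: q_def) simp
    also have "\<dots> = (1 / q) * (of_real (V' (J b)) * (j * (x - sg)) / (x - s0)) + (1 + k) * (of_real (V' (J b)) * (j * (x - sg)))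
       - k * (of_real (V' (J b)) * (j * (x * (x + 1))) / x)"
    proof -
      have "of_real (V' (J b)) * (j * (x * (x + 1))) / x = of_real (V' (J b)) * j * (x + 1)" using nz by simp
      then show ?thesis by (simp add: algebra_simps)
    qed
    also have "\<dots> = (1 / q) * (of_real (V' (J b) * J' b) / (x - s0)) + (1 + k) * of_real (V' (J b) * J' b) - k * (of_real (DV (J b)) * (\<xi>' b / x))"
      by (simp only: dJx[symmetric] of_real_mult m[symmetric] times_divide_eq_right)
    finally show "of_real (DV (J b)) * (\<xi>' b / (\<xi> b - s0)) = (1 / q) * (of_real (V' (J b) * J' b) / (\<xi> b - s0)) + (1 + k) * of_real (V' (J b) * J' b) - k * (of_real (DV (J b)) * (\<xi>' b / \<xi> b))"
      by (simp only: x_def)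
  qed auto
  moreover have "(1 / q) * R + (1 + k) * 0 - k * (\<i> * of_real DV_total) = 2 * pi * \<i> * (1 + of_real edge_coeff / (s0 - sg) - N)"
  proof -
    have qnz: "q \<noteq> 0" using sns f(1) s1 by (simp add: q_def)
    have "(1 / q) * R = 2 * pi * \<i> * (1 / q / s0 - N)" using qnz by (simp add: R_def right_diff_distrib)
    moreover have "1 / q / s0 = 1 + (1 + sg) / (s0 - sg)"
    proof -
      have "1 / q / s0 = (s0 + 1) / (s0 - sg)" using f(1) by (simp add: q_def)
      also have "s0 + 1 = (s0 - sg) + (1 + sg)" by simp
      also have "\<dots> / (s0 - sg) = 1 + (1 + sg) / (s0 - sg)" using sns by (subst add_divide_distrib) simp
      finally show ?thesis .
    qed
    moreover have "k * (\<i> * of_real DV_total) = 2 * pi * \<i> * (of_real (DV_total / (2 * pi * th)) / (s0 - sg))"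
      by (simp add: k_def)
    ultimately have "(1 / q) * R + (1 + k) * 0 - k * (\<i> * of_real DV_total) =
       2 * pi * \<i> * (1 + (1 + sg) / (s0 - sg) - N - of_real (DV_total / (2 * pi * th)) / (s0 - sg))"
      by (simp only: right_diff_distrib mult_zero_right add_0_right)
    also have "1 + (1 + sg) / (s0 - sg) - N - of_real (DV_total / (2 * pi * th)) / (s0 - sg) = 1 + of_real edge_coeff / (s0 - sg) - N"
      by (simp add: edge_coeff_def diff_divide_distrib)
    finally show ?thesis .
  qed
  ultimately show ?thesis by simp
qed

text \<open>In the real part of \<open>N_formula\<close>, integration by parts turns Re
  (\<xi>'/(\<xi> - s0)) into ln |\<xi> - s0|. Folding to [0, pi] then produces a difference of
  logarithms, since J is even, J' is odd and reflection of the angle is conjugation.\<close>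

lemma Im_N:
  assumes s0: "lam > 1" "\<bar>b0\<bar> \<le> pi" "s0 = of_real lam * \<xi> b0"
  defines "N \<equiv> (\<integral>z. w_of s0 / (w_of s0 - of_real z) \<partial>mu)"
  assumes wint: "integrable mu (\<lambda>z. w_of s0 / (w_of s0 - of_real z))"
  shows "((\<lambda>b. dDV (J b) * J' b * (ln (cmod (cnj (\<xi> b) - s0)) - ln (cmod (\<xi> b - s0)))) has_integral
     2 * pi * (Im N - edge_coeff * Im (1 / (s0 - sg)))) {0..pi}"
proof -
  note f = lam_xi_facts[OF s0]
  define Z where "Z = 2 * pi * \<i> * (1 + of_real edge_coeff / (s0 - sg) - N)"
  have reZ: "Re Z = 2 * pi * (Im N - edge_coeff * Im (1 / (s0 - sg)))"
  proof -
    have "Re Z = - 2 * pi * Im (1 + of_real edge_coeff / (s0 - sg) - N)" by (simp add: Z_def)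
    also have "of_real edge_coeff / (s0 - sg) = of_real edge_coeff * (1 / (s0 - sg))" by simp
    also have "Im (1 + of_real edge_coeff * (1 / (s0 - sg)) - N) = edge_coeff * Im (1 / (s0 - sg)) - Im N"
      by (simp only: minus_complex.sel plus_complex.sel one_complex.sel times_complex.sel Re_complex_of_real Im_complex_of_real mult_zero_left add_0_left add_0_right)
    finally show ?thesis by (simp add: algebra_simps)
  qed
  have "((\<lambda>b. of_real (DV (J b)) * (\<xi>' b / (\<xi> b - s0))) has_integral Z) {-pi..pi}"
    using N_formula[OF s0 wint] by (simp only: Z_def N_def)
  from has_integral_linear[OF this bounded_linear_Re]
  have "((\<lambda>b. Re (of_real (DV (J b)) * (\<xi>' b / (\<xi> b - s0)))) has_integral Re Z) {-pi..pi}"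
    by (simp only: o_def)
  then have X1: "((\<lambda>b. DV (J b) * Re (\<xi>' b / (\<xi> b - s0))) has_integral Re Z) {-pi..pi}"
    by (simp only: times_complex.sel Re_complex_of_real Im_complex_of_real mult_zero_left diff_zero)
  \<comment> \<open>The boundary terms vanish because J is 0 at both ends and \<open>DV 0\<close> =
    0.\<close>
  have X2: "((\<lambda>b. dDV (J b) * J' b * ln (cmod (\<xi> b - s0)) + DV (J b) * Re (\<xi>' b / (\<xi> b - s0))) has_integral
     DV (J pi) * ln (cmod (\<xi> pi - s0)) - DV (J (- pi)) * ln (cmod (\<xi> (- pi) - s0))) {-pi..pi}"
  proof (rule fundamental_theorem_of_calculus_interior_strong[of "{0}" _ _ "\<lambda>b. DV (J b) * ln (cmod (\<xi> b - s0))"])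
    fix b assume "b \<in> {-pi<..<pi} - {0}"
    then have b: "b \<noteq> 0" "\<bar>b\<bar> < pi" "\<bar>b\<bar> \<le> pi" by auto
    have nz: "\<xi> b - s0 \<noteq> 0" using f(2)[OF b(3)] by simp
    have "((\<lambda>b. \<xi> b - s0) has_vector_derivative \<xi>' b) (at b)"
      using has_vector_derivative_diff[OF A.xi_has_derivative[OF b(1,3)] has_vector_derivative_const[of s0]] by simp
    from DERIV_mult[OF comp_J_deriv[of DV dDV, OF DV_deriv b(1,2)] ln_norm_derivative[OF this nz]]
    show "((\<lambda>b. DV (J b) * ln (cmod (\<xi> b - s0))) has_vector_derivative
      dDV (J b) * J' b * ln (cmod (\<xi> b - s0)) + DV (J b) * Re (\<xi>' b / (\<xi> b - s0))) (at b)"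
      by (simp add: has_real_derivative_iff_has_vector_derivative mult.commute)
  next
    show "continuous_on {-pi..pi} (\<lambda>b. DV (J b) * ln (cmod (\<xi> b - s0)))"
      by (intro continuous_intros A.continuous_on_xi continuous_on_comp_J continuous_on_DV)
         (use f(2) in \<open>auto simp: abs_le_iff\<close>)
  qed auto
  have X3: "((\<lambda>b. dDV (J b) * J' b * ln (cmod (\<xi> b - s0))) has_integral - Re Z) {-pi..pi}"
    using has_integral_diff[OF X2 X1] by (simp add: DV_def)
  define g where "g = (\<lambda>b. dDV (J b) * J' b * ln (cmod (\<xi> b - s0)))"
  have gi: "g integrable_on {-pi..pi}" "integral {-pi..pi} g = - Re Z" using X3 by (auto simp: g_def)
  then have gi1: "g integrable_on {-pi..0}" and gi2: "g integrable_on {0..pi}"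
    by (auto intro: integrable_on_subinterval)
  have "((\<lambda>b. g (- b)) has_integral integral {-pi..0} g) {- 0..- (- pi)}"
    using integrable_integral[OF gi1] by (subst has_integral_reflect_real) auto
  then have r1: "((\<lambda>b. g (- b)) has_integral integral {-pi..0} g) {0..pi}" by simp
  have "((\<lambda>b. - (g b) - g (- b)) has_integral - integral {0..pi} g - integral {-pi..0} g) {0..pi}"
    by (intro has_integral_diff has_integral_neg r1 integrable_integral gi2)
  moreover have "integral {-pi..0} g + integral {0..pi} g = - Re Z"
    using Henstock_Kurzweil_Integration.integral_combine[of "- pi" 0 pi g] gi by simp
  moreover have "- integral {0..pi} g - integral {-pi..0} g = Re Z" using calculation(2) by linarith
  ultimately have "((\<lambda>b. - (g b) - g (- b)) has_integral Re Z) {0..pi}" by (simp only:)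
  moreover have "- (g b) - g (- b) = dDV (J b) * J' b * (ln (cmod (cnj (\<xi> b) - s0)) - ln (cmod (\<xi> b - s0)))" for b
    by (simp add: g_def dJ_minus A.xi_minus algebra_simps)
  ultimately show ?thesis unfolding reZ by simp
qed

end


section \<open>Boundary values\<close>

context equil begin

text \<open>Im (w/(w - z)) is - z times the unnormalised Poisson kernel of the upper half-plane at
  w, so the imaginary part samples the density of z d\<mu>(z).\<close>

lemma Poisson_Im:
  assumes "Im w > 0"
  shows "integrable mu (\<lambda>z. w / (w - of_real z))"
    "Im (\<integral>z. w / (w - of_real z) \<partial>mu) = - (\<integral>z. z * (Im w / ((z - Re w)\<^sup>2 + (Im w)\<^sup>2)) \<partial>mu)"
    "integrable mu (\<lambda>z. z * (Im w / ((z - Re w)\<^sup>2 + (Im w)\<^sup>2)))"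
proof -
  interpret prob_space mu by (rule prob)
  show i: "integrable mu (\<lambda>z. w / (w - of_real z))"
  proof (rule integrable_const_bound[where B="cmod w / Im w"])
    have "cmod (w / (w - of_real z)) \<le> cmod w / Im w" for z
    proof -
      have "Im w \<le> cmod (w - of_real z)" using abs_Im_le_cmod[of "w - of_real z"] by simp
      then show ?thesis using assms by (simp add: norm_divide frac_le)
    qed
    then show "AE z in mu. norm (w / (w - of_real z)) \<le> cmod w / Im w" by simp
  qed simp
  have e: "Im (w / (w - of_real z)) = - (z * (Im w / ((z - Re w)\<^sup>2 + (Im w)\<^sup>2)))" for z
  proof -
    have "(z - Re w)\<^sup>2 = (Re w - z)\<^sup>2" by (rule power2_commute)
    then show ?thesis by (simp add: Im_divide algebra_simps)
  qed
  have "integrable mu (\<lambda>z. Im (w / (w - of_real z)))" using i by simp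
  then show "integrable mu (\<lambda>z. z * (Im w / ((z - Re w)\<^sup>2 + (Im w)\<^sup>2)))" unfolding e by simp
  show "Im (\<integral>z. w / (w - of_real z) \<partial>mu) = - (\<integral>z. z * (Im w / ((z - Re w)\<^sup>2 + (Im w)\<^sup>2)) \<partial>mu)"
    using integral_Im[OF i] unfolding e by simp
qed

text \<open>Approximate identity with total mass pi. Continuity of \<psi> at x allows any direction
  of approach. Away from x the density is not estimated at all, only the probability measure is
  used.\<close>

lemma Poisson_limit:
  fixes w :: "nat \<Rightarrow> complex"
  assumes x: "0 < x" "x < J 0" and w: "w \<longlonglongrightarrow> of_real x" "\<And>n. Im (w n) > 0"
  shows "(\<lambda>n. Im (\<integral>z. w n / (w n - of_real z) \<partial>mu)) \<longlonglongrightarrow> - pi * x * \<psi> x"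
proof -
  interpret prob_space mu by (rule prob)
  define k where "k = (\<lambda>z. z * \<psi> z)"
  define P where "P = (\<lambda>n z. Im (w n) / ((z - Re (w n))\<^sup>2 + (Im (w n))\<^sup>2))"
  define I where "I = (\<lambda>n. (\<integral>z. z * P n z \<partial>mu))"
  have rw: "(\<lambda>n. Re (w n)) \<longlonglongrightarrow> x" and iw: "(\<lambda>n. Im (w n)) \<longlonglongrightarrow> 0"
    using tendsto_Re[OF w(1)] tendsto_Im[OF w(1)] by auto
  have Ppos: "P n z > 0" for n z using w(2)[of n] by (auto simp: P_def intro!: divide_pos_pos add_nonneg_pos)
  have kcont: "continuous_on {0<..<J 0} k" unfolding k_def by (intro continuous_intros psi_cont)
  have "I \<longlonglongrightarrow> pi * k x"
  proof (rule LIMSEQ_I)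
    fix r :: real assume r: "r > 0"
    \<comment> \<open>Chosen so that (pi + 1) e = r/2: one part is for the oscillation of k against
      mass at most nearly pi, the rest is slack.\<close>
    define e where "e = (r / 2) / (pi + 1)"
    have e: "e > 0" using r pi_gt_zero by (simp add: e_def add_pos_pos)
    have er: "pi * e + e < r"
    proof -
      have "pi + 1 > 0" using pi_gt_zero by linarith
      then have "(pi + 1) * e = r / 2" unfolding e_def by (simp del: divide_divide_eq_left)
      then show ?thesis using r by (simp add: algebra_simps)
    qed
    have "isCont k x" using kcont x by (simp add: continuous_on_eq_continuous_at)
    then obtain d0 where d0: "d0 > 0" "\<And>z. \<bar>z - x\<bar> < d0 \<Longrightarrow> \<bar>k z - k x\<bar> < e"
      using e unfolding continuous_at_eps_delta by (auto simp: dist_real_def)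
    define d where "d = Min {d0, x, J 0 - x} / 2"
    have d: "d > 0" "d < d0" "d < x" "d < J 0 - x" using d0 x by (auto simp: d_def min_def)
    define A where "A = {x - d..x + d}"
    have Asub: "A \<subseteq> {0<..<J 0}" using d by (auto simp: A_def)
    have kA: "\<bar>k z - k x\<bar> \<le> e" if "z \<in> A" for z
    proof -
      have "\<bar>z - x\<bar> < d0" using that d by (auto simp: A_def)
      from d0(2)[OF this] show ?thesis by simp
    qed
    define T where "T = (\<lambda>n. arctan ((x + d - Re (w n)) / Im (w n)) - arctan ((x - d - Re (w n)) / Im (w n)))"
    have Pc: "continuous_on S (P n)" for S n
      unfolding P_def using w(2)[of n] by (intro continuous_intros) (auto simp: sum_power2_eq_zero_iff add_nonneg_eq_0_iff)
    have TP: "(\<integral>z. indicator A z *\<^sub>R P n z \<partial>lborel) = T n" for n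
      unfolding A_def T_def
    proof (rule integral_FTC_atLeastAtMost)
      fix z
      have i: "Im (w n) > 0" by (rule w(2))
      have d1: "((\<lambda>z. (z - Re (w n)) / Im (w n)) has_real_derivative 1 / Im (w n)) (at z)"
        using i by (auto intro!: derivative_eq_intros)
      have "((\<lambda>z. arctan ((z - Re (w n)) / Im (w n))) has_real_derivative (1 / (1 + ((z - Re (w n)) / Im (w n))\<^sup>2)) * (1 / Im (w n))) (at z within {x - d..x + d})"
        using has_field_derivative_at_within[OF DERIV_chain2[OF DERIV_arctan d1]] by (simp only: inverse_eq_divide)
      moreover have "(1 / (1 + ((z - Re (w n)) / Im (w n))\<^sup>2)) * (1 / Im (w n)) = P n z"
      proof -
        have "1 + ((z - Re (w n)) / Im (w n))\<^sup>2 = ((z - Re (w n))\<^sup>2 + (Im (w n))\<^sup>2) / (Im (w n))\<^sup>2"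
          using i by (simp add: power_divide add_divide_distrib)
        then show ?thesis using i by (simp add: P_def power2_eq_square)
      qed
      ultimately show "((\<lambda>z. arctan ((z - Re (w n)) / Im (w n))) has_vector_derivative P n z) (at z within {x - d..x + d})"
        by (simp add: has_real_derivative_iff_has_vector_derivative)
    qed (use d Pc in auto)
    have Tlim: "T \<longlonglongrightarrow> pi"
    proof -
      have inf: "filterlim (\<lambda>n. Im (w n)) (at_right 0) sequentially"
      proof -
        have "Im (w n) \<noteq> 0" for n using w(2)[of n] by simp
        then show ?thesis unfolding filterlim_at using iw w(2) by (auto intro!: always_eventually)
      qed
      have "(\<lambda>n. x + d - Re (w n)) \<longlonglongrightarrow> x + d - x" "(\<lambda>n. x - d - Re (w n)) \<longlonglongrightarrow> x - d - x"
        by (intro tendsto_intros rw)+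
      then have a: "(\<lambda>n. x + d - Re (w n)) \<longlonglongrightarrow> d" "(\<lambda>n. x - d - Re (w n)) \<longlonglongrightarrow> - d" by simp_all
      have "filterlim (\<lambda>n. (x + d - Re (w n)) * inverse (Im (w n))) at_top sequentially"
        by (rule filterlim_tendsto_pos_mult_at_top[OF a(1) d(1)]) (rule filterlim_compose[OF filterlim_inverse_at_top_right inf])
      then have "(\<lambda>n. arctan ((x + d - Re (w n)) / Im (w n))) \<longlonglongrightarrow> pi / 2"
        by (intro filterlim_compose[OF tendsto_arctan_at_top]) (simp add: divide_inverse)
      moreover have "filterlim (\<lambda>n. (x - d - Re (w n)) * inverse (Im (w n))) at_bot sequentially"
        by (rule filterlim_tendsto_neg_mult_at_bot[OF a(2)]) (use d in simp, rule filterlim_compose[OF filterlim_inverse_at_top_right inf])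
      then have "(\<lambda>n. arctan ((x - d - Re (w n)) / Im (w n))) \<longlonglongrightarrow> - (pi / 2)"
        by (intro filterlim_compose[OF tendsto_arctan_at_bot]) (simp add: divide_inverse)
      ultimately have "T \<longlonglongrightarrow> pi / 2 - - (pi / 2)" unfolding T_def by (intro tendsto_diff)
      then show ?thesis by simp
    qed
    have kPi: "integrable lborel (\<lambda>z. indicator A z *\<^sub>R (k z * P n z))" for n
      using borel_integrable_compact[of A "\<lambda>z. k z * P n z"] continuous_on_subset[OF kcont Asub] Pc[of A n]
      by (auto simp: A_def indicator_def intro!: continuous_intros)
    have Pi: "integrable lborel (\<lambda>z. indicator A z *\<^sub>R P n z)" for n
      using borel_integrable_compact[of A "P n"] Pc[of A n] by (auto simp: A_def)
    have Ai: "integrable mu (\<lambda>z. indicator A z * (z * P n z))" "integrable mu (\<lambda>z. indicator (- A) z * (z * P n z))" for n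
    proof -
      have base: "integrable mu (\<lambda>z. z * P n z)" using Poisson_Im(3)[OF w(2)[of n]] by (simp only: P_def)
      have "A \<in> sets mu" "- A \<in> sets mu" by (auto simp: A_def)
      from integrable_real_mult_indicator[OF this(1) base] integrable_real_mult_indicator[OF this(2) base]
      show "integrable mu (\<lambda>z. indicator A z * (z * P n z))" "integrable mu (\<lambda>z. indicator (- A) z * (z * P n z))"
        by (simp_all only: mult.commute)
    qed
    have split: "I n = (\<integral>z. indicator A z * (z * P n z) \<partial>mu) + (\<integral>z. indicator (- A) z * (z * P n z) \<partial>mu)" for n
    proof -
      have "I n = (\<integral>z. indicator A z * (z * P n z) + indicator (- A) z * (z * P n z) \<partial>mu)"
        unfolding I_def by (intro Bochner_Integration.integral_cong) (auto simp: indicator_def)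
      then show ?thesis using Ai by simp
    qed
    have first: "(\<integral>z. indicator A z * (z * P n z) \<partial>mu) = (\<integral>z. indicator A z *\<^sub>R (k z * P n z) \<partial>lborel)" for n
    proof -
      have "(\<integral>z. indicator A z * (z * P n z) \<partial>mu)
        = (\<integral>z. (indicator {0<..<J 0} z * \<psi> z) *\<^sub>R (indicator A z * (z * P n z)) \<partial>lborel)"
        unfolding mu_eq
        by (rule integral_density)
           (auto simp: A_def P_def intro!: psi_nonneg AE_I2 split: split_indicator)
      also have "\<dots> = (\<integral>z. indicator A z *\<^sub>R (k z * P n z) \<partial>lborel)"
        by (rule Bochner_Integration.integral_cong) (use Asub in \<open>auto simp: k_def indicator_def\<close>)
      finally show ?thesis .
    qed
    have up1: "(\<integral>z. indicator A z *\<^sub>R (k z * P n z) \<partial>lborel) \<le> (k x + e) * T n" for n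
    proof -
      have "(\<integral>z. indicator A z *\<^sub>R (k z * P n z) \<partial>lborel) \<le> (\<integral>z. (k x + e) * (indicator A z *\<^sub>R P n z) \<partial>lborel)"
      proof (rule integral_mono)
        fix z show "indicator A z *\<^sub>R (k z * P n z) \<le> (k x + e) * (indicator A z *\<^sub>R P n z)"
          using kA[of z] Ppos[of n z] by (auto simp: indicator_def intro!: mult_right_mono)
      qed (use kPi Pi in auto)
      then show ?thesis using TP[of n] by simp
    qed
    have lo1: "(\<integral>z. indicator A z *\<^sub>R (k z * P n z) \<partial>lborel) \<ge> (k x - e) * T n" for n
    proof -
      have "(\<integral>z. (k x - e) * (indicator A z *\<^sub>R P n z) \<partial>lborel) \<le> (\<integral>z. indicator A z *\<^sub>R (k z * P n z) \<partial>lborel)"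
      proof (rule integral_mono)
        fix z show "(k x - e) * (indicator A z *\<^sub>R P n z) \<le> indicator A z *\<^sub>R (k z * P n z)"
          using kA[of z] Ppos[of n z] by (auto simp: indicator_def intro!: mult_right_mono)
      qed (use kPi Pi in auto)
      then show ?thesis using TP[of n] by simp
    qed
    \<comment> \<open>Once Re (w n) is within d/2 of x, points outside A have distance at least d/2
      from it, so this bounds z times the kernel there.\<close>
    define E where "E = (\<lambda>n. J 0 * (Im (w n) / (d / 2)\<^sup>2))"
    have second: "0 \<le> (\<integral>z. indicator (- A) z * (z * P n z) \<partial>mu)" for n
    proof (rule integral_nonneg_AE)
      show "AE z in mu. 0 \<le> indicator (- A) z * (z * P n z)"
        using AE_mu by eventually_elim (use Ppos[of n] in \<open>auto simp: indicator_def less_imp_le\<close>)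
    qed
    have second2: "(\<integral>z. indicator (- A) z * (z * P n z) \<partial>mu) \<le> E n" if n: "\<bar>Re (w n) - x\<bar> < d / 2" for n
    proof -
      have "(\<integral>z. indicator (- A) z * (z * P n z) \<partial>mu) \<le> (\<integral>z. E n \<partial>mu)"
      proof (rule integral_mono_AE)
        show "AE z in mu. indicator (- A) z * (z * P n z) \<le> E n"
          using AE_mu
        proof eventually_elim
          fix z assume z: "0 < z \<and> z < J 0"
          have En: "0 \<le> E n" using w(2)[of n] d J_pos[of 0] by (simp add: E_def)
          show "indicator (- A) z * (z * P n z) \<le> E n"
          proof (cases "z \<in> A")
            case False
            then have "d / 2 \<le> \<bar>z - Re (w n)\<bar>" using n by (auto simp: A_def abs_if split: if_splits)
            then have "(d / 2)\<^sup>2 \<le> \<bar>z - Re (w n)\<bar>\<^sup>2" using d by (intro power_mono) auto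
            then have "P n z \<le> Im (w n) / (d / 2)\<^sup>2"
            proof -
              have "(d / 2)\<^sup>2 > 0" using d by simp
              moreover have "(d / 2)\<^sup>2 \<le> (z - Re (w n))\<^sup>2 + (Im (w n))\<^sup>2"
                using \<open>(d / 2)\<^sup>2 \<le> \<bar>z - Re (w n)\<bar>\<^sup>2\<close> zero_le_power2[of "Im (w n)"] unfolding power2_abs by linarith
              ultimately show ?thesis unfolding P_def using w(2)[of n] by (intro frac_le) auto
            qed
            then have "z * P n z \<le> J 0 * (Im (w n) / (d / 2)\<^sup>2)"
              using z Ppos[of n z] by (intro mult_mono) auto
            then show ?thesis using False by (simp add: E_def)
          qed (simp add: En)
        qed
      qed (use Ai in auto)
      then show ?thesis using prob_space by simp
    qed
    have "(\<lambda>n. (k x + e) * T n + E n) \<longlonglongrightarrow> (k x + e) * pi + J 0 * (0 / (d / 2)\<^sup>2)"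
      unfolding E_def using d by (intro tendsto_intros Tlim iw) auto
    then have u: "\<forall>\<^sub>F n in sequentially. (k x + e) * T n + E n < pi * k x + r"
      by (rule order_tendstoD) (use er e in \<open>simp add: algebra_simps\<close>)
    have "(\<lambda>n. (k x - e) * T n) \<longlonglongrightarrow> (k x - e) * pi" by (intro tendsto_intros Tlim)
    then have lw: "\<forall>\<^sub>F n in sequentially. (k x - e) * T n > pi * k x - r"
      by (rule order_tendstoD) (use er e in \<open>simp add: algebra_simps\<close>)
    have dl: "\<forall>\<^sub>F n in sequentially. \<bar>Re (w n) - x\<bar> < d / 2"
      using tendstoD[OF rw, of "d / 2"] d by (simp add: dist_real_def)
    from u lw dl have "\<forall>\<^sub>F n in sequentially. norm (I n - pi * k x) < r"
    proof eventually_elim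
      fix n assume a: "(k x + e) * T n + E n < pi * k x + r" "(k x - e) * T n > pi * k x - r" "\<bar>Re (w n) - x\<bar> < d / 2"
      show "norm (I n - pi * k x) < r"
        using up1[of n] lo1[of n] second[of n] second2[OF a(3)] split[of n] first[of n] a(1,2) unfolding real_norm_def by linarith
    qed
    then show "\<exists>no. \<forall>n\<ge>no. norm (I n - pi * k x) < r" by (simp add: eventually_sequentially)
  qed
  then have "(\<lambda>n. - I n) \<longlonglongrightarrow> - (pi * k x)" by (rule tendsto_minus)
  then show ?thesis unfolding Poisson_Im(2)[OF w(2)] by (simp add: I_def P_def k_def mult.assoc)
qed

text \<open>In the variable 1/s the point lies inside the inverted curve, in the lower half-plane;
  its conjugate falls under \<open>Im_quotient_neg\<close> for the exponent 1/th.\<close>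

lemma w_of_Im: 
  assumes "lam > 1" "0 < b0" "b0 < pi"
  shows "Im (w_of (of_real lam * \<xi> b0)) > 0"
proof -
  define s0 where "s0 = of_real lam * \<xi> b0"
  have ab: "\<bar>b0\<bar> \<le> pi" using assms by auto
  note f = lam_xi_facts[OF assms(1) ab s0_def]
  define t where "t = 1 / s0"
  have td: "t \<in> fc_dom (1 / th)" using f(3) by (simp only: t_def)
  have "Im s0 > 0" using A.Im_xi_pos[OF assms(2,3)] assms by (simp add: s0_def)
  then have imt: "Im t < 0" by (simp add: t_def Im_divide divide_less_0_iff sum_power2_gt_zero_iff)
  have "Im ((1 + cnj t) powr of_real (1 + 1 / th) / cnj t) < 0"
    by (rule S.Im_quotient_neg[OF S.cnj_in_fc_dom[OF td]]) (use imt in simp)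
  moreover have "cnj ((1 + t) powr of_real (1 + 1 / th)) = cnj (1 + t) powr cnj (of_real (1 + 1 / th))"
    by (rule cnj_powr) (use S.one_plus_fc_dom_nonpos[OF td] in \<open>auto simp: complex_nonpos_Reals_iff\<close>)
  ultimately have "Im (cnj ((1 + t) powr of_real (1 + 1 / th) / t)) < 0" by simp
  then have "Im ((1 + t) powr of_real (1 + 1 / th) / t) > 0" by (simp only: cnj.sel neg_less_0_iff_less)
  then have "Im (of_real c * ((1 + t) powr of_real (1 + 1 / th) / t)) > 0"
    using c_pos by (simp only: times_complex.sel Re_complex_of_real Im_complex_of_real) simp
  moreover have "w_of s0 = of_real c * ((1 + t) powr of_real (1 + 1 / th) / t)" by (simp add: w_of_def t_def)
  ultimately show ?thesis by (simp only: s0_def)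
qed

lemma w_of_tendsto:
  assumes b0: "0 < b0" "b0 < pi" and r: "r \<longlonglongrightarrow> 1"
  shows "(\<lambda>n. w_of (of_real (r n) * \<xi> b0)) \<longlonglongrightarrow> of_real (J b0)"
proof -
  have ab: "\<bar>b0\<bar> \<le> pi" "\<bar>- b0\<bar> < pi" "\<bar>- b0\<bar> \<le> pi" using b0 by auto
  have nz: "\<xi> b0 \<noteq> 0" using A.xi_nonzero ab by simp
  have np: "1 + 1 / \<xi> b0 \<notin> \<real>\<^sub>\<le>\<^sub>0" using S.one_plus_xi_nonpos[OF ab(2)] by (simp add: xi_S)
  have "w_of (\<xi> b0) = of_real c * ((1 + xi (1 / th) (- b0)) powr of_real (1 + 1 / th)) * \<xi> b0"
    by (simp add: w_of_def xi_S)
  also have "\<dots> = of_real c * (of_real (fc_quot (1 / th) (- b0)) * (1 / \<xi> b0)) * \<xi> b0"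
    unfolding S.powr_xi[OF ab(3)] by (simp only: xi_S)
  also have "\<dots> = of_real (J b0)" using nz c_pos fc_quot_S[OF ab(3)] by simp
  finally have v: "w_of (\<xi> b0) = of_real (J b0)" .
  have "isCont w_of (\<xi> b0)" unfolding w_of_def using nz np by (intro continuous_intros) auto
  moreover have "(\<lambda>n. of_real (r n) * \<xi> b0) \<longlonglongrightarrow> of_real 1 * \<xi> b0" by (intro tendsto_intros r)
  ultimately have "(\<lambda>n. w_of (of_real (r n) * \<xi> b0)) \<longlonglongrightarrow> w_of (\<xi> b0)"
    using isCont_tendsto_compose by fastforce
  then show ?thesis by (simp only: v)
qed

text \<open>At s = \<xi> b0 this is the logarithm in the density formula, since |cnj \<xi> - s| =
  |\<xi> - cnj s|.\<close>

definition log_ratio :: "real \<Rightarrow> complex \<Rightarrow> real" where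
  "log_ratio b s = ln (cmod (cnj (\<xi> b) - s)) - ln (cmod (\<xi> b - s))"

text \<open>Both points are in the closed upper half-plane, so reflecting one of them only increases
  the distance. The single possible singularity is at b = b0, controlled by
  \<open>xi_dist_lower\<close> uniformly in the dilation factor.\<close>

lemma log_ratio_bound: 
  obtains C where "C \<ge> 0" "\<And>lam b b0. 1 \<le> lam \<Longrightarrow> lam \<le> 2 \<Longrightarrow> 0 \<le> b \<Longrightarrow> b \<le> pi \<Longrightarrow> 0 < b0 \<Longrightarrow> b0 < pi \<Longrightarrow> b \<noteq> b0 \<Longrightarrow>
    \<bar>log_ratio b (of_real lam * \<xi> b0)\<bar> \<le> C + \<bar>ln \<bar>b - b0\<bar>\<bar>"
proof -
  obtain k where k: "k > 0" "\<And>r r' b b'. r \<ge> 1/2 \<Longrightarrow> r' \<ge> 1/2 \<Longrightarrow> 0 \<le> b \<Longrightarrow> b \<le> pi \<Longrightarrow> 0 \<le> b' \<Longrightarrow> b' \<le> pi \<Longrightarrow>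
    k * \<bar>b - b'\<bar> \<le> cmod (of_real r * \<xi> b - of_real r' * \<xi> b')" using A.xi_dist_lower by blast
  have "bounded (\<xi> ` {-pi..pi})" by (intro compact_imp_bounded compact_continuous_image A.continuous_on_xi) auto
  then obtain R where "R > 0" "\<forall>x\<in>\<xi> ` {-pi..pi}. norm x \<le> R" unfolding bounded_pos by blast
  then have R: "R > 0" "\<And>b. 0 \<le> b \<Longrightarrow> b \<le> pi \<Longrightarrow> cmod (\<xi> b) \<le> R" by auto
  show thesis
  proof (rule that[of "\<bar>ln (3 * R)\<bar> + \<bar>ln k\<bar>"])
    fix lam b b0 :: real
    assume a: "1 \<le> lam" "lam \<le> 2" "0 \<le> b" "b \<le> pi" "0 < b0" "b0 < pi" "b \<noteq> b0"
    define s where "s = of_real lam * \<xi> b0"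
    have lo: "k * \<bar>b - b0\<bar> \<le> cmod (\<xi> b - s)" using k(2)[of 1 lam b b0] a by (simp add: s_def)
    have p: "k * \<bar>b - b0\<bar> > 0" using k a by simp
    have Ims: "Im s > 0" using A.Im_xi_pos[OF a(5,6)] a by (simp add: s_def)
    have Imx: "Im (\<xi> b) \<ge> 0" using A.rho_pos[of b] a by (simp add: xi_def sin_ge_zero)
    have "(cmod (\<xi> b - s))\<^sup>2 \<le> (cmod (cnj (\<xi> b) - s))\<^sup>2"
    proof -
      have "(Im (\<xi> b) - Im s)\<^sup>2 \<le> (- Im (\<xi> b) - Im s)\<^sup>2"
        using Ims Imx by (simp add: power2_eq_square algebra_simps)
      then show ?thesis by (simp add: cmod_power2)
    qed
    then have le: "cmod (\<xi> b - s) \<le> cmod (cnj (\<xi> b) - s)" by (rule power2_le_imp_le) simp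
    have "cmod (cnj (\<xi> b) - s) \<le> cmod (cnj (\<xi> b)) + cmod s" by (rule norm_triangle_ineq4)
    also have "\<dots> \<le> R + 2 * R" using R(2)[of b] R(2)[of b0] R(1) a
      by (intro add_mono) (auto simp: s_def norm_mult intro!: mult_mono)
    finally have hi: "cmod (cnj (\<xi> b) - s) \<le> 3 * R" by simp
    have pos: "cmod (\<xi> b - s) > 0" "cmod (cnj (\<xi> b) - s) > 0" using lo p le by linarith+
    have "ln (cmod (\<xi> b - s)) \<le> ln (cmod (cnj (\<xi> b) - s))" using le pos by simp
    moreover have "ln (cmod (cnj (\<xi> b) - s)) \<le> ln (3 * R)" using hi pos R(1) by simp
    moreover have "ln k + ln \<bar>b - b0\<bar> \<le> ln (cmod (\<xi> b - s))"
    proof -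
      have "ln (k * \<bar>b - b0\<bar>) \<le> ln (cmod (\<xi> b - s))" using lo p pos by simp
      then show ?thesis using k a by (simp add: ln_mult)
    qed
    ultimately show "\<bar>log_ratio b (of_real lam * \<xi> b0)\<bar> \<le> \<bar>ln (3 * R)\<bar> + \<bar>ln k\<bar> + \<bar>ln \<bar>b - b0\<bar>\<bar>"
      unfolding log_ratio_def s_def[symmetric] by linarith
  qed simp
qed

lemma dDV_dJ_bounded: "\<exists>M>0. \<forall>b. 0 < \<bar>b\<bar> \<longrightarrow> \<bar>b\<bar> < pi \<longrightarrow> \<bar>dDV (J b) * J' b\<bar> \<le> M"
proof -
  obtain M where M: "M > 0" "\<And>b. 0 < \<bar>b\<bar> \<Longrightarrow> \<bar>b\<bar> < pi \<Longrightarrow> \<bar>J' b\<bar> \<le> M" using dJ_bounded by blast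
  have "bounded ((\<lambda>b. dDV (J b)) ` {-pi..pi})"
    by (intro compact_imp_bounded compact_continuous_image continuous_on_comp_J continuous_on_dDV) auto
  then obtain G where "G > 0" "\<forall>x\<in>(\<lambda>b. dDV (J b)) ` {-pi..pi}. norm x \<le> G" unfolding bounded_pos by blast
  then have G: "G > 0" "\<And>b. b \<in> {-pi..pi} \<Longrightarrow> \<bar>dDV (J b)\<bar> \<le> G" by auto
  have "\<bar>dDV (J b) * J' b\<bar> \<le> G * M" if "0 < \<bar>b\<bar>" "\<bar>b\<bar> < pi" for b
  proof -
    have "b \<in> {-pi..pi}" using that by auto
    from G(2)[OF this] show ?thesis unfolding abs_mult using M G(1) that by (intro mult_mono) auto
  qed
  then show ?thesis using M(1) G(1) by (intro exI[of _ "G * M"]) auto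
qed

lemma xi_neq: "0 < b \<Longrightarrow> b < pi \<Longrightarrow> 0 < b0 \<Longrightarrow> b0 < pi \<Longrightarrow> b \<noteq> b0 \<Longrightarrow> \<xi> b \<noteq> \<xi> b0"
  using A.Arg_of_real_mult_xi[of 1 b] A.Arg_of_real_mult_xi[of 1 b0] by auto

lemma xi_neq_cnj: "0 < b \<Longrightarrow> b < pi \<Longrightarrow> 0 < b0 \<Longrightarrow> b0 < pi \<Longrightarrow> cnj (\<xi> b) \<noteq> \<xi> b0"
  using A.Im_xi_pos[of b] A.Im_xi_pos[of b0] by (auto simp: complex_eq_iff)

text \<open>\<open>Im_N\<close> at points shrinking radially to the curve from outside: the integral
  passes to the limit by \<open>log_ratio_bound\<close>, and the Poisson limit supplies the
  density.\<close>

lemma density_formula: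
  assumes b0: "0 < b0" "b0 < pi"
  shows "((\<lambda>b. dDV (J b) * J' b * log_ratio b (\<xi> b0)) has_integral
     2 * pi * (- pi * J b0 * \<psi> (J b0) - edge_coeff * Im (1 / (\<xi> b0 - sg)))) {0..pi}"
proof -
  define r where "r = (\<lambda>n. 1 + inverse (real (Suc n)))"
  have rb: "1 < r n" "r n \<le> 2" for n by (auto simp: r_def field_simps)
  have rlim: "r \<longlonglongrightarrow> 1"
    using tendsto_add[OF tendsto_const[of 1] LIMSEQ_inverse_real_of_nat] by (simp add: r_def)
  have ab: "\<bar>b0\<bar> \<le> pi" using b0 by auto
  define s where "s = (\<lambda>n. of_real (r n) * \<xi> b0)"
  have slim: "s \<longlonglongrightarrow> \<xi> b0"
  proof -
    have "s \<longlonglongrightarrow> of_real 1 * \<xi> b0" unfolding s_def by (intro tendsto_intros rlim)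
    then show ?thesis by simp
  qed
  have wI: "Im (w_of (s n)) > 0" for n unfolding s_def by (rule w_of_Im[OF rb(1) b0])
  have wl: "(\<lambda>n. w_of (s n)) \<longlonglongrightarrow> of_real (J b0)" unfolding s_def by (rule w_of_tendsto[OF b0 rlim])
  define I where "I = (\<lambda>n. 2 * pi * (Im (\<integral>z. w_of (s n) / (w_of (s n) - of_real z) \<partial>mu) - edge_coeff * Im (1 / (s n - sg))))"
  have Jb: "0 < J b0" "J b0 < J 0" using J_pos[of b0] J_strict[of 0 b0] b0 by auto
  have nsg: "\<xi> b0 - sg \<noteq> 0" using A.Im_xi_pos[OF b0] by (auto simp: complex_eq_iff)
  have "I \<longlonglongrightarrow> 2 * pi * (- pi * J b0 * \<psi> (J b0) - edge_coeff * Im (1 / (\<xi> b0 - sg)))"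
    unfolding I_def by (intro tendsto_intros Poisson_limit[OF Jb wl wI] slim nsg)
  moreover
  define g where "g = (\<lambda>n b. dDV (J b) * J' b * log_ratio b (s n))"
  have gI: "(g n has_integral I n) {0..pi}" for n
    unfolding g_def I_def log_ratio_def
    by (rule Im_N[OF rb(1)[of n] ab _ Poisson_Im(1)[OF wI]]) (simp only: s_def)
  define N where "N = {0, pi, b0}"
  define S where "S = {0..pi} - N"
  have neg: "negligible N" by (simp add: N_def)
  have ns: "(u has_integral i) {0..pi} \<longleftrightarrow> (u has_integral i) S" for u :: "real \<Rightarrow> real" and i
    unfolding S_def by (rule has_integral_spike_set_eq; rule negligible_subset[OF neg]) auto
  obtain C where C: "C \<ge> 0" "\<And>lam b b0. 1 \<le> lam \<Longrightarrow> lam \<le> 2 \<Longrightarrow> 0 \<le> b \<Longrightarrow> b \<le> pi \<Longrightarrow> 0 < b0 \<Longrightarrow> b0 < pi \<Longrightarrow> b \<noteq> b0 \<Longrightarrow>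
    \<bar>log_ratio b (of_real lam * \<xi> b0)\<bar> \<le> C + \<bar>ln \<bar>b - b0\<bar>\<bar>" using log_ratio_bound by blast
  obtain M where M: "M > 0" "\<And>b. 0 < \<bar>b\<bar> \<Longrightarrow> \<bar>b\<bar> < pi \<Longrightarrow> \<bar>dDV (J b) * J' b\<bar> \<le> M" using dDV_dJ_bounded by blast
  have p1: "g n integrable_on S" for n using gI[of n] ns by blast
  have "(\<lambda>b. M * (C + \<bar>ln \<bar>b - b0\<bar>\<bar>)) integrable_on {0..pi}"
    by (intro integrable_on_mult_right integrable_add integrable_const_ivl ln_abs_integrable)
  then have p2: "(\<lambda>b. M * (C + \<bar>ln \<bar>b - b0\<bar>\<bar>)) integrable_on S" using ns by (auto simp: integrable_on_def)
  have p3: "norm (g n b) \<le> M * (C + \<bar>ln \<bar>b - b0\<bar>\<bar>)" if "b \<in> S" for n b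
  proof -
    have b: "0 < b" "b < pi" "b \<noteq> b0" using that by (auto simp: S_def N_def)
    have "norm (g n b) = \<bar>dDV (J b) * J' b\<bar> * \<bar>log_ratio b (s n)\<bar>" by (simp add: g_def abs_mult)
    also have "\<dots> \<le> M * (C + \<bar>ln \<bar>b - b0\<bar>\<bar>)"
      using M(2)[of b] C(2)[of "r n" b b0] b b0 rb[of n] M(1) by (intro mult_mono) (auto simp: s_def)
    finally show ?thesis .
  qed
  have p4: "(\<lambda>n. g n b) \<longlonglongrightarrow> dDV (J b) * J' b * log_ratio b (\<xi> b0)" if "b \<in> S" for b
  proof -
    have b: "0 < b" "b < pi" "b \<noteq> b0" using that by (auto simp: S_def N_def)
    have "\<xi> b - \<xi> b0 \<noteq> 0" using xi_neq[OF b(1,2) b0 b(3)] by simp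
    moreover have "cnj (\<xi> b) - \<xi> b0 \<noteq> 0" using xi_neq_cnj[OF b(1,2) b0] by simp
    ultimately show ?thesis unfolding g_def log_ratio_def by (intro tendsto_intros slim) auto
  qed
  note DC = dominated_convergence[OF p1 p2 p3 p4]
  have "integral S (g n) = I n" for n using gI[of n] ns by blast
  then have "I \<longlonglongrightarrow> integral S (\<lambda>b. dDV (J b) * J' b * log_ratio b (\<xi> b0))" using DC(2) by simp
  ultimately have "integral S (\<lambda>b. dDV (J b) * J' b * log_ratio b (\<xi> b0)) = 2 * pi * (- pi * J b0 * \<psi> (J b0) - edge_coeff * Im (1 / (\<xi> b0 - sg)))"
    using LIMSEQ_unique by blast
  then have "((\<lambda>b. dDV (J b) * J' b * log_ratio b (\<xi> b0)) has_integral
     2 * pi * (- pi * J b0 * \<psi> (J b0) - edge_coeff * Im (1 / (\<xi> b0 - sg)))) S" using integrable_integral[OF DC(1)] by simp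
  then show ?thesis by (simp only: ns)
qed

end


section \<open>Vanishing of the edge coefficient\<close>

context equil begin

text \<open>The integral in \<open>density_formula\<close> has a logarithmic majorant, and the
  integral of ln |b - b0| over [0, pi] is bounded below independently of b0 because x ln x >= -1.
  Any blow-up of the edge term must therefore be compensated by \<psi>.\<close>

lemma log_ratio_integral_bounded:
  "\<exists>Q. \<forall>b0. 0 < b0 \<longrightarrow> b0 < pi \<longrightarrow> \<bar>2 * pi * (- pi * J b0 * \<psi> (J b0) - edge_coeff * Im (1 / (\<xi> b0 - sg)))\<bar> \<le> Q"
proof -
  obtain C where C: "C \<ge> 0" "\<And>lam b b0. 1 \<le> lam \<Longrightarrow> lam \<le> 2 \<Longrightarrow> 0 \<le> b \<Longrightarrow> b \<le> pi \<Longrightarrow> 0 < b0 \<Longrightarrow> b0 < pi \<Longrightarrow> b \<noteq> b0 \<Longrightarrow>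
    \<bar>log_ratio b (of_real lam * \<xi> b0)\<bar> \<le> C + \<bar>ln \<bar>b - b0\<bar>\<bar>" using log_ratio_bound by blast
  obtain M where M: "M > 0" "\<And>b. 0 < \<bar>b\<bar> \<Longrightarrow> \<bar>b\<bar> < pi \<Longrightarrow> \<bar>dDV (J b) * J' b\<bar> \<le> M" using dDV_dJ_bounded by blast
  have xlnx: "x * ln x \<ge> - 1" if "x > 0" for x :: real
  proof -
    have "ln (1 / x) \<le> 1 / x - 1" using that by (intro ln_le_minus_one) simp
    then have "- ln x \<le> 1 / x - 1" using that by (simp add: ln_div)
    then have "x * (- ln x) \<le> x * (1 / x - 1)" using that by (intro mult_left_mono) auto
    then show ?thesis using that by (simp add: right_diff_distrib)
  qed
  have "\<bar>2 * pi * (- pi * J b0 * \<psi> (J b0) - edge_coeff * Im (1 / (\<xi> b0 - sg)))\<bar> \<le> M * ((C + 2 * pi) * pi + 2 + pi)"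
    if b0: "0 < b0" "b0 < pi" for b0
  proof -
    define I where "I = 2 * pi * (- pi * J b0 * \<psi> (J b0) - edge_coeff * Im (1 / (\<xi> b0 - sg)))"
    define L where "L = ((pi - b0) * ln \<bar>pi - b0\<bar> - (pi - b0)) - ((0 - b0) * ln \<bar>0 - b0\<bar> - (0 - b0))"
    have Lint: "((\<lambda>b. ln \<bar>b - b0\<bar>) has_integral L) {0..pi}" unfolding L_def by (rule ln_abs_has_integral) simp
    have Lge: "L \<ge> - 2 - pi"
    proof -
      have "L = (pi - b0) * ln (pi - b0) + b0 * ln b0 - pi" using b0 by (simp add: L_def algebra_simps)
      then show ?thesis using xlnx[of "pi - b0"] xlnx[of b0] b0 by linarith
    qed
    \<comment> \<open>For y = ln |b - b0| <= pi one has |y| <= 2 pi - y; this majorant is linear in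
      y and has an explicit integral.\<close>
    have "((\<lambda>b. (C + 2 * pi) - ln \<bar>b - b0\<bar>) has_integral (C + 2 * pi) * (pi - 0) - L) {0..pi}"
      using has_integral_diff[OF has_integral_const_real[of "C + 2 * pi" 0 pi] Lint] by (simp add: mult.commute)
    from has_integral_mult_right[OF this, of M]
    have B: "((\<lambda>b. M * ((C + 2 * pi) - ln \<bar>b - b0\<bar>)) has_integral M * ((C + 2 * pi) * (pi - 0) - L)) {0..pi}" .
    have neg: "negligible {0, pi, b0}" by simp
    have le: "\<bar>dDV (J b) * J' b * log_ratio b (\<xi> b0)\<bar> \<le> M * ((C + 2 * pi) - ln \<bar>b - b0\<bar>)" if "b \<in> {0..pi} - {0, pi, b0}" for b
    proof -
      have b: "0 < b" "b < pi" "b \<noteq> b0" using that by auto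
      have "ln \<bar>b - b0\<bar> \<le> \<bar>b - b0\<bar>" using ln_le_minus_one[of "\<bar>b - b0\<bar>"] b by simp
      then have "ln \<bar>b - b0\<bar> \<le> pi" using b b0 by (auto simp: abs_if split: if_splits)
      then have "C + \<bar>ln \<bar>b - b0\<bar>\<bar> \<le> (C + 2 * pi) - ln \<bar>b - b0\<bar>" using pi_gt_zero by linarith
      moreover have "\<bar>log_ratio b (\<xi> b0)\<bar> \<le> C + \<bar>ln \<bar>b - b0\<bar>\<bar>" using C(2)[of 1 b b0] b b0 by simp
      ultimately have "\<bar>log_ratio b (\<xi> b0)\<bar> \<le> (C + 2 * pi) - ln \<bar>b - b0\<bar>" by linarith
      then show ?thesis unfolding abs_mult[of "dDV (J b) * J' b"] using M(1) M(2)[of b] b by (intro mult_mono) auto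
    qed
    have D: "((\<lambda>b. dDV (J b) * J' b * log_ratio b (\<xi> b0)) has_integral I) {0..pi}" unfolding I_def by (rule density_formula[OF b0])
    have ns: "(u has_integral i) {0..pi} \<longleftrightarrow> (u has_integral i) ({0..pi} - {0, pi, b0})" for u :: "real \<Rightarrow> real" and i
      by (rule has_integral_spike_set_eq; rule negligible_subset[OF neg]) auto
    have D': "((\<lambda>b. dDV (J b) * J' b * log_ratio b (\<xi> b0)) has_integral I) ({0..pi} - {0, pi, b0})"
      using D by (simp only: ns)
    have B': "((\<lambda>b. M * ((C + 2 * pi) - ln \<bar>b - b0\<bar>)) has_integral M * ((C + 2 * pi) * (pi - 0) - L)) ({0..pi} - {0, pi, b0})"
      using B by (simp only: ns)
    have "I \<le> M * ((C + 2 * pi) * (pi - 0) - L)"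
      by (rule has_integral_le[OF D' B']) (use le in \<open>auto simp: abs_le_iff\<close>)
    moreover have "- I \<le> M * ((C + 2 * pi) * (pi - 0) - L)"
      by (rule has_integral_le[OF has_integral_neg[OF D'] B']) (use le in \<open>auto simp: abs_le_iff\<close>)
    ultimately have "\<bar>I\<bar> \<le> M * ((C + 2 * pi) * (pi - 0) - L)" by linarith
    also have "\<dots> \<le> M * ((C + 2 * pi) * pi + 2 + pi)" using Lge M(1) by (intro mult_left_mono) auto
    finally show ?thesis unfolding I_def .
  qed
  then show ?thesis by blast
qed

text \<open>Near b = 0 the displacement from 1/th has modulus at most M b and imaginary part at
  least m b/2, so the imaginary part of its inverse is below a negative multiple of 1/b.\<close>

lemma Im_inverse_unbounded:
  "\<exists>b1>0. b1 < pi \<and> (\<forall>b. 0 < b \<longrightarrow> b < b1 \<longrightarrow> Im (1 / (\<xi> b - sg)) < - K)"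
proof -
  obtain m where m: "m > 0" "\<And>b. \<bar>b\<bar> \<le> pi \<Longrightarrow> m \<le> rho th b" using A.rho_lower by blast
  obtain M where M: "M > 0" "\<And>b. 0 < \<bar>b\<bar> \<Longrightarrow> \<bar>b\<bar> \<le> pi \<Longrightarrow> cmod (\<xi>' b) \<le> M" using A.dxi_bounded by blast
  \<comment> \<open>The bound 1/2 ensures sin b >= b/2; the other makes m / (2 M^2 b) exceed |K| +
    1.\<close>
  define b1 where "b1 = min (1 / 2) (m / (2 * M\<^sup>2 * (\<bar>K\<bar> + 1)))"
  have "m / (2 * M\<^sup>2 * (\<bar>K\<bar> + 1)) > 0" using m(1) M(1) by (intro divide_pos_pos mult_pos_pos) auto
  then have b1: "b1 > 0" "b1 \<le> 1 / 2" by (auto simp: b1_def min_def)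
  moreover have "Im (1 / (\<xi> b - sg)) < - K" if b: "0 < b" "b < b1" for b
  proof -
    have b2: "b < 1 / 2" "b < pi" using b b1 pi_gt3 by linarith+
    have "(\<xi>' has_integral (\<xi> b - \<xi> 0)) {0..b}"
    proof (rule fundamental_theorem_of_calculus_interior)
      show "continuous_on {0..b} \<xi>" using b2 by (intro continuous_on_subset[OF A.continuous_on_xi]) auto
    qed (use b b2 in \<open>auto intro!: A.xi_has_derivative\<close>)
    then have "(\<xi>' has_integral (\<xi> b - \<xi> 0)) (cbox 0 b)" by simp
    then have "cmod (\<xi> b - \<xi> 0) \<le> M * measure lborel (cbox 0 b)"
      by (rule has_integral_bound_spike_finite[of _ "{0}", rotated 2]) (use M b b2 in auto)
    then have nx: "cmod (\<xi> b - sg) \<le> M * b" using b by simp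
    have sb: "sin b \<ge> b / 2"
    proof -
      have "\<bar>sin b - b\<bar> \<le> b\<^sup>2" by (rule abs_sin_minus_le)
      moreover have "b\<^sup>2 \<le> b / 2" using b b2 by (simp add: power2_eq_square)
      ultimately show ?thesis by linarith
    qed
    have Im1: "Im (\<xi> b - sg) \<ge> m * (b / 2)"
    proof -
      have "m * (b / 2) \<le> rho th b * sin b" using m(1) m(2)[of b] sb b b2 by (intro mult_mono) auto
      then show ?thesis by (simp add: xi_def)
    qed
    have pos: "m * (b / 2) > 0" using m b by simp
    have nz: "cmod (\<xi> b - sg) > 0" using Im1 pos by (metis abs_Im_le_cmod abs_ge_self less_le_trans order_trans)
    have "(cmod (\<xi> b - sg))\<^sup>2 \<le> (M * b)\<^sup>2" using nx by (intro power_mono) auto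
    then have "m * (b / 2) / (M * b)\<^sup>2 \<le> Im (\<xi> b - sg) / (cmod (\<xi> b - sg))\<^sup>2"
      using Im1 pos nz by (intro frac_le) auto
    moreover have "Im (1 / (\<xi> b - sg)) = - (Im (\<xi> b - sg) / (cmod (\<xi> b - sg))\<^sup>2)"
      by (simp add: Im_divide cmod_power2)
    moreover have "m * (b / 2) / (M * b)\<^sup>2 = m / (2 * M\<^sup>2) / b" using b by (simp add: power2_eq_square)
    moreover have "m / (2 * M\<^sup>2) / b > K"
    proof -
      have "b < m / (2 * M\<^sup>2 * (\<bar>K\<bar> + 1))" using b by (simp add: b1_def)
      moreover have "2 * M\<^sup>2 * (\<bar>K\<bar> + 1) > 0" using M(1) by (intro mult_pos_pos) auto
      ultimately have "b * (2 * M\<^sup>2 * (\<bar>K\<bar> + 1)) < m" by (simp only: pos_less_divide_eq)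
      then have "((\<bar>K\<bar> + 1) * b) * (2 * M\<^sup>2) < m" by (simp only: mult_ac)
      then have "(\<bar>K\<bar> + 1) * b < m / (2 * M\<^sup>2)" using M(1) by (subst pos_less_divide_eq) auto
      then have "\<bar>K\<bar> + 1 < m / (2 * M\<^sup>2) / b" using b by (subst pos_less_divide_eq) auto
      then show ?thesis by linarith
    qed
    ultimately show ?thesis by linarith
  qed
  ultimately show ?thesis using pi_gt3 by (intro exI[of _ b1]) auto
qed

text \<open>A density bounded below near the edge makes the logarithmic potential grow like e ln (1/e) to the right of it.\<close>
lemma soft_edge:
  assumes ineq: "\<And>x. x \<ge> 0 \<Longrightarrow> (\<integral>y. ln \<bar>x - y\<bar> \<partial>mu) + (\<integral>y. ln \<bar>x powr th - y powr th\<bar> \<partial>mu) - V x \<le> l"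
    and d: "d > 0" "d < J 0" and psi: "\<And>x. J 0 - d < x \<Longrightarrow> x < J 0 \<Longrightarrow> \<psi> x \<ge> 1"
  shows False
proof -
  interpret prob_space mu by (rule prob)
  define B where "B = J 0"
  have B: "B > 0" using d by (simp add: B_def)
  have "bounded (V' ` {B..B + 1})"
    using B by (intro compact_imp_bounded compact_continuous_image continuous_on_subset[OF continuous_on_V']) auto
  then obtain K where "K > 0" "\<forall>x\<in>V' ` {B..B + 1}. norm x \<le> K" unfolding bounded_pos by blast
  then have K: "K > 0" "\<And>x. x \<in> {B..B + 1} \<Longrightarrow> V' x \<le> K" by (auto simp: abs_le_iff)
  \<comment> \<open>The inequality at B + e minus the equality at B bounds the growth of the
    logarithmic potential by K e. Dividing by e gives a bound that fails as e tends to 0.\<close>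
  have main: "ln (d + e) - ln e \<le> K" if e: "0 < e" "e \<le> 1" for e
  proof -
    define X where "X = B + e"
    have X: "X > B" using e by (simp add: X_def)
    have BX: "B powr th < X powr th" using X B th_pos by (intro powr_less_mono2) auto
    have Xp: "X powr th > 0" using X B by simp
    have i1: "integrable mu (\<lambda>y. ln \<bar>X - y\<bar>)"
    proof (rule integrable_const_bound[where B="\<bar>ln X\<bar> + \<bar>ln e\<bar>"])
      show "AE y in mu. norm (ln \<bar>X - y\<bar>) \<le> \<bar>ln X\<bar> + \<bar>ln e\<bar>"
        using AE_mu
      proof eventually_elim
        fix y assume y: "0 < y \<and> y < J 0"
        then have "e \<le> X - y" "X - y \<le> X" by (auto simp: X_def B_def)
        then have "ln e \<le> ln \<bar>X - y\<bar>" "ln \<bar>X - y\<bar> \<le> ln X" using e by auto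
        then show "norm (ln \<bar>X - y\<bar>) \<le> \<bar>ln X\<bar> + \<bar>ln e\<bar>" unfolding real_norm_def by linarith
      qed
    qed simp
    have i2: "integrable mu (\<lambda>y. ln \<bar>X powr th - y powr th\<bar>)"
    proof (rule integrable_const_bound[where B="\<bar>ln (X powr th)\<bar> + \<bar>ln (X powr th - B powr th)\<bar>"])
      show "AE y in mu. norm (ln \<bar>X powr th - y powr th\<bar>) \<le> \<bar>ln (X powr th)\<bar> + \<bar>ln (X powr th - B powr th)\<bar>"
        using AE_mu
      proof eventually_elim
        fix y assume y: "0 < y \<and> y < J 0"
        then have "y powr th \<le> B powr th" "0 \<le> y powr th" using th_pos by (auto simp: B_def intro!: powr_mono2)
        then have "X powr th - B powr th \<le> X powr th - y powr th" "X powr th - y powr th \<le> X powr th" by auto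
        then have "ln (X powr th - B powr th) \<le> ln \<bar>X powr th - y powr th\<bar>" "ln \<bar>X powr th - y powr th\<bar> \<le> ln (X powr th)"
          using BX Xp by (auto simp del: ln_powr)
        then show "norm (ln \<bar>X powr th - y powr th\<bar>) \<le> \<bar>ln (X powr th)\<bar> + \<bar>ln (X powr th - B powr th)\<bar>"
          unfolding real_norm_def by linarith
      qed
    qed simp
    have BB: "B \<in> {0..J 0}" using B by (simp add: B_def)
    have VX: "V X - V B \<le> K * e"
    proof -
      have "\<exists>z. B < z \<and> z < X \<and> V X - V B = (X - B) * V' z"
        by (rule MVT2[OF X]) (use V_deriv B in auto)
      then obtain z where z: "B < z" "z < X" "V X - V B = (X - B) * V' z" by blast
      have "V' z \<le> K" using K(2)[of z] z e by (auto simp: X_def)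
      then have "e * V' z \<le> e * K" using e by (intro mult_left_mono) auto
      then show ?thesis using z by (simp add: X_def mult.commute)
    qed
    have "(\<integral>y. ln \<bar>X - y\<bar> - ln \<bar>B - y\<bar> \<partial>mu) + (\<integral>y. ln \<bar>X powr th - y powr th\<bar> - ln \<bar>B powr th - y powr th\<bar> \<partial>mu) \<le> V X - V B"
      using ineq[of X] EL[OF BB] i1 i2 X B by simp
    moreover have "0 \<le> (\<integral>y. ln \<bar>X powr th - y powr th\<bar> - ln \<bar>B powr th - y powr th\<bar> \<partial>mu)"
    proof (rule integral_nonneg_AE)
      show "AE y in mu. 0 \<le> ln \<bar>X powr th - y powr th\<bar> - ln \<bar>B powr th - y powr th\<bar>"
        using AE_mu
      proof eventually_elim
        fix y assume y: "0 < y \<and> y < J 0"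
        then have "y powr th < B powr th" using th_pos by (auto simp: B_def intro!: powr_less_mono2)
        then show "0 \<le> ln \<bar>X powr th - y powr th\<bar> - ln \<bar>B powr th - y powr th\<bar>" using BX by simp
      qed
    qed
    ultimately have up: "(\<integral>y. ln \<bar>X - y\<bar> - ln \<bar>B - y\<bar> \<partial>mu) \<le> K * e" using VX by linarith
    \<comment> \<open>By ln u <= u - 1 this is a lower bound for ln (X - y) - ln (B - y) near the
      edge. Unlike that difference it is bounded by 1, and its Lebesgue integral is e (ln (d+e) - ln
      e).\<close>
    define g where "g = (\<lambda>y. indicator {B - d..B} y *\<^sub>R (e / (X - y)))"
    have gc: "continuous_on {B - d..B} (\<lambda>y. e / (X - y))" using X by (intro continuous_intros) auto
    have gi: "integrable lborel g" unfolding g_def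
      using borel_integrable_compact[of "{B - d..B}" "\<lambda>y. e / (X - y)"] gc by simp
    have gm [measurable]: "g \<in> borel_measurable borel" using gi by simp
    have gb: "0 \<le> g y" "g y \<le> 1" for y using e X by (auto simp: g_def indicator_def X_def)
    have gmu: "integrable mu g"
      by (rule integrable_const_bound[where B=1]) (use gb in auto)
    have "(\<integral>y. g y \<partial>mu) \<le> (\<integral>y. ln \<bar>X - y\<bar> - ln \<bar>B - y\<bar> \<partial>mu)"
    proof (rule integral_mono_AE)
      show "AE y in mu. g y \<le> ln \<bar>X - y\<bar> - ln \<bar>B - y\<bar>"
        using AE_mu
      proof eventually_elim
        fix y assume y: "0 < y \<and> y < J 0"
        then have By: "B - y > 0" "X - y > 0" using X by (auto simp: B_def)
        have "ln ((B - y) / (X - y)) \<le> (B - y) / (X - y) - 1" using By by (intro ln_le_minus_one) auto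
        also have "\<dots> = - (e / (X - y))" using By by (simp add: X_def field_simps)
        finally have "e / (X - y) \<le> ln (X - y) - ln (B - y)" using By by (simp add: ln_div)
        moreover have "0 \<le> e / (X - y)" using e By by simp
        ultimately show "g y \<le> ln \<bar>X - y\<bar> - ln \<bar>B - y\<bar>" using By X by (auto simp: g_def indicator_def)
      qed
    qed (use gmu i1 EL(1)[OF BB] in auto)
    moreover have "(\<integral>y. g y \<partial>lborel) \<le> (\<integral>y. g y \<partial>mu)"
    proof -
      have dDV: "(\<integral>y. g y \<partial>mu) = (\<integral>y. (indicator {0<..<J 0} y * \<psi> y) *\<^sub>R g y \<partial>lborel)"
        unfolding mu_eq by (rule integral_density) (auto intro!: psi_nonneg AE_I2 split: split_indicator)
      have di: "integrable lborel (\<lambda>y. (indicator {0<..<J 0} y * \<psi> y) *\<^sub>R g y)"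
        using gmu unfolding mu_eq
        by (subst (asm) integrable_density) (auto intro!: psi_nonneg AE_I2 split: split_indicator)
      show ?thesis unfolding dDV
      proof (rule integral_mono_AE[OF gi di])
        have "AE y in lborel. y \<notin> {B - d, B}" using AE_lborel_singleton[of "B - d"] AE_lborel_singleton[of B] by eventually_elim simp
        then show "AE y in lborel. g y \<le> (indicator {0<..<J 0} y * \<psi> y) *\<^sub>R g y"
        proof eventually_elim
          fix y assume y: "y \<notin> {B - d, B}"
          show "g y \<le> (indicator {0<..<J 0} y * \<psi> y) *\<^sub>R g y"
          proof (cases "y \<in> {B - d..B}")
            case True
            then have "J 0 - d < y" "y < J 0" "0 < y" using y d by (auto simp: B_def)
            then show ?thesis using psi[of y] gb[of y] by (simp add: mult_le_cancel_right1)
          next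
            case False then show ?thesis by (simp add: g_def)
          qed
        qed
      qed
    qed
    moreover have "(\<integral>y. g y \<partial>lborel) = - e * ln (X - B) - (- e * ln (X - (B - d)))"
      unfolding g_def
    proof (rule integral_FTC_atLeastAtMost[OF _ _ gc])
      fix y assume y: "B - d \<le> y" "y \<le> B"
      have "((\<lambda>y. - e * ln (X - y)) has_real_derivative e / (X - y)) (at y)"
        using y X by (auto intro!: derivative_eq_intros)
      then show "((\<lambda>y. - e * ln (X - y)) has_vector_derivative e / (X - y)) (at y within {B - d..B})"
        by (simp add: has_real_derivative_iff_has_vector_derivative has_vector_derivative_at_within)
    qed (use d in simp)
    ultimately have "e * (ln (d + e) - ln e) \<le> e * K" using up by (simp add: X_def algebra_simps)
    then show ?thesis using e by simp
  qed
  \<comment> \<open>The exponential makes ln d - ln e at least K + 1; the cap 1 keeps B + e in the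
    interval where K bounds V'.\<close>
  define e where "e = min 1 (d * exp (- K - 1))"
  have e: "0 < e" "e \<le> 1" "e \<le> d * exp (- K - 1)" using d by (auto simp: e_def)
  have "ln e \<le> ln (d * exp (- K - 1))" using e d by (subst ln_le_cancel_iff) auto
  also have "\<dots> = ln d - K - 1" using d by (simp add: ln_mult)
  finally have "ln e \<le> ln d - K - 1" .
  moreover have "ln d \<le> ln (d + e)" using d e by simp
  ultimately show False using main[OF e(1,2)] by linarith
qed

lemma edge_coeff_zero:
  assumes ineq: "\<And>x. x \<ge> 0 \<Longrightarrow> (\<integral>y. ln \<bar>x - y\<bar> \<partial>mu) + (\<integral>y. ln \<bar>x powr th - y powr th\<bar> \<partial>mu) - V x \<le> l"
  shows "edge_coeff = 0"
proof (rule ccontr)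
  assume "edge_coeff \<noteq> 0"
  obtain Q where Q: "\<And>b0. 0 < b0 \<Longrightarrow> b0 < pi \<Longrightarrow> \<bar>2 * pi * (- pi * J b0 * \<psi> (J b0) - edge_coeff * Im (1 / (\<xi> b0 - sg)))\<bar> \<le> Q"
    using log_ratio_integral_bounded by blast
  have Q': "\<bar>pi * (J b * \<psi> (J b)) + edge_coeff * Im (1 / (\<xi> b - sg))\<bar> \<le> Q" if "0 < b" "b < pi" for b
  proof -
    define Y where "Y = pi * (J b * \<psi> (J b)) + edge_coeff * Im (1 / (\<xi> b - sg))"
    have "- pi * J b * \<psi> (J b) - edge_coeff * Im (1 / (\<xi> b - sg)) = - Y" by (simp add: Y_def mult.assoc)
    then have "\<bar>2 * pi * (- Y)\<bar> \<le> Q" using Q[OF that] by (simp only:)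
    then have "2 * pi * \<bar>Y\<bar> \<le> Q" by (simp add: abs_mult)
    moreover have "1 * \<bar>Y\<bar> \<le> 2 * pi * \<bar>Y\<bar>" using pi_gt3 by (intro mult_right_mono) auto
    ultimately have "\<bar>Y\<bar> \<le> Q" by linarith
    then show ?thesis by (simp only: Y_def)
  qed
  have J0: "J 0 > 0" using J_pos[of 0] by simp
  \<comment> \<open>Q absorbs the bounded integral; the surplus pi * \<open>J 0\<close> forces x
    \<psi>(x) > \<open>J 0\<close> and hence \<psi> > 1 when the coefficient is positive.\<close>
  define K where "K = (Q + pi * J 0) / \<bar>edge_coeff\<bar>"
  obtain b1 where b1: "0 < b1" "b1 < pi" "\<And>b. 0 < b \<Longrightarrow> b < b1 \<Longrightarrow> Im (1 / (\<xi> b - sg)) < - K"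
    using Im_inverse_unbounded[of K] by blast
  have big: "\<bar>edge_coeff\<bar> * (- Im (1 / (\<xi> b - sg))) > Q + pi * J 0" if "0 < b" "b < b1" for b
  proof -
    have "\<bar>edge_coeff\<bar> * K < \<bar>edge_coeff\<bar> * (- Im (1 / (\<xi> b - sg)))" using b1(3)[OF that] \<open>edge_coeff \<noteq> 0\<close> by (intro mult_strict_left_mono) auto
    then show ?thesis using \<open>edge_coeff \<noteq> 0\<close> by (simp add: K_def)
  qed
  show False
  proof (cases "edge_coeff < 0")
    case True
    define b where "b = b1 / 2"
    have b: "0 < b" "b < b1" "b < pi" using b1 by (auto simp: b_def)
    have "edge_coeff * Im (1 / (\<xi> b - sg)) > Q + pi * J 0" using big[OF b(1,2)] True by simp
    moreover have "pi * (J b * \<psi> (J b)) \<ge> 0"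
      using psi_nonneg[of "J b"] J_pos[of b] J_strict[of 0 b] b by simp
    moreover have "pi * J 0 > 0" using J0 by simp
    ultimately show False using Q'[OF b(1,3)] by linarith
  next
    case False
    then have CCp: "edge_coeff > 0" using \<open>edge_coeff \<noteq> 0\<close> by simp
    have ge: "\<psi> x \<ge> 1" if x: "J b1 < x" "x < J 0" for x
    proof -
      have x0: "0 < x" using x J_nonneg[of b1] by linarith
      obtain b where b: "0 < b" "b < pi" "J b = x" using J_surj[OF x0 x(2)] by blast
      have "b < b1" using J_strict[of b1 b] b b1 x by (cases "b < b1") (auto simp: not_less order_le_less)
      then have "edge_coeff * (- Im (1 / (\<xi> b - sg))) > Q + pi * J 0" using big[OF b(1)] CCp by simp
      then have "- (edge_coeff * Im (1 / (\<xi> b - sg))) > Q + pi * J 0" by (simp only: mult_minus_right)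
      then have "pi * (J b * \<psi> (J b)) > pi * J 0" using Q'[OF b(1,2)] by linarith
      then have "x * \<psi> x > J 0" using b by simp
      moreover have "x * \<psi> x \<le> J 0 * \<psi> x" using psi_nonneg[of x] x x0 by (intro mult_right_mono) auto
      ultimately have "J 0 * 1 < J 0 * \<psi> x" by simp
      then show ?thesis using J0 by simp
    qed
    have "J 0 - J b1 > 0" "J 0 - J b1 < J 0" using J_strict[of 0 b1] J_pos[of b1] b1 by auto
    then show False using soft_edge[OF ineq, of "J 0 - J b1"] ge by auto
  qed
qed

end


section \<open>Return to the variable x\<close>

lemma Ln_divide_eq:
  assumes "w \<noteq> 0" "z \<noteq> 0" "- pi < Im (Ln w) - Im (Ln z)" "Im (Ln w) - Im (Ln z) \<le> pi"
  shows "Ln (w / z) = Ln w - Ln z"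
  by (rule Ln_unique) (use assms in \<open>auto simp: exp_diff\<close>)

context fuss begin

text \<open>The principal logarithm of (1+s)/s splits because the arguments b/(1+th) and b differ by
  less than pi; then \<open>ln_fc_quot\<close> applies.\<close>

lemma Jc_xi: "0 < b \<Longrightarrow> b < pi \<Longrightarrow> Jc c th (\<xi> b) = of_real (J b)"
proof -
  assume b: "0 < b" "b < pi"
  have ab: "\<bar>b\<bar> < pi" "\<bar>b\<bar> \<le> pi" using b by auto
  have nz: "\<xi> b \<noteq> 0" "1 + \<xi> b \<noteq> 0" using A.xi_nonzero ab A.one_plus_xi_nonzero by auto
  define R where "R = cmod (1 + \<xi> b)"
  have R: "R > 0" using nz by (simp add: R_def)
  have r: "rho th b > 0" using A.rho_pos ab by simp
  have L1: "Ln (1 + \<xi> b) = Complex (ln R) (b / (1 + th))" using A.Ln_one_plus_xi[OF ab(1)] by (simp add: R_def)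
  have L2: "Ln (\<xi> b) = Complex (ln (rho th b)) b" by (rule A.Ln_xi[OF ab(1)])
  have "b / (1 + th) < b" using b th_pos by (simp add: field_simps)
  moreover have "b / (1 + th) > 0" using b th_pos by simp
  ultimately have L3: "Ln ((1 + \<xi> b) / \<xi> b) = Ln (1 + \<xi> b) - Ln (\<xi> b)"
    using b nz by (intro Ln_divide_eq) (auto simp: L1 L2)
  have "Jc c th (\<xi> b) = of_real c * ((1 + \<xi> b) * ((1 + \<xi> b) / \<xi> b) powr sg)" by (simp add: Jc_def add.commute)
  also have "(1 + \<xi> b) * ((1 + \<xi> b) / \<xi> b) powr sg = exp (Ln (1 + \<xi> b)) * exp (sg * (Ln (1 + \<xi> b) - Ln (\<xi> b)))"
    using nz by (simp add: powr_def L3)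
  also have "\<dots> = exp (Ln (1 + \<xi> b) + sg * (Ln (1 + \<xi> b) - Ln (\<xi> b)))" by (simp only: exp_add)
  also have "Ln (1 + \<xi> b) + sg * (Ln (1 + \<xi> b) - Ln (\<xi> b)) = sg * of_real (ln (fc_quot th b))"
    unfolding A.ln_fc_quot[OF ab(1)] using th_pos by (simp add: field_simps)
  also have "\<dots> = of_real ((1 / th) * ln (fc_quot th b))" by (simp only: of_real_mult)
  also have "exp (complex_of_real ((1 / th) * ln (fc_quot th b))) = of_real (fc_quot th b powr (1 / th))"
    using A.fc_quot_pos[OF ab(1)] unfolding exp_of_real by (simp add: powr_def)
  finally show ?thesis by (simp add: Jr_def)
qed

text \<open>With al = arg (1+s) < b = arg s, the argument of the value is u = al - (b - al)/th. For
  th >= 1 it stays in (- pi, pi), so a real value forces u = 0, that is al = b/(1+th), and the law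
  of sines puts s on the curve.\<close>

lemma Jc_upper_unique:
  assumes th1: "th \<ge> 1" and s: "Im s > 0" and x: "x > 0" "Jc c th s = of_real x"
  shows "\<exists>b. 0 < b \<and> b < pi \<and> s = \<xi> b"
proof -
  have nz: "s \<noteq> 0" "1 + s \<noteq> 0" using s by (auto simp: complex_eq_iff)
  define al where "al = Arg (1 + s)"
  define b where "b = Arg s"
  have al: "0 < al" "al < pi" using s Arg_lt_pi[of "1 + s"] by (auto simp: al_def)
  have b: "0 < b" "b < pi" using s Arg_lt_pi[of s] by (auto simp: b_def)
  have sal: "1 + s = of_real (cmod (1 + s)) * cis al" using Arg_eq[OF nz(2)] by (simp add: al_def cis_conv_exp)
  have sb: "s = of_real (cmod s) * cis b" using Arg_eq[OF nz(1)] by (simp add: b_def cis_conv_exp)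
  have L1: "Ln (1 + s) = Complex (ln (cmod (1 + s))) al" using nz by (simp add: al_def complex_eq_iff Arg_eq_Im_Ln)
  have L2: "Ln s = Complex (ln (cmod s)) b" using nz by (simp add: b_def complex_eq_iff Arg_eq_Im_Ln)
  have alb: "al < b"
  proof -
    have "Im ((1 + s) * cis (- b)) = - sin b"
    proof -
      have "(1 + s) * cis (- b) = cis (- b) + of_real (cmod s)" 
        by (subst sb) (simp add: distrib_right mult.assoc cis_mult)
      then show ?thesis by simp
    qed
    moreover have "Im ((1 + s) * cis (- b)) = cmod (1 + s) * sin (al - b)"
      by (subst sal) (simp only: mult.assoc cis_mult, simp)
    ultimately have "cmod (1 + s) * sin (al - b) < 0" using sin_gt_zero[OF b] by linarith
    then have "sin (al - b) < 0" using nz by (simp add: mult_less_0_iff)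
    then show ?thesis using sin_ge_zero[of "al - b"] al b by (smt (verit))
  qed
  have L3: "Ln ((1 + s) / s) = Ln (1 + s) - Ln s"
    using b al alb nz by (intro Ln_divide_eq) (auto simp: L1 L2)
  define u where "u = al + (1 / th) * (al - b)"
  have "Jc c th s = of_real c * ((1 + s) * ((1 + s) / s) powr sg)" by (simp add: Jc_def add.commute)
  also have "(1 + s) * ((1 + s) / s) powr sg = exp (Ln (1 + s)) * exp (sg * (Ln (1 + s) - Ln s))"
    using nz by (simp add: powr_def L3)
  also have "\<dots> = exp (Ln (1 + s) + sg * (Ln (1 + s) - Ln s))" by (simp only: exp_add)
  also have "Ln (1 + s) + sg * (Ln (1 + s) - Ln s) = Complex (ln (cmod (1 + s)) + (1 / th) * (ln (cmod (1 + s)) - ln (cmod s))) u"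
    by (simp add: L1 L2 complex_eq_iff u_def)
  finally have "Im (Jc c th s) = c * (exp (ln (cmod (1 + s)) + (1 / th) * (ln (cmod (1 + s)) - ln (cmod s))) * sin u)"
    by (simp add: Im_exp)
  then have su: "sin u = 0" using x c_pos by simp
  have "(1 / th) * (b - al) \<le> 1 * (b - al)" using th1 alb by (intro mult_right_mono) auto
  then have "u > - pi" using al b by (simp add: u_def right_diff_distrib)
  moreover have "(1 / th) * (al - b) < 0" using th1 alb by (simp add: divide_less_0_iff)
  then have "u < pi" using al by (simp add: u_def)
  ultimately have u0: "u = 0" using su sin_eq_0_pi by blast
  then have alP: "al = b / (1 + th)" using th_pos by (simp add: u_def field_simps)
  define P where "P = b / (1 + th)"
  define Q where "Q = th * b / (1 + th)"
  have bPQ: "b = P + Q" using th_pos by (simp add: P_def Q_def add_divide_distrib[symmetric]) (simp add: field_simps)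
  have sq: "sin Q > 0" using A.sin_q_pos[of b] b by (simp add: Q_def)
  have "Im ((1 + s) * cis (- P)) = cmod s * sin Q - sin P"
  proof -
    have "(1 + s) * cis (- P) = cis (- P) + of_real (cmod s) * cis Q"
      by (subst sb) (simp add: distrib_right mult.assoc cis_mult bPQ)
    then show ?thesis by simp
  qed
  moreover have "Im ((1 + s) * cis (- P)) = 0"
    by (subst sal) (simp only: mult.assoc cis_mult alP P_def, simp)
  ultimately have "cmod s = sin P / sin Q" using sq by (simp add: field_simps)
  then have "cmod s = rho th b" using b by (simp add: rho_def P_def Q_def)
  then have "s = \<xi> b" using sb by (simp add: xi_def)
  then show ?thesis using b by blast
qed

lemma J_inj: "0 \<le> u \<Longrightarrow> u \<le> pi \<Longrightarrow> 0 \<le> v \<Longrightarrow> v \<le> pi \<Longrightarrow> J u = J v \<Longrightarrow> u = v"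
  using J_strict[of u v] J_strict[of v u] by (cases u v rule: linorder_cases) auto

text \<open>The definite description also admits -1 and 1/th. Their values 0 and \<open>J 0\<close>
  are not taken at interior angles, so the preimage in the open half-plane is the only
  candidate.\<close>

lemma Iplus_J:
  assumes th1: "th \<ge> 1" and b: "0 < b" "b < pi"
  shows "Iplus c th (J b) = \<xi> b"
  unfolding Iplus_def
proof (rule the_equality)
  show "(0 < Im (\<xi> b) \<or> \<xi> b = - 1 \<or> \<xi> b = complex_of_real (1 / th)) \<and> Jc c th (\<xi> b) = complex_of_real (J b)"
    using A.Im_xi_pos[OF b] Jc_xi[OF b] by simp
  fix s assume s: "(0 < Im s \<or> s = - 1 \<or> s = complex_of_real (1 / th)) \<and> Jc c th s = complex_of_real (J b)"
  have Jb: "J b > 0" "J b < J 0" using J_pos[of b] J_strict[of 0 b] b by auto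
  have "Jc c th (- 1) = 0" by (simp add: Jc_def)
  then have "s \<noteq> - 1" using s Jb by fastforce
  moreover have "s \<noteq> complex_of_real (1 / th)"
  proof
    assume s1: "s = complex_of_real (1 / th)"
    have "Jc c th s = of_real (c * (1 / th + 1)) * (of_real ((1 / th + 1) / (1 / th)) powr complex_of_real (1 / th))"
      by (simp add: Jc_def s1)
    also have "of_real ((1 / th + 1) / (1 / th)) powr complex_of_real (1 / th) = of_real (((1 / th + 1) / (1 / th)) powr (1 / th))"
      using th_pos by (intro powr_of_real) auto
    also have "(1 / th + 1) / (1 / th) = 1 + th" using th_pos by (simp add: field_simps)
    finally have "Jc c th s = of_real (c * (1 / th + 1) * (1 + th) powr (1 / th))" by simp
    also have "c * (1 / th + 1) * (1 + th) powr (1 / th) = J 0"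
    proof -
      have "(1 + th) powr (1 + 1 / th) = (1 + th) * (1 + th) powr (1 / th)" using th_pos by (simp add: powr_add)
      then show ?thesis unfolding J_0 using th_pos by (simp add: field_simps)
    qed
    finally have "complex_of_real (J 0) = of_real (J b)" using s by simp
    then show False using Jb by simp
  qed
  ultimately have "0 < Im s" using s by blast
  then obtain b' where b': "0 < b'" "b' < pi" "s = \<xi> b'"
    using Jc_upper_unique[OF th1 _ Jb(1)] s by blast
  have "complex_of_real (J b') = of_real (J b)" using Jc_xi[OF b'(1,2)] s b'(3) by simp
  then have "J b' = J b" by simp
  then show "s = \<xi> b" using J_inj[of b' b] b b' by simp
qed

section \<open>The inverse of J on the upper arc and substitution\<close>

definition Jinv :: "real \<Rightarrow> real" where "Jinv = the_inv_into {0..pi} J"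

lemma Jinv_J: "0 \<le> b \<Longrightarrow> b \<le> pi \<Longrightarrow> Jinv (J b) = b"
  unfolding Jinv_def by (rule the_inv_into_f_f) (auto simp: inj_on_def intro: J_inj)

lemma J_image: "J ` {0..pi} = {0..J 0}"
proof
  show "J ` {0..pi} \<subseteq> {0..J 0}" using J_range by (auto simp: abs_le_iff)
  show "{0..J 0} \<subseteq> J ` {0..pi}"
  proof
    fix y assume y: "y \<in> {0..J 0}"
    have "\<exists>b\<ge>0. b \<le> pi \<and> J b = y"
      by (rule IVT2') (use y continuous_on_subset[OF continuous_on_J] in auto)
    then show "y \<in> J ` {0..pi}" by auto
  qed
qed

lemma J_Jinv: assumes "0 \<le> y" "y \<le> J 0" shows "J (Jinv y) = y" "0 \<le> Jinv y" "Jinv y \<le> pi"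
proof -
  have "y \<in> J ` {0..pi}" using assms J_image by simp
  then obtain b where "0 \<le> b" "b \<le> pi" "y = J b" by auto
  then show "J (Jinv y) = y" "0 \<le> Jinv y" "Jinv y \<le> pi" using Jinv_J[of b] by auto
qed

lemma Jinv_ends [simp]: "Jinv 0 = pi" "Jinv (J 0) = 0"
  using Jinv_J[of pi] Jinv_J[of 0] by auto

lemma Jinv_interior: assumes "0 < y" "y < J 0" shows "0 < Jinv y" "Jinv y < pi"
proof -
  have "J (Jinv y) = y" "0 \<le> Jinv y" "Jinv y \<le> pi" using J_Jinv[of y] assms by auto
  then show "0 < Jinv y" "Jinv y < pi" using assms by (auto simp: order_le_less)
qed

lemma continuous_on_Jinv: "continuous_on {0..J 0} Jinv"
  unfolding J_image[symmetric]
  by (rule continuous_on_inv) (use continuous_on_subset[OF continuous_on_J, of "{0..pi}"] Jinv_J in auto)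

lemma Jinv_deriv: assumes "0 < y" "y < J 0" shows "(Jinv has_real_derivative 1 / J' (Jinv y)) (at y)"
proof -
  note i = Jinv_interior[OF assms]
  have "(Jinv has_real_derivative inverse (J' (Jinv y))) (at y)"
  proof (rule DERIV_inverse_function[where f=J and a=0 and b="J 0"])
    show "(J has_real_derivative J' (Jinv y)) (at (Jinv y))" using i by (intro J_has_derivative) auto
    show "J' (Jinv y) \<noteq> 0" using dJ_nonzero[OF i] .
    show "isCont Jinv y" using continuous_on_interior[OF continuous_on_Jinv, of y] assms by (simp add: interior_atLeastAtMost_real)
  qed (use assms J_Jinv in auto)
  then show ?thesis by (simp add: inverse_eq_divide)
qed

lemma primitive_deriv:
  fixes g :: "real \<Rightarrow> 'a::banach"
  assumes "g integrable_on {0..pi}" "finite N" "continuous_on ({0<..<pi} - N) g" "0 < b" "b < pi" "b \<notin> N"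
  shows "((\<lambda>u. integral {0..u} g) has_vector_derivative g b) (at b)"
proof -
  define S where "S = N \<union> {0, pi}"
  have eq: "{0..pi} - S = {0<..<pi} - N" by (auto simp: S_def)
  have op: "open ({0<..<pi} - N)" using assms(2) by (intro open_Diff) (auto intro: finite_imp_closed)
  have bin: "b \<in> {0<..<pi} - N" using assms by auto
  have "((\<lambda>u. integral {0..u} g) has_vector_derivative g b) (at b within ({0..pi} - S))"
  proof (rule integral_has_vector_derivative_continuous_at[OF assms(1)])
    show "b \<in> {0..pi} - S" "finite S" using bin assms(2) eq by (auto simp: S_def)
    show "continuous (at b within {0..pi} - S) g"
      unfolding eq using assms(3) bin by (simp add: continuous_on_eq_continuous_within)
  qed
  then show ?thesis unfolding eq using at_within_open[OF bin op] by simp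
qed

text \<open>J decreases on [0, pi], whence the minus sign. The integrand may be unbounded near
  points of \<open>N\<close>, so the substitution is done through the indefinite integral, which is
  continuous, and not by a theorem for continuous integrands.\<close>

lemma change_of_variables:
  fixes g :: "real \<Rightarrow> real"
  assumes g: "(g has_integral I) {0..pi}" "finite N" "continuous_on ({0<..<pi} - N) g"
  shows "((\<lambda>y. g (Jinv y) / J' (Jinv y)) has_integral - I) {0..J 0}"
proof -
  define G where "G = (\<lambda>b. integral {0..b} g)"
  have gi: "g integrable_on {0..pi}" using g by blast
  have J0: "J 0 > 0" using J_pos[of 0] by simp
  have "((\<lambda>y. g (Jinv y) / J' (Jinv y)) has_integral (G \<circ> Jinv) (J 0) - (G \<circ> Jinv) 0) {0..J 0}"
  proof (rule fundamental_theorem_of_calculus_interior_strong[of "J ` N"])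
    show "finite (J ` N)" using g by simp
    fix y assume y: "y \<in> {0<..<J 0} - J ` N"
    have i: "0 < Jinv y" "Jinv y < pi" using Jinv_interior[of y] y by auto
    have "Jinv y \<notin> N" using y J_Jinv(1)[of y] by (metis DiffE greaterThanLessThan_iff image_eqI less_imp_le)
    then have d: "(G has_vector_derivative g (Jinv y)) (at (Jinv y))"
      unfolding G_def using primitive_deriv[OF gi g(2,3) i] by simp
    have "(Jinv has_vector_derivative 1 / J' (Jinv y)) (at y)"
      using Jinv_deriv[of y] y by (simp add: has_real_derivative_iff_has_vector_derivative)
    from vector_diff_chain_at[OF this d]
    show "(G \<circ> Jinv has_vector_derivative g (Jinv y) / J' (Jinv y)) (at y)" by simp
  next
    have "continuous_on {0..pi} G" unfolding G_def by (rule indefinite_integral_continuous_1[OF gi])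
    then show "continuous_on {0..J 0} (G \<circ> Jinv)"
      using J_Jinv by (intro continuous_on_compose continuous_on_Jinv) (auto intro: continuous_on_subset)
  qed (use J0 in auto)
  moreover have "(G \<circ> Jinv) (J 0) - (G \<circ> Jinv) 0 = - I" using g(1) by (simp add: G_def integral_unique)
  ultimately show ?thesis by simp
qed

end

context equil begin

text \<open>With the edge term gone, substituting y = J b in \<open>density_formula\<close> cancels
  the factor J' and reverses the sign.\<close>

lemma density_integral:
  assumes th1: "th \<ge> 1" and C0: "edge_coeff = 0" and x: "0 < x" "x < J 0"
  shows "((\<lambda>y. (V'' y * y + V' y) *
     ln (cmod ((Iplus c th y - Iminus c th x) / (Iplus c th y - Iplus c th x)))) has_integral 2 * pi\<^sup>2 * x * \<psi> x) {0..J 0}"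
proof -
  define b0 where "b0 = Jinv x"
  have b0: "0 < b0" "b0 < pi" using Jinv_interior[OF x] by (auto simp: b0_def)
  have Jb0: "J b0 = x" using J_Jinv[of x] x by (simp add: b0_def)
  define g where "g = (\<lambda>b. dDV (J b) * J' b * log_ratio b (\<xi> b0))"
  have gI: "(g has_integral - (2 * pi\<^sup>2 * x * \<psi> x)) {0..pi}"
    using density_formula[OF b0] unfolding C0 g_def Jb0 by (simp add: power2_eq_square mult.assoc)
  have "continuous_on ({0<..<pi} - {b0}) g"
    unfolding g_def log_ratio_def
  proof (intro continuous_intros)
    show "continuous_on ({0<..<pi} - {b0}) (\<lambda>b. dDV (J b))"
      by (rule continuous_on_subset[OF continuous_on_comp_J[OF continuous_on_dDV]]) auto
    show "continuous_on ({0<..<pi} - {b0}) J'"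
      by (rule continuous_on_subset[OF continuous_on_dJ]) auto
    show "continuous_on ({0<..<pi} - {b0}) \<xi>" "continuous_on ({0<..<pi} - {b0}) \<xi>"
      by (rule continuous_on_subset[OF A.continuous_on_xi]; auto)+
  qed (use xi_neq xi_neq_cnj b0 in auto)
  from change_of_variables[OF gI _ this]
  have CV: "((\<lambda>y. g (Jinv y) / J' (Jinv y)) has_integral 2 * pi\<^sup>2 * x * \<psi> x) {0..J 0}" by simp
  have Ix: "Iplus c th x = \<xi> b0" using Iplus_J[OF th1 b0] Jb0 by simp
  show ?thesis
  proof (rule has_integral_spike_finite[OF _ _ CV, of "{0, x, J 0}"])
    fix y assume "y \<in> {0..J 0} - {0, x, J 0}"
    then have y: "0 < y" "y < J 0" "y \<noteq> x" by auto
    define b where "b = Jinv y"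
    have b: "0 < b" "b < pi" using Jinv_interior[OF y(1,2)] by (auto simp: b_def)
    have Jb: "J b = y" using J_Jinv[of y] y by (simp add: b_def)
    have bb: "b \<noteq> b0" using Jb Jb0 y(3) by auto
    have Iy: "Iplus c th y = \<xi> b" using Iplus_J[OF th1 b] Jb by simp
    have n1: "\<xi> b - \<xi> b0 \<noteq> 0" using xi_neq[OF b b0 bb] by simp
    have n2: "cnj (\<xi> b) - \<xi> b0 \<noteq> 0" using xi_neq_cnj[OF b b0] by simp
    have e: "cmod (\<xi> b - cnj (\<xi> b0)) = cmod (cnj (\<xi> b) - \<xi> b0)"
      by (metis complex_cnj_cnj complex_cnj_diff complex_mod_cnj)
    have "ln (cmod ((Iplus c th y - Iminus c th x) / (Iplus c th y - Iplus c th x))) = log_ratio b (\<xi> b0)"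
      unfolding Iminus_def Ix Iy log_ratio_def norm_divide e using n1 n2 by (simp add: ln_div)
    moreover have "g b / J' b = dDV y * log_ratio b (\<xi> b0)" using dJ_nonzero[OF b] by (simp add: g_def Jb)
    ultimately show "(V'' y * y + V' y) * ln (cmod ((Iplus c th y - Iminus c th x) / (Iplus c th y - Iplus c th x)))
       = g (Jinv y) / J' (Jinv y)" by (simp add: b_def dDV_def)
  qed auto
qed

lemma Jc_cnj_xi: "0 < b \<Longrightarrow> b < pi \<Longrightarrow> Jc c th (cnj (\<xi> b)) = of_real (J b)"
proof -
  assume b: "0 < b" "b < pi"
  have nz: "\<xi> b \<noteq> 0" using A.xi_nonzero[of b] b by simp
  have im: "Im ((\<xi> b + 1) / \<xi> b) \<noteq> 0"
  proof -
    have "(\<xi> b + 1) / \<xi> b = 1 + 1 / \<xi> b" using nz by (simp add: add_divide_distrib)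
    moreover have "Im (1 / \<xi> b) \<noteq> 0" using A.Im_xi_pos[OF b] nz by (simp add: Im_divide complex_eq_iff sum_power2_eq_zero_iff)
    ultimately show ?thesis by simp
  qed
  have "cnj (((\<xi> b + 1) / \<xi> b) powr sg) = cnj ((\<xi> b + 1) / \<xi> b) powr cnj sg"
    by (rule cnj_powr) (use im in auto)
  then have "Jc c th (cnj (\<xi> b)) = cnj (Jc c th (\<xi> b))" by (simp add: Jc_def)
  then show ?thesis using Jc_xi[OF b] by simp
qed

text \<open>\<open>gamma_path\<close> is parametrised by the value of J, and its velocity, a
  multiple of \<xi>'/J', is unbounded at the ends of the arcs. The integral is therefore evaluated
  from its definition, on each half by the fundamental theorem with the indefinite integral
  \<open>H\<close> composed with the inverse of J.\<close>

lemma contour_condition: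
  assumes th1: "th \<ge> 1" and Jm: "Jmax c th = J 0"
  shows "((\<lambda>s. complex_of_real (V' (Re (Jc c th s))) * Jc c th s / s) has_contour_integral (\<i> * of_real DV_total)) (gamma_path c th)"
proof -
  define g where "g = (\<lambda>b. of_real (DV (J b)) * (\<xi>' b / \<xi> b))"
  define H where "H = (\<lambda>b. integral {0..b} g)"
  have gI: "(g has_integral (\<i> * of_real DV_total)) {-pi..pi}" unfolding g_def by (rule has_integral_m_xi)
  then have gi: "g integrable_on {0..pi}" "g integrable_on {-pi..0}"
    by (auto intro: integrable_on_subinterval[OF has_integral_integrable])
  have gc: "continuous_on ({0<..<pi} - {}) g"
    unfolding g_def
  proof (intro continuous_intros continuous_on_of_real)
    show "continuous_on ({0<..<pi} - {}) (\<lambda>b. DV (J b))"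
      by (rule continuous_on_subset[OF continuous_on_comp_J[OF continuous_on_DV]]) auto
    show "continuous_on ({0<..<pi} - {}) \<xi>'" by (rule continuous_on_subset[OF A.continuous_on_dxi]) auto
    show "continuous_on ({0<..<pi} - {}) \<xi>" by (rule continuous_on_subset[OF A.continuous_on_xi]) auto
  qed (use A.xi_nonzero in auto)
  have Hd: "(H has_vector_derivative g b) (at b)" if "0 < b" "b < pi" for b
    unfolding H_def using primitive_deriv[OF gi(1) _ gc that] by simp
  have Hc: "continuous_on {0..pi} H" unfolding H_def by (rule indefinite_integral_continuous_1[OF gi(1)])
  have J0: "J 0 > 0" using J_pos[of 0] by simp
  \<comment> \<open>The lower arc contributes minus the conjugate of the upper one, by the
    reflection b -> - b.\<close>
  have total: "H pi - cnj (H pi) = \<i> * of_real DV_total"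
  proof -
    have "((\<lambda>b. g (- b)) has_integral integral {-pi..0} g) {- 0..- (- pi)}"
      using integrable_integral[OF gi(2)] by (subst has_integral_reflect_real) auto
    then have r: "((\<lambda>b. g (- b)) has_integral integral {-pi..0} g) {0..pi}" by simp
    have gm: "g (- b) = - cnj (g b)" for b by (simp add: g_def A.dxi_minus A.xi_minus)
    have "((\<lambda>b. - cnj (g b)) has_integral - cnj (H pi)) {0..pi}"
      unfolding H_def
      using has_integral_neg[OF has_integral_linear[OF integrable_integral[OF gi(1)] bounded_linear_cnj]] by (simp only: o_def)
    then have "integral {-pi..0} g = - cnj (H pi)" using r unfolding gm using has_integral_unique by blast
    moreover have "integral {-pi..0} g + H pi = \<i> * of_real DV_total"
      unfolding H_def using Henstock_Kurzweil_Integration.integral_combine[of "- pi" 0 pi g] gI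
      by (simp add: has_integral_iff)
    ultimately show ?thesis by simp
  qed
  define F where "F = (\<lambda>s. complex_of_real (V' (Re (Jc c th s))) * Jc c th s / s)"
  define be1 where "be1 = (\<lambda>t. Jinv (J 0 * (1 - 2 * t)))"
  define be2 where "be2 = (\<lambda>t. Jinv (J 0 * (2 * t - 1)))"
  have I1: "((\<lambda>t. F (gamma_path c th t) * vector_derivative (gamma_path c th) (at t)) has_integral (H \<circ> be1) (1/2) - (H \<circ> be1) 0) {0..1/2}"
  proof (rule fundamental_theorem_of_calculus_interior)
    have "continuous_on {0..1/2} be1" unfolding be1_def
      using J0 by (intro continuous_on_compose2[OF continuous_on_Jinv] continuous_intros) (auto simp: mult_le_cancel_left1)
    moreover have "be1 ` {0..1/2} \<subseteq> {0..pi}" using J_Jinv J0 by (auto simp: be1_def mult_le_cancel_left1)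
    ultimately show "continuous_on {0..1/2} (H \<circ> be1)" by (intro continuous_on_compose continuous_on_subset[OF Hc])
    fix t :: real assume t: "t \<in> {0<..<1/2}"
    define b where "b = be1 t"
    have y: "0 < J 0 * (1 - 2 * t')" "J 0 * (1 - 2 * t') < J 0" if "t' \<in> {0<..<1/2}" for t'
      using that J0 by (auto simp: mult_less_cancel_left2)
    have b: "0 < b" "b < pi" using Jinv_interior[OF y[OF t]] by (auto simp: b_def be1_def)
    have ge: "gamma_path c th t' = \<xi> (be1 t')" if "t' \<in> {0<..<1/2}" for t'
    proof -
      note i = Jinv_interior[OF y[OF that]]
      have "J (be1 t') = J 0 * (1 - 2 * t')" unfolding be1_def using y[OF that] by (intro J_Jinv(1) less_imp_le)
      then show ?thesis using Iplus_J[OF th1, of "be1 t'"] i that by (simp add: gamma_path_def Jm be1_def)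
    qed
    have db: "(be1 has_vector_derivative (- 2 * J 0) * (1 / J' b)) (at t)"
    proof -
      have "((\<lambda>t. J 0 * (1 - 2 * t)) has_real_derivative - 2 * J 0) (at t)" by (auto intro!: derivative_eq_intros)
      from DERIV_chain2[OF Jinv_deriv[OF y[OF t]] this]
      show ?thesis unfolding be1_def b_def by (simp add: has_real_derivative_iff_has_vector_derivative mult.commute)
    qed
    have "((\<xi> \<circ> be1) has_vector_derivative ((- 2 * J 0) * (1 / J' b)) *\<^sub>R \<xi>' b) (at t)"
      by (rule vector_diff_chain_at[OF db]) (use A.xi_has_derivative[of b] b in \<open>simp add: b_def\<close>)
    then have "(gamma_path c th has_vector_derivative ((- 2 * J 0) * (1 / J' b)) *\<^sub>R \<xi>' b) (at t)"
      by (rule has_vector_derivative_transform_within_open[where S="{0<..<1/2}"]) (use t ge in auto)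
    then have vd: "vector_derivative (gamma_path c th) (at t) = ((- 2 * J 0) * (1 / J' b)) *\<^sub>R \<xi>' b"
      by (rule vector_derivative_at)
    have "gamma_path c th t = \<xi> b" using ge[OF t] by (simp add: b_def)
    then have Fg: "F (gamma_path c th t) = of_real (DV (J b)) / \<xi> b"
      by (simp add: F_def Jc_xi[OF b] DV_def mult.commute)
    have "((H \<circ> be1) has_vector_derivative ((- 2 * J 0) * (1 / J' b)) *\<^sub>R g b) (at t)"
      by (rule vector_diff_chain_at[OF db]) (use Hd[OF b] in \<open>simp add: b_def\<close>)
    then show "((H \<circ> be1) has_vector_derivative F (gamma_path c th t) * vector_derivative (gamma_path c th) (at t)) (at t)"
      unfolding vd Fg g_def by (simp add: scaleR_conv_of_real mult_ac)
  qed simp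
  have I2: "((\<lambda>t. F (gamma_path c th t) * vector_derivative (gamma_path c th) (at t)) has_integral (cnj \<circ> (H \<circ> be2)) 1 - (cnj \<circ> (H \<circ> be2)) (1/2)) {1/2..1}"
  proof (rule fundamental_theorem_of_calculus_interior)
    have "continuous_on {1/2..1} be2" unfolding be2_def
      using J0 by (intro continuous_on_compose2[OF continuous_on_Jinv] continuous_intros) (auto simp: mult_le_cancel_left2)
    moreover have "be2 ` {1/2..1} \<subseteq> {0..pi}" using J_Jinv J0 by (auto simp: be2_def mult_le_cancel_left2)
    ultimately have "continuous_on {1/2..1} (H \<circ> be2)" by (intro continuous_on_compose continuous_on_subset[OF Hc])
    then show "continuous_on {1/2..1} (cnj \<circ> (H \<circ> be2))" unfolding o_def by (intro continuous_intros)
    fix t :: real assume t: "t \<in> {1/2<..<1}"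
    define b where "b = be2 t"
    have y: "0 < J 0 * (2 * t' - 1)" "J 0 * (2 * t' - 1) < J 0" if "t' \<in> {1/2<..<1}" for t'
      using that J0 by (auto simp: mult_less_cancel_left2)
    have b: "0 < b" "b < pi" using Jinv_interior[OF y[OF t]] by (auto simp: b_def be2_def)
    have ge: "gamma_path c th t' = cnj (\<xi> (be2 t'))" if "t' \<in> {1/2<..<1}" for t'
    proof -
      note i = Jinv_interior[OF y[OF that]]
      have "J (be2 t') = J 0 * (2 * t' - 1)" unfolding be2_def using y[OF that] by (intro J_Jinv(1) less_imp_le)
      then show ?thesis using Iplus_J[OF th1, of "be2 t'"] i that by (simp add: gamma_path_def Iminus_def Jm be2_def)
    qed
    have db: "(be2 has_vector_derivative (2 * J 0) * (1 / J' b)) (at t)"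
    proof -
      have "((\<lambda>t. J 0 * (2 * t - 1)) has_real_derivative 2 * J 0) (at t)" by (auto intro!: derivative_eq_intros)
      from DERIV_chain2[OF Jinv_deriv[OF y[OF t]] this]
      show ?thesis unfolding be2_def b_def by (simp add: has_real_derivative_iff_has_vector_derivative mult.commute)
    qed
    have "((\<xi> \<circ> be2) has_vector_derivative ((2 * J 0) * (1 / J' b)) *\<^sub>R \<xi>' b) (at t)"
      by (rule vector_diff_chain_at[OF db]) (use A.xi_has_derivative[of b] b in \<open>simp add: b_def\<close>)
    from bounded_linear.has_vector_derivative[OF bounded_linear_cnj this]
    have "((\<lambda>t. cnj (\<xi> (be2 t))) has_vector_derivative ((2 * J 0) * (1 / J' b)) *\<^sub>R cnj (\<xi>' b)) (at t)" by simp
    then have "(gamma_path c th has_vector_derivative ((2 * J 0) * (1 / J' b)) *\<^sub>R cnj (\<xi>' b)) (at t)"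
      by (rule has_vector_derivative_transform_within_open[where S="{1/2<..<1}"]) (use t ge in auto)
    then have vd: "vector_derivative (gamma_path c th) (at t) = ((2 * J 0) * (1 / J' b)) *\<^sub>R cnj (\<xi>' b)"
      by (rule vector_derivative_at)
    have "gamma_path c th t = cnj (\<xi> b)" using ge[OF t] by (simp add: b_def)
    then have Fg: "F (gamma_path c th t) = of_real (DV (J b)) / cnj (\<xi> b)"
      by (simp add: F_def Jc_cnj_xi[OF b] DV_def mult.commute)
    have "((H \<circ> be2) has_vector_derivative ((2 * J 0) * (1 / J' b)) *\<^sub>R g b) (at t)"
      by (rule vector_diff_chain_at[OF db]) (use Hd[OF b] in \<open>simp add: b_def\<close>)
    from bounded_linear.has_vector_derivative[OF bounded_linear_cnj this]
    have "((cnj \<circ> (H \<circ> be2)) has_vector_derivative ((2 * J 0) * (1 / J' b)) *\<^sub>R cnj (g b)) (at t)" by (simp add: o_def)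
    then show "((cnj \<circ> (H \<circ> be2)) has_vector_derivative F (gamma_path c th t) * vector_derivative (gamma_path c th) (at t)) (at t)"
      unfolding vd Fg g_def by (simp add: scaleR_conv_of_real mult_ac)
  qed simp
  have "((\<lambda>t. F (gamma_path c th t) * vector_derivative (gamma_path c th) (at t)) has_integral
     ((H \<circ> be1) (1/2) - (H \<circ> be1) 0) + ((cnj \<circ> (H \<circ> be2)) 1 - (cnj \<circ> (H \<circ> be2)) (1/2))) {0..1}"
    by (rule has_integral_combine[OF _ _ I1 I2]) auto
  moreover have "((H \<circ> be1) (1/2) - (H \<circ> be1) 0) + ((cnj \<circ> (H \<circ> be2)) 1 - (cnj \<circ> (H \<circ> be2)) (1/2)) = \<i> * of_real DV_total"
    using total by (simp add: be1_def be2_def H_def)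
  ultimately show ?thesis unfolding has_contour_integral F_def by simp
qed

end

theorem theorem1p5:
  fixes \<theta> b l :: real and V V' V'' \<psi> :: "real \<Rightarrow> real" and \<mu> :: "real measure"
  assumes "\<theta> > 1"
    and "\<forall>x\<ge>0. (V has_real_derivative V' x) (at x within {0..})"
    and "\<forall>x\<ge>0. (V' has_real_derivative V'' x) (at x within {0..})"
    and "continuous_on {0..} V''"
    and "filterlim (\<lambda>x. V x / ln x) at_top at_top"
    and "prob_space \<mu>"
    and "b > 0"
    and "mu_support \<mu> = {0..b}"
    and "continuous_on {0<..<b} \<psi>"
    and "\<forall>x\<in>{0<..<b}. \<psi> x \<ge> 0"
    and "\<mu> = density lborel (\<lambda>x. ennreal (indicator {0<..<b} x * \<psi> x))"
    and "\<forall>x\<in>mu_support \<mu>.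
           integrable \<mu> (\<lambda>y. ln \<bar>x - y\<bar>) \<and>
           integrable \<mu> (\<lambda>y. ln \<bar>x powr \<theta> - y powr \<theta>\<bar>) \<and>
           (\<integral>y. ln \<bar>x - y\<bar> \<partial>\<mu>) + (\<integral>y. ln \<bar>x powr \<theta> - y powr \<theta>\<bar> \<partial>\<mu>) - V x = l"
    and "\<forall>x\<ge>0. (\<integral>y. ln \<bar>x - y\<bar> \<partial>\<mu>) + (\<integral>y. ln \<bar>x powr \<theta> - y powr \<theta>\<bar> \<partial>\<mu>) - V x \<le> l"
  shows "\<exists>c>0.
           ((\<lambda>s. complex_of_real (V' (Re (Jc c \<theta> s))) * Jc c \<theta> s / s)
              has_contour_integral (2 * pi * \<i> * complex_of_real (1 + \<theta>))) (gamma_path c \<theta>)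
         \<and> b = c * (1 + \<theta>) powr (1 + 1 / \<theta>) / \<theta>
         \<and> (\<forall>x\<in>{0<..<b}.
              (\<lambda>y. (V'' y * y + V' y) *
                    ln (cmod ((Iplus c \<theta> y - Iminus c \<theta> x) / (Iplus c \<theta> y - Iplus c \<theta> x))))
                integrable_on {0..b}
            \<and> \<psi> x = 1 / (2 * pi\<^sup>2 * x) *
                integral {0..b} (\<lambda>y. (V'' y * y + V' y) *
                    ln (cmod ((Iplus c \<theta> y - Iminus c \<theta> x) / (Iplus c \<theta> y - Iplus c \<theta> x)))))"
proof -
  \<comment> \<open>This c is forced by the formula for b; that it solves the contour equation is
    then the vanishing of the edge coefficient.\<close>
  define c where "c = b * \<theta> / (1 + \<theta>) powr (1 + 1 / \<theta>)"
  have th: "\<theta> > 0" "\<theta> \<ge> 1" using assms(1) by auto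
  have pw: "(1 + \<theta>) powr (1 + 1 / \<theta>) > 0" using th by simp
  have c: "c > 0" using assms(7) th pw by (simp add: c_def)
  have b: "b = c * (1 + \<theta>) powr (1 + 1 / \<theta>) / \<theta>" using th pw by (simp add: c_def)
  interpret F: fuss \<theta> c by unfold_locales (use th c in auto)
  have J0: "Jr c \<theta> 0 = b" using F.J_0 b by simp
  interpret E: equil \<theta> c V V' V'' \<psi> \<mu> l
  proof (intro equil.intro F.fuss_axioms equil_axioms.intro)
    show "(V has_real_derivative V' x) (at x within {0..})" if "x \<ge> 0" for x using assms(2) that by blast
    show "(V' has_real_derivative V'' x) (at x within {0..})" if "x \<ge> 0" for x using assms(3) that by blast
    show "continuous_on {0..} V''" "prob_space \<mu>" by (fact assms(4) assms(6))+
    show "continuous_on {0<..<Jr c \<theta> 0} \<psi>" using assms(9) by (simp only: J0)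
    show "\<psi> x \<ge> 0" if "x \<in> {0<..<Jr c \<theta> 0}" for x using assms(10) that unfolding J0 by blast
    show "\<mu> = density lborel (\<lambda>x. ennreal (indicator {0<..<Jr c \<theta> 0} x * \<psi> x))" using assms(11) by (simp only: J0)
  next
    fix x assume "x \<in> {0..Jr c \<theta> 0}"
    then have "x \<in> mu_support \<mu>" using assms(8) J0 by simp
    with assms(12) have e: "integrable \<mu> (\<lambda>y. ln \<bar>x - y\<bar>)" "integrable \<mu> (\<lambda>y. ln \<bar>x powr \<theta> - y powr \<theta>\<bar>)"
      "(\<integral>y. ln \<bar>x - y\<bar> \<partial>\<mu>) + (\<integral>y. ln \<bar>x powr \<theta> - y powr \<theta>\<bar> \<partial>\<mu>) - V x = l" by blast+
    show "integrable \<mu> (\<lambda>y. ln \<bar>x - y\<bar>)" "integrable \<mu> (\<lambda>y. ln \<bar>x powr \<theta> - y powr \<theta>\<bar>)" by (fact e)+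
    show "(\<integral>y. ln \<bar>x - y\<bar> \<partial>\<mu>) + (\<integral>y. ln \<bar>x powr \<theta> - y powr \<theta>\<bar> \<partial>\<mu>) = V x + l" using e(3) by linarith
  qed
  have CC0: "E.edge_coeff = 0" by (rule E.edge_coeff_zero) (use assms(13) in blast)
  have "E.DV_total / (2 * pi * \<theta>) = 1 + 1 / \<theta>" using CC0 by (simp add: E.edge_coeff_def)
  then have DV_total: "E.DV_total = 2 * pi * (1 + \<theta>)" using th by (simp add: field_simps)
  have Jm: "Jmax c \<theta> = Jr c \<theta> 0" using b J0 by (simp add: Jmax_def)
  have ci: "((\<lambda>s. complex_of_real (V' (Re (Jc c \<theta> s))) * Jc c \<theta> s / s)
              has_contour_integral (2 * pi * \<i> * complex_of_real (1 + \<theta>))) (gamma_path c \<theta>)"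
  proof -
    have "\<i> * complex_of_real E.DV_total = 2 * pi * \<i> * complex_of_real (1 + \<theta>)" by (simp add: DV_total)
    then show ?thesis using E.contour_condition[OF th(2) Jm] by (simp only:)
  qed
  show ?thesis
  proof (intro exI[of _ c] conjI ballI)
    fix x assume x: "x \<in> {0<..<b}"
    define f where "f = (\<lambda>y. (V'' y * y + V' y) *
                    ln (cmod ((Iplus c \<theta> y - Iminus c \<theta> x) / (Iplus c \<theta> y - Iplus c \<theta> x))))"
    have "(f has_integral 2 * pi\<^sup>2 * x * \<psi> x) {0..b}"
      using E.density_integral[OF th(2) CC0, of x] x J0 by (simp add: f_def)
    then have fi: "f integrable_on {0..b}" "integral {0..b} f = 2 * pi\<^sup>2 * x * \<psi> x" by auto
    show "(\<lambda>y. (V'' y * y + V' y) *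
                    ln (cmod ((Iplus c \<theta> y - Iminus c \<theta> x) / (Iplus c \<theta> y - Iplus c \<theta> x))))
                integrable_on {0..b}" using fi(1) by (simp only: f_def)
    have "\<psi> x = 1 / (2 * pi\<^sup>2 * x) * integral {0..b} f" using x fi(2) by simp
    then show "\<psi> x = 1 / (2 * pi\<^sup>2 * x) *
                integral {0..b} (\<lambda>y. (V'' y * y + V' y) *
                    ln (cmod ((Iplus c \<theta> y - Iminus c \<theta> x) / (Iplus c \<theta> y - Iplus c \<theta> x))))"
      by (simp only: f_def)
  qed (use c b ci in auto)
qed

end
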